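(* Let $P\subset\mathbb R^2$ be a finite set and let $\beta$ be the $P$-curve that is the boundary of the convex hull of $P$. For every $P$-curve $\gamma_0$, the number of HCS iterations $\gamma_{i+1}=\mathrm{HCS}_P(\gamma_i)$ needed until the curve collapses to a point is at most the number of HCS iterations needed starting from $\beta$. That is, among all $P$-curves, $\beta$ maximizes the number of HCS iterations.
   Context: A path is a continuous map $[0,1]\to\mathbb R^2$ and a (closed) curve is a continuous map $\mathbb S^1\to\mathbb R^2$. $P\subset\mathbb R^2$ is a finite set of points regarded as obstacles. Two curves avoiding $P$ are homotopic if one can be continuously deformed into the other while avoiding $P$ at all times. Two paths with common endpoints that avoid $P$ except possibly at their endpoints are homotopic if one can be deformed into the other with endpoints fixed, avoiding $P$ at all times except possibly at the endpoints. If $\gamma$ avoids $P$ but $\delta$ may touch $P$, "$\gamma$ homotopic to $\delta$" means such a deformation exists that avoids $P$ at all times except possibly at the final moment. For every curve (resp. path) there is a unique shortest curve (resp. path) homotopic to it. A $P$-curve (resp. $P$-path) is a closed (resp. non-closed) polygonal curve composed of straight segments each of which starts and ends at points of $P$. Homotopic curve shortening: for a $P$-curve $\gamma$, $\gamma'=\mathrm{HCS}_P(\gamma)$ is defined as follows. Let $(p_0,\dots,p_{m-1})$ be the circular list of obstacle points visited by $\gamma$ (indices mod $m$). Call $p_i$ nailed if $\angle p_{i-1}p_ip_{i+1}=\pi$. Let $(q_0,\dots,q_{k-1})$ be the circular list of nailed vertices. If $k\ge1$: (1) Splitting: split $\gamma$ at the nailed vertices into $P$-paths $\delta_0,\dots,\delta_{k-1}$,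 $\delta_i$ going from $q_i$ to $q_{i+1}$. (2) Shortcutting: for sufficiently small $\varepsilon>0$, at each non-endpoint vertex $p_i$ of each $\delta_j$, let $C_{p_i}$ be the circle of radius $\varepsilon$ about $p_i$, let $x_i$ be the intersection of segment $p_{i-1}p_i$ with $C_{p_i}$ and $y_i$ that of segment $p_ip_{i+1}$ with $C_{p_i}$, and replace the portion through $p_i$ by the segment $x_iy_i$; call the result $\rho_j$. (3) Shortening: replace each $\rho_j$ by the shortest path homotopic to it; the concatenation is $\gamma'$. If $k=0$, steps (2),(3) are applied to the whole closed curve $\gamma$. Each step strictly shortens the curve, and the process is iterated until the curve collapses to a point, which happens after finitely many steps. *)

theory Defs
  imports "HOL-Analysis.Analysis"
begin

text \<open>The plane R^2 is modelled by the type complex. Paths are maps real => complex,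
  considered on [0,1] (HOL-Analysis convention); a closed curve is a path with
  pathfinish = pathstart.\<close>

definition path_length :: "(real \<Rightarrow> complex) \<Rightarrow> ennreal" where
  "path_length g = Sup {(\<Sum>i<n. ennreal (dist (g (t (Suc i))) (g (t i)))) | n t.
      t 0 = 0 \<and> t n = 1 \<and> (\<forall>i<n. t i \<le> t (Suc i))}"

definition vec_angle :: "complex \<Rightarrow> complex \<Rightarrow> real" where
  "vec_angle u v = \<bar>Arg (u / v)\<bar>"

fun polypath :: "complex list \<Rightarrow> real \<Rightarrow> complex" where
  "polypath [] = linepath 0 0"
| "polypath [p] = linepath p p"
| "polypath [p, q] = linepath p q"
| "polypath (p # q # r # rs) = linepath p q +++ polypath (q # r # rs)"

definition closed_poly :: "complex list \<Rightarrow> real \<Rightarrow> complex" where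
  "closed_poly vs = polypath (vs @ [hd vs])"

definition cyc :: "complex list \<Rightarrow> nat \<Rightarrow> complex" where
  "cyc vs i = vs ! (i mod length vs)"

text \<open>A P-curve, represented by the circular list (p_0,...,p_{m-1}) of obstacle points
  it visits: consecutive points are distinct, and the open segments between
  consecutive points contain no obstacle (so the list is exactly the list of visited
  obstacle points).\<close>
definition pcurve :: "complex set \<Rightarrow> complex list \<Rightarrow> bool" where
  "pcurve P vs \<longleftrightarrow> length vs \<ge> 2 \<and> set vs \<subseteq> P \<and>
     (\<forall>i<length vs. cyc vs i \<noteq> cyc vs (Suc i) \<and>
        open_segment (cyc vs i) (cyc vs (Suc i)) \<inter> P = {})"

definition ppath :: "complex set \<Rightarrow> complex list \<Rightarrow> bool" where
  "ppath P ws \<longleftrightarrow> length ws \<ge> 2 \<and> set ws \<subseteq> P \<and>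
     (\<forall>i. Suc i < length ws \<longrightarrow> ws ! i \<noteq> ws ! Suc i \<and>
        open_segment (ws ! i) (ws ! Suc i) \<inter> P = {})"

definition homotopic_paths_obst :: "complex set \<Rightarrow> (real \<Rightarrow> complex) \<Rightarrow> (real \<Rightarrow> complex) \<Rightarrow> bool" where
  "homotopic_paths_obst P g h \<longleftrightarrow>
     (\<exists>H :: real \<times> real \<Rightarrow> complex. continuous_on ({0..1} \<times> {0..1}) H \<and>
        (\<forall>t\<in>{0..1}. H (0, t) = g t \<and> H (1, t) = h t) \<and>
        (\<forall>s\<in>{0..1}. H (s, 0) = g 0 \<and> H (s, 1) = g 1) \<and>
        (\<forall>s\<in>{0..<1}. \<forall>t\<in>{0<..<1}. H (s, t) \<notin> P))"

definition homotopic_loops_obst :: "complex set \<Rightarrow> (real \<Rightarrow> complex) \<Rightarrow> (real \<Rightarrow> complex) \<Rightarrow> bool" where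
  "homotopic_loops_obst P g h \<longleftrightarrow>
     (\<exists>H :: real \<times> real \<Rightarrow> complex. continuous_on ({0..1} \<times> {0..1}) H \<and>
        (\<forall>t\<in>{0..1}. H (0, t) = g t \<and> H (1, t) = h t) \<and>
        (\<forall>s\<in>{0..1}. H (s, 0) = H (s, 1)) \<and>
        (\<forall>s\<in>{0..<1}. \<forall>t\<in>{0..1}. H (s, t) \<notin> P))"

definition shortest_homotopic_path :: "complex set \<Rightarrow> (real \<Rightarrow> complex) \<Rightarrow> (real \<Rightarrow> complex) \<Rightarrow> bool" where
  "shortest_homotopic_path P g h \<longleftrightarrow> path h \<and> homotopic_paths_obst P g h \<and>
     (\<forall>h'. path h' \<and> homotopic_paths_obst P g h' \<longrightarrow> path_length h \<le> path_length h')"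

definition shortest_homotopic_loop :: "complex set \<Rightarrow> (real \<Rightarrow> complex) \<Rightarrow> (real \<Rightarrow> complex) \<Rightarrow> bool" where
  "shortest_homotopic_loop P g h \<longleftrightarrow> path h \<and> pathfinish h = pathstart h \<and>
     homotopic_loops_obst P g h \<and>
     (\<forall>h'. path h' \<and> pathfinish h' = pathstart h' \<and> homotopic_loops_obst P g h' \<longrightarrow>
        path_length h \<le> path_length h')"

definition nailed :: "complex list \<Rightarrow> nat \<Rightarrow> bool" where
  "nailed vs i \<longleftrightarrow>
     vec_angle (cyc vs (i + length vs - 1) - cyc vs i) (cyc vs (Suc i) - cyc vs i) = pi"

definition sc_x :: "complex list \<Rightarrow> real \<Rightarrow> nat \<Rightarrow> complex" where
  "sc_x vs eps i = cyc vs i + of_real eps * sgn (cyc vs (i + length vs - 1) - cyc vs i)"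

definition sc_y :: "complex list \<Rightarrow> real \<Rightarrow> nat \<Rightarrow> complex" where
  "sc_y vs eps i = cyc vs i + of_real eps * sgn (cyc vs (Suc i) - cyc vs i)"

definition nailed_idx :: "complex list \<Rightarrow> nat list" where
  "nailed_idx vs = filter (nailed vs) [0..<length vs]"

text \<open>Start and end index of the j-th piece delta_j (end index taken modulo length).\<close>
definition piece_start :: "complex list \<Rightarrow> nat \<Rightarrow> nat" where
  "piece_start vs j = nailed_idx vs ! j"

definition piece_end :: "complex list \<Rightarrow> nat \<Rightarrow> nat" where
  "piece_end vs j = (if Suc j < length (nailed_idx vs) then nailed_idx vs ! Suc j
                     else nailed_idx vs ! 0 + length vs)"

definition shortcut_piece :: "complex list \<Rightarrow> real \<Rightarrow> nat \<Rightarrow> complex list" where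
  "shortcut_piece vs eps j =
     [cyc vs (piece_start vs j)] @
     concat (map (\<lambda>l. [sc_x vs eps l, sc_y vs eps l]) [Suc (piece_start vs j)..<piece_end vs j]) @
     [cyc vs (piece_end vs j)]"

definition shortcut_closed :: "complex list \<Rightarrow> real \<Rightarrow> complex list" where
  "shortcut_closed vs eps = concat (map (\<lambda>l. [sc_x vs eps l, sc_y vs eps l]) [0..<length vs])"

text \<open>One HCS step: hcs_step P vs r means r represents HCS_P(vs).  The result r is the
  cyclic vertex list of a P-curve, or has length at most 1 if the curve collapsed to a
  point (r = [x] is the constant curve at x; r = [] arises when all pieces collapse).\<close>
definition hcs_step :: "complex set \<Rightarrow> complex list \<Rightarrow> complex list \<Rightarrow> bool" where
  "hcs_step P vs r \<longleftrightarrow> pcurve P vs \<and>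
     (if nailed_idx vs = [] then
        (length r = 1 \<or> pcurve P r) \<and>
        (\<forall>\<^sub>F eps in at_right 0.
           shortest_homotopic_loop P (closed_poly (shortcut_closed vs eps)) (closed_poly r))
      else
        (\<exists>ws. length ws = length (nailed_idx vs) \<and> r = concat (map tl ws) \<and>
           (\<forall>j<length ws.
              (ppath P (ws ! j) \<or> length (ws ! j) = 1) \<and>
              hd (ws ! j) = cyc vs (piece_start vs j) \<and>
              last (ws ! j) = cyc vs (piece_end vs j) \<and>
              (\<forall>\<^sub>F eps in at_right 0.
                 shortest_homotopic_path P (polypath (shortcut_piece vs eps j)) (polypath (ws ! j))))))"

definition hcs_collapse_steps :: "complex set \<Rightarrow> complex list \<Rightarrow> nat \<Rightarrow> bool" where
  "hcs_collapse_steps P vs n \<longleftrightarrow>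
     (\<exists>seq :: nat \<Rightarrow> complex list. seq 0 = vs \<and>
        (\<forall>i<n. length (seq i) \<ge> 2 \<and> hcs_step P (seq i) (seq (Suc i))) \<and>
        length (seq n) \<le> 1)"

text \<open>beta is the P-curve which is the boundary of the convex hull of P, traversed once:
  its trace is the frontier of the convex hull and it is a shortest such P-curve
  (in the degenerate case of a single point, it is that point).\<close>
definition hull_boundary_curve :: "complex set \<Rightarrow> complex list \<Rightarrow> bool" where
  "hull_boundary_curve P vs \<longleftrightarrow>
     ((length vs = 1 \<and> set vs \<subseteq> P) \<or> pcurve P vs) \<and>
     path_image (closed_poly vs) = frontier (convex hull P) \<and>
     (\<forall>ws. pcurve P ws \<and> path_image (closed_poly ws) = frontier (convex hull P) \<longrightarrow>
        path_length (closed_poly vs) \<le> path_length (closed_poly ws))"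

end

theory Submission
  imports Defs "HOL-Complex_Analysis.Complex_Analysis"
begin

text \<open>
  Let Q be a layer of P, and let the next layer arise from Q by deleting the extreme points of conv Q.
  A shortcut curve with vertices in Q can be pushed to the convex hull of the next layer by the
  nearest-point retraction without meeting an obstacle before the final moment. The retraction strictly
  shortens whatever leaves that hull, so a shortest curve lies inside it. Hence after i steps every
  curve lives in the i-th layer.

  The boundary curve \<open>\<beta>\<close> cannot run ahead of the layers. As long as it is a convex curve around the
  current layer, the shortcut curve has every point p of the next layer strictly on one side. If p
  were outside the hull of the new curve, the integral of 1/(z - p) along the latter would be an
  increment of a branch of the logarithm, hence 0 once around, whereas along the shortcut curve, which
  is homotopic off p, its imaginary part is not 0; so the new curve surrounds the next layer. It is again convex: radially
  projecting the shortcut curve onto the boundary of the hull of the next layer gives a homotopic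
  curve, so the new curve is at most as long as the perimeter of a convex set it surrounds, and the
  Cauchy--Crofton formula then shows that it crosses no line four times. If the layer is collinear,
  convexity is replaced by the fact that the interior points are nailed. So \<open>\<beta>\<close> collapses only
  when the layers have at most one point left, and then any other curve has collapsed too.
\<close>

subsection \<open>Variation and the length of polygons\<close>

text \<open>The relation "homotopic with contact at the final moment" does not compose: its target
  may lie on obstacles, so a deformation cannot simply be continued past it. Competitors for a
  shortest curve are therefore produced by homotopies that start at the shortcut curve itself and
  avoid the obstacles strictly before their end: a rescheduled retraction in
  \<open>retract_homotopy\<close>, straight motion along rays in \<open>piece_length\<close> and
  \<open>loop_length\<close>. For the same reason the winding argument removes one obstacle at a
  time, since only off an obstacle missed by the new curve does the relation become ordinary
  homotopy. The two evolutions are never compared with each other, only with the layers; the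
  boundary curve merely has to keep each layer in its hull, not to equal the boundary of that hull.
  Convexity is carried as \<open>no_alt\<close> because this is what the equality case of the
  Cauchy--Crofton formula yields directly, without any statement on angles or on the order of the
  vertices.\<close>

definition variation :: "(real \<Rightarrow> 'a::metric_space) \<Rightarrow> real \<Rightarrow> real \<Rightarrow> ennreal" where
  "variation f a b = Sup {(\<Sum>i<n. ennreal (dist (f (t (Suc i))) (f (t i)))) | n t.
      t 0 = a \<and> t n = b \<and> (\<forall>i<n. t i \<le> t (Suc i))}"

text \<open>\<open>variation\<close> repeats the formula of \<open>path_length\<close> for an
  arbitrary interval, so that lengths can be cut at intermediate times.\<close>

lemma path_length_variation: "path_length g = variation g 0 1"
  unfolding path_length_def variation_def ..

lemma variation_upper:
  assumes "t 0 = a" "t n = b" "\<And>i. i < n \<Longrightarrow> t i \<le> t (Suc i)"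
  shows "(\<Sum>i<n. ennreal (dist (f (t (Suc i))) (f (t i)))) \<le> variation f a b"
  unfolding variation_def by (rule Sup_upper) (use assms in blast)

lemma variation_least:
  assumes "\<And>n t. t 0 = a \<Longrightarrow> t n = b \<Longrightarrow> (\<And>i. i < n \<Longrightarrow> t i \<le> t (Suc i)) \<Longrightarrow>
    (\<Sum>i<n. ennreal (dist (f (t (Suc i))) (f (t i)))) \<le> C"
  shows "variation f a b \<le> C"
  unfolding variation_def by (rule Sup_least) (use assms in blast)

lemma partition_mono:
  fixes t :: "nat \<Rightarrow> real"
  assumes "\<And>i. i < n \<Longrightarrow> t i \<le> t (Suc i)" "i \<le> j" "j \<le> n"
  shows "t i \<le> t j"
  using assms(2,3)
proof (induction j rule: dec_induct)
  case base
  then show ?case by simp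
next
  case (step k)
  then show ?case using assms(1)[of k] by simp
qed

lemma variation_dist: "a \<le> b \<Longrightarrow> ennreal (dist (f a) (f b)) \<le> variation f a b"
  using variation_upper[of "\<lambda>i. if i = 0 then a else b" a 1 b f] by (simp add: dist_commute)

lemma sum_lessThan_add:
  fixes g :: "nat \<Rightarrow> 'a::comm_monoid_add"
  shows "(\<Sum>i<n+m. g i) = (\<Sum>i<n. g i) + (\<Sum>i<m. g (n+i))"
  by (induction m) (auto simp: ac_simps)

text \<open>Partitions of the two intervals are concatenated; the two suprema are then taken one
  after the other.\<close>

lemma variation_superadd:
  assumes "a \<le> b" "b \<le> c"
  shows "variation f a b + variation f b c \<le> variation f a c"
proof -
  let ?S = "\<lambda>a b. {(\<Sum>i<n. ennreal (dist (f (t (Suc i))) (f (t i)))) | n t.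
      t 0 = a \<and> t n = b \<and> (\<forall>i<n. t i \<le> t (Suc i))}"
  have ne: "?S a b \<noteq> {}" if "a \<le> b" for a b
  proof -
    have "(\<Sum>i<1. ennreal (dist (f ((\<lambda>i::nat. if i = 0 then a else b) (Suc i))) (f ((\<lambda>i::nat. if i = 0 then a else b) i)))) \<in> ?S a b"
      using that by (intro CollectI exI[of _ 1] exI[of _ "\<lambda>i::nat. if i = 0 then a else b"]) auto
    then show ?thesis by blast
  qed
  have *: "x + y \<le> variation f a c" if xy: "x \<in> ?S a b" "y \<in> ?S b c" for x y
  proof -
    obtain n t where t: "x = (\<Sum>i<n. ennreal (dist (f (t (Suc i))) (f (t i))))"
      "t 0 = a" "t n = b" "\<forall>i<n. t i \<le> t (Suc i)" using xy by auto
    obtain m s where s: "y = (\<Sum>i<m. ennreal (dist (f (s (Suc i))) (f (s i))))"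
      "s 0 = b" "s m = c" "\<forall>i<m. s i \<le> s (Suc i)" using xy by auto
    define r where "r = (\<lambda>i. if i \<le> n then t i else s (i - n))"
    have r2: "r (n + i) = s i" for i using t s by (auto simp: r_def)
    have "(\<Sum>i<n+m. ennreal (dist (f (r (Suc i))) (f (r i)))) \<le> variation f a c"
    proof (rule variation_upper)
      show "r i \<le> r (Suc i)" if "i < n + m" for i
      proof (cases "i < n")
        case True
        then show ?thesis using t by (auto simp: r_def)
      next
        case False
        then obtain k where k: "i = n + k" using le_Suc_ex by (metis not_less)
        then show ?thesis using that s r2[of k] r2[of "Suc k"] by auto
      qed
    qed (use t s r2[of m] in \<open>auto simp: r_def\<close>)
    also have "(\<Sum>i<n+m. ennreal (dist (f (r (Suc i))) (f (r i)))) = x + y"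
      unfolding sum_lessThan_add t(1) s(1)
      using r2 by (intro arg_cong2[where f = "(+)"] sum.cong) (auto simp: r_def simp flip: add_Suc_right)
    finally show ?thesis .
  qed
  have "variation f a b + variation f b c = (SUP x\<in>?S a b. x + variation f b c)"
    using ennreal_SUP_add_left[OF ne[OF assms(1)], of "\<lambda>x. x" "variation f b c"] by (simp add: variation_def)
  also have "\<dots> \<le> variation f a c"
  proof (rule SUP_least)
    fix x assume x: "x \<in> ?S a b"
    have "x + variation f b c = (SUP y\<in>?S b c. x + y)"
      using ennreal_SUP_add_right[OF ne[OF assms(2)], of x "\<lambda>x. x"] by (simp add: variation_def)
    also have "\<dots> \<le> variation f a c" by (rule SUP_least) (use * x in blast)
    finally show "x + variation f b c \<le> variation f a c" .
  qed
  finally show ?thesis .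
qed

lemma subadd_aux:
  fixes A B C D E V W :: ennreal
  assumes "A + B \<le> V" "C + D \<le> W" "E \<le> B + C"
  shows "A + E + D \<le> V + W"
proof -
  have "A + E + D \<le> A + (B + C) + D" using assms(3) by (intro add_mono) auto
  also have "\<dots> = (A + B) + (C + D)" by (simp only: ac_simps)
  also have "\<dots> \<le> V + W" using assms by (intro add_mono)
  finally show ?thesis .
qed

lemma variation_subadd:
  assumes "a \<le> b" "b \<le> c"
  shows "variation f a c \<le> variation f a b + variation f b c"
proof (rule variation_least)
  fix n t assume t: "t 0 = a" "t n = c" "\<And>i. i < n \<Longrightarrow> t i \<le> t (Suc i)"
  let ?d = "\<lambda>x y. ennreal (dist (f x) (f y))"
  show "(\<Sum>i<n. ?d (t (Suc i)) (t i)) \<le> variation f a b + variation f b c"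
  proof (cases "c = b")
    case True
    then show ?thesis using variation_upper[OF t, of f] by (metis add_increasing2 zero_le)
  next
    case False
    \<comment> \<open>The last partition index not beyond \<open>b\<close>. Inserting
      \<open>b\<close> between \<open>t k\<close> and \<open>t (Suc k)\<close> splits the partition,
      and the triangle inequality pays for the extra point.\<close>
    define k where "k = (GREATEST i. i \<le> n \<and> t i \<le> b)"
    have ex: "0 \<le> n \<and> t 0 \<le> b" using t assms by auto
    have k: "k \<le> n \<and> t k \<le> b" unfolding k_def by (rule GreatestI_nat[where k = 0 and b = n]) (use ex in auto)
    have kg: "i \<le> k" if "i \<le> n" "t i \<le> b" for i unfolding k_def
      by (rule Greatest_le_nat[where b = n]) (use that in auto)
    have kn: "k < n" using k False t assms by (metis le_neq_implies_less nle_le)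
    have tb: "b \<le> t (Suc k)" using kg[of "Suc k"] kn by linarith
    obtain m where m: "n = Suc k + m" using kn by (metis Suc_leI le_Suc_ex)
    have s1: "(\<Sum>i<Suc k. ?d ((\<lambda>i. if i \<le> k then t i else b) (Suc i)) ((\<lambda>i. if i \<le> k then t i else b) i)) \<le> variation f a b"
      by (rule variation_upper) (use t k kn in \<open>auto simp: less_Suc_eq\<close>)
    have s2: "(\<Sum>i<Suc k. ?d ((\<lambda>i. if i \<le> k then t i else b) (Suc i)) ((\<lambda>i. if i \<le> k then t i else b) i))
      = (\<Sum>i<k. ?d (t (Suc i)) (t i)) + ?d b (t k)"
      unfolding sum.lessThan_Suc by (intro arg_cong2[where f = "(+)"] sum.cong) auto
    have s3: "(\<Sum>i<Suc m. ?d ((\<lambda>i. if i = 0 then b else t (k + i)) (Suc i)) ((\<lambda>i. if i = 0 then b else t (k+i)) i)) \<le> variation f b c"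
      by (rule variation_upper) (use t k kn tb m in auto)
    have s4: "(\<Sum>i<Suc m. ?d ((\<lambda>i. if i = 0 then b else t (k + i)) (Suc i)) ((\<lambda>i. if i = 0 then b else t (k+i)) i))
      = ?d (t (Suc k)) b + (\<Sum>i<m. ?d (t (Suc (Suc k + i))) (t (Suc k + i)))"
      by (subst sum.lessThan_Suc_shift) simp
    have s5: "(\<Sum>i<n. ?d (t (Suc i)) (t i)) = (\<Sum>i<k. ?d (t (Suc i)) (t i)) + ?d (t (Suc k)) (t k)
       + (\<Sum>i<m. ?d (t (Suc (Suc k + i))) (t (Suc k + i)))"
      unfolding m sum_lessThan_add by simp
    have s6: "?d (t (Suc k)) (t k) \<le> ?d b (t k) + ?d (t (Suc k)) b"
      using dist_triangle[of "f (t (Suc k))" "f (t k)" "f b"] by (simp add: add.commute flip: ennreal_plus)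
    show ?thesis
      unfolding s5 by (rule subadd_aux[OF s1[unfolded s2] s3[unfolded s4] s6])
  qed
qed

lemma variation_add:
  assumes "a \<le> b" "b \<le> c"
  shows "variation f a c = variation f a b + variation f b c"
  using variation_superadd[OF assms] variation_subadd[OF assms] by (rule order.antisym[rotated])

text \<open>A monotone \<open>\<alpha>\<close> maps partitions to partitions. The main use has a
  lifted angle for \<open>\<alpha>\<close> and the boundary of a convex set for \<open>Y\<close>: a
  radial projection is bounded by the arc that it sweeps.\<close>

lemma variation_reparam_le:
  assumes eq: "\<And>x. x \<in> {a..b} \<Longrightarrow> f x = Y (\<alpha> x)" and mono: "mono_on {a..b} \<alpha>"
  shows "variation f a b \<le> variation Y (\<alpha> a) (\<alpha> b)"
proof (rule variation_least)
  fix n t assume t: "t 0 = a" "t n = b" "\<And>i. i < n \<Longrightarrow> t i \<le> t (Suc i)"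
  have tin: "t i \<in> {a..b}" if "i \<le> n" for i
    using partition_mono[of n t 0 i] partition_mono[of n t i n] t that by auto
  have "(\<Sum>i<n. ennreal (dist (f (t (Suc i))) (f (t i)))) =
      (\<Sum>i<n. ennreal (dist (Y ((\<alpha> \<circ> t) (Suc i))) (Y ((\<alpha> \<circ> t) i))))"
    by (rule sum.cong) (use eq tin in auto)
  also have "\<dots> \<le> variation Y (\<alpha> a) (\<alpha> b)"
    by (rule variation_upper) (use t tin in \<open>auto intro!: mono_onD[OF mono]\<close>)
  finally show "(\<Sum>i<n. ennreal (dist (f (t (Suc i))) (f (t i)))) \<le> variation Y (\<alpha> a) (\<alpha> b)" .
qed

lemma variation_affine:
  fixes c d :: real
  assumes "c > 0" and eq: "\<And>x. x \<in> {a..b} \<Longrightarrow> f x = Y (c * x + d)"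
  shows "variation f a b = variation Y (c * a + d) (c * b + d)"
proof (rule order.antisym)
  show "variation f a b \<le> variation Y (c * a + d) (c * b + d)"
    using variation_reparam_le[of a b f Y "\<lambda>x. c * x + d"] eq assms(1) by (auto simp: mono_on_def)
  have "variation Y (c * a + d) (c * b + d) \<le> variation f ((c*a+d-d)/c) ((c*b+d-d)/c)"
  proof (rule variation_reparam_le)
    fix x assume x: "x \<in> {c*a+d..c*b+d}"
    have "(x - d)/c \<in> {a..b}" using x assms(1) by (auto simp: field_simps)
    from eq[OF this] show "Y x = f ((x - d)/c)" using assms(1) by simp
  next
    show "mono_on {c*a+d..c*b+d} (\<lambda>x. (x - d)/c)"
      using assms(1) by (auto simp: mono_on_def divide_right_mono)
  qed
  then show "variation Y (c * a + d) (c * b + d) \<le> variation f a b" using assms(1) by simp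
qed

lemma variation_mono_dist:
  assumes "\<And>x y. x \<in> {a..b} \<Longrightarrow> y \<in> {a..b} \<Longrightarrow> dist (f x) (f y) \<le> dist (h x) (h y)"
  shows "variation f a b \<le> variation h a b"
proof (rule variation_least)
  fix n t assume t: "t 0 = a" "t n = b" "\<And>i. i < n \<Longrightarrow> t i \<le> t (Suc i)"
  have tin: "t i \<in> {a..b}" if "i \<le> n" for i
    using partition_mono[of n t 0 i] partition_mono[of n t i n] t that by auto
  have "(\<Sum>i<n. ennreal (dist (f (t (Suc i))) (f (t i)))) \<le> (\<Sum>i<n. ennreal (dist (h (t (Suc i))) (h (t i))))"
    by (rule sum_mono) (use assms tin in \<open>auto intro!: ennreal_leI\<close>)
  also have "\<dots> \<le> variation h a b" by (rule variation_upper) (use t in auto)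
  finally show "(\<Sum>i<n. ennreal (dist (f (t (Suc i))) (f (t i)))) \<le> variation h a b" .
qed

lemma path_length_linepath: "path_length (linepath a b) = ennreal (dist a b)"
proof (rule order.antisym)
  show "path_length (linepath a b) \<le> ennreal (dist a b)"
    unfolding path_length_variation
  proof (rule variation_least)
    fix n and t :: "nat \<Rightarrow> real" assume t: "t 0 = 0" "t n = 1" "\<And>i. i < n \<Longrightarrow> t i \<le> t (Suc i)"
    have lin: "dist (linepath a b x) (linepath a b y) = \<bar>x - y\<bar> * dist a b" for x y
    proof -
      have "linepath a b x - linepath a b y = (x - y) *\<^sub>R (b - a)"
        by (simp add: linepath_def algebra_simps)
      then show ?thesis by (simp add: dist_norm norm_minus_commute)
    qed
    have "(\<Sum>i<n. ennreal (dist (linepath a b (t (Suc i))) (linepath a b (t i)))) =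
       ennreal (\<Sum>i<n. (t (Suc i) - t i) * dist a b)"
      using t by (subst sum_ennreal[symmetric]) (auto simp: lin intro!: sum.cong)
    also have "(\<Sum>i<n. (t (Suc i) - t i) * dist a b) = dist a b"
      using t sum_lessThan_telescope[of t n] by (simp flip: sum_distrib_right)
    finally show "(\<Sum>i<n. ennreal (dist (linepath a b (t (Suc i))) (linepath a b (t i)))) \<le> ennreal (dist a b)" by simp
  qed
  show "ennreal (dist a b) \<le> path_length (linepath a b)"
    unfolding path_length_variation using variation_dist[of 0 1 "linepath a b"] by (simp add: linepath_def)
qed

lemma path_length_join:
  assumes "pathfinish g1 = pathstart g2"
  shows "path_length (g1 +++ g2) = path_length g1 + path_length g2"
proof -
  have "path_length (g1 +++ g2) = variation (g1 +++ g2) 0 (1/2) + variation (g1 +++ g2) (1/2) 1"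
    unfolding path_length_variation by (rule variation_add) auto
  moreover have "variation (g1 +++ g2) 0 (1/2) = path_length g1"
    using variation_affine[of 2 0 "1/2" "g1 +++ g2" g1 0] by (simp add: path_length_variation joinpaths_def)
  moreover have "variation (g1 +++ g2) (1/2) 1 = path_length g2"
    using variation_affine[of 2 "1/2" 1 "g1 +++ g2" g2 "-1"] assms
    by (simp add: path_length_variation joinpaths_def pathfinish_def pathstart_def)
      (smt (verit) atLeastAtMost_iff field_sum_of_halves mult_2)

  ultimately show ?thesis by simp
qed

fun psum :: "('a \<Rightarrow> 'a \<Rightarrow> real) \<Rightarrow> 'a list \<Rightarrow> real" where
  "psum d (p # q # rs) = d p q + psum d (q # rs)"
| "psum d _ = 0"

lemma psum_nonneg: "(\<And>x y. d x y \<ge> 0) \<Longrightarrow> psum d ws \<ge> 0"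
  by (induction d ws rule: psum.induct) auto

lemma polypath_ends:
  assumes "ws \<noteq> []"
  shows "pathstart (polypath ws) = hd ws" "pathfinish (polypath ws) = last ws"
  using assms by (induction ws rule: polypath.induct) auto

lemma path_polypath: "path (polypath ws)"
proof (induction ws rule: polypath.induct)
  case (4 p q r rs)
  then show ?case using polypath_ends(1)[of "q # r # rs"] by simp
qed (simp_all only: polypath.simps path_linepath)

lemma path_length_polypath: "path_length (polypath ws) = ennreal (psum dist ws)"
proof (induction ws rule: polypath.induct)
  case (4 p q r rs)
  have "path_length (polypath (p # q # r # rs)) = ennreal (dist p q) + path_length (polypath (q # r # rs))"
    using polypath_ends(1)[of "q # r # rs"] by (simp add: path_length_join path_length_linepath)
  then show ?case using 4 psum_nonneg[of dist "q # r # rs"] by (simp add: ennreal_plus del: polypath.simps)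
qed (simp_all only: polypath.simps psum.simps path_length_linepath, simp_all)

lemma sum_squares_le_imp_le:
  fixes x y z :: real
  assumes "x\<^sup>2 + y\<^sup>2 \<le> z\<^sup>2" "0 \<le> z"
  shows "x \<le> z"
  using assms zero_le_power2[of y] by (intro power2_le_imp_le[of x z]) linarith

text \<open>The increments of \<open>f\<close> and \<open>g\<close> behave like the legs of a right
  triangle below those of \<open>h\<close>, so a displacement of \<open>g\<close> between the end
  points costs length. Summed over a partition this is Minkowski's inequality.\<close>

lemma variation_pythagoras:
  fixes f g h :: "real \<Rightarrow> complex"
  assumes firm: "\<And>x y. x \<in> {a..b} \<Longrightarrow> y \<in> {a..b} \<Longrightarrow>
      (dist (f x) (f y))\<^sup>2 + (dist (g x) (g y))\<^sup>2 \<le> (dist (h x) (h y))\<^sup>2"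
    and L: "variation h a b = ennreal L" "L \<ge> 0" and "a \<le> b"
  shows "variation f a b \<le> ennreal (sqrt (L\<^sup>2 - (dist (g a) (g b))\<^sup>2))"
proof (rule variation_least)
  fix n t assume t: "t 0 = a" "t n = b" "\<And>i. i < n \<Longrightarrow> t i \<le> t (Suc i)"
  have tin: "t i \<in> {a..b}" if "i \<le> n" for i
    using partition_mono[of n t 0 i] partition_mono[of n t i n] t that by auto
  define F where "F = (\<Sum>i<n. dist (f (t (Suc i))) (f (t i)))"
  define G where "G = (\<Sum>i<n. dist (g (t (Suc i))) (g (t i)))"
  define H where "H = (\<Sum>i<n. dist (h (t (Suc i))) (h (t i)))"
  have "ennreal H \<le> ennreal L"
    unfolding H_def L(1)[symmetric] using variation_upper[OF t, of h] by (subst sum_ennreal[symmetric]) auto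
  then have HL: "H \<le> L" using L(2) by (simp add: ennreal_le_iff)
  have G: "dist (g a) (g b) \<le> G"
  proof -
    have "g b - g a = (\<Sum>i<n. g (t (Suc i)) - g (t i))"
      using sum_lessThan_telescope[of "g \<circ> t" n] t by simp
    then have "dist (g a) (g b) = norm (\<Sum>i<n. g (t (Suc i)) - g (t i))"
      by (metis dist_norm dist_commute)
    also have "\<dots> \<le> G" unfolding G_def dist_norm by (rule norm_sum)
    finally show ?thesis .
  qed
  have FGH: "sqrt (F\<^sup>2 + G\<^sup>2) \<le> H"
  proof -
    \<comment> \<open>Minkowski's inequality as the triangle inequality in the plane, for the
      vectors whose coordinates are the increments of \<open>f\<close> and of
      \<open>g\<close>.\<close>
    have "sqrt (F\<^sup>2 + G\<^sup>2) = norm (\<Sum>i<n. Complex (dist (f (t (Suc i))) (f (t i))) (dist (g (t (Suc i))) (g (t i))))"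
      by (simp add: cmod_def F_def G_def)
    also have "\<dots> \<le> H" unfolding H_def
    proof (rule sum_norm_le)
      fix i assume "i \<in> {..<n}"
      then show "norm (Complex (dist (f (t (Suc i))) (f (t i))) (dist (g (t (Suc i))) (g (t i)))) \<le> dist (h (t (Suc i))) (h (t i))"
        using firm[of "t (Suc i)" "t i"] tin by (auto simp: cmod_def intro: real_le_lsqrt)
    qed
    finally show ?thesis .
  qed
  have F0: "F \<ge> 0" unfolding F_def by (simp add: sum_nonneg)
  have "F\<^sup>2 + G\<^sup>2 \<le> H\<^sup>2" using FGH by (rule sqrt_le_D)
  also have "H\<^sup>2 \<le> L\<^sup>2" using HL by (rule power_mono) (simp add: H_def sum_nonneg)
  finally have "F\<^sup>2 \<le> L\<^sup>2 - (dist (g a) (g b))\<^sup>2"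
    using power_mono[OF G, of 2] by simp
  then have "F \<le> sqrt (L\<^sup>2 - (dist (g a) (g b))\<^sup>2)" using F0 by (simp add: real_le_rsqrt)
  then show "(\<Sum>i<n. ennreal (dist (f (t (Suc i))) (f (t i)))) \<le> ennreal (sqrt (L\<^sup>2 - (dist (g a) (g b))\<^sup>2))"
    unfolding F_def by (subst sum_ennreal) (auto intro!: ennreal_leI)
qed

text \<open>If \<open>g t\<close> differed from \<open>g a\<close>, then \<open>f\<close> would be
  strictly shorter than \<open>h\<close> on \<open>{a..t}\<close>, and it is no longer than
  \<open>h\<close> on the rest. In the applications \<open>f\<close> is the nearest-point image of
  \<open>h\<close> and \<open>g\<close> is the displacement between them.\<close>

lemma variation_eq_imp_complement_const:
  fixes f g h :: "real \<Rightarrow> complex"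
  assumes firm: "\<And>x y. x \<in> {a..b} \<Longrightarrow> y \<in> {a..b} \<Longrightarrow>
      (dist (f x) (f y))\<^sup>2 + (dist (g x) (g y))\<^sup>2 \<le> (dist (h x) (h y))\<^sup>2"
    and fin: "variation h a b < top" and le: "variation h a b \<le> variation f a b"
    and t: "t \<in> {a..b}"
  shows "g t = g a"
proof (rule ccontr)
  assume ne: "g t \<noteq> g a"
  have t': "a \<le> t" "t \<le> b" using t by auto
  have add: "variation h a b = variation h a t + variation h t b" by (rule variation_add[OF t'])
  obtain L where L: "variation h a t = ennreal L" "L \<ge> 0"
    using fin add by (metis ennreal_add_eq_top ennreal_cases less_top)
  have "variation f a t \<le> ennreal (sqrt (L\<^sup>2 - (dist (g a) (g t))\<^sup>2))"
    by (rule variation_pythagoras[OF _ L t'(1)]) (use t in \<open>auto intro!: firm\<close>)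
  also have "\<dots> < ennreal L"
  proof -
    have "dist (g a) (g t) \<le> L"
    proof -
      have "dist (g a) (g t) \<le> dist (h a) (h t)"
        using firm[of t a] t' sum_squares_le_imp_le[of "dist (g a) (g t)" "dist (f a) (f t)"] by (simp add: dist_commute add.commute)
      then have "ennreal (dist (g a) (g t)) \<le> ennreal L"
        using variation_dist[OF t'(1), of h] L by (metis ennreal_leI order_trans)
      then show ?thesis using L by simp
    qed
    moreover have "dist (g a) (g t) > 0" using ne by simp
    ultimately have "L > 0" by linarith
    have "L\<^sup>2 - (dist (g a) (g t))\<^sup>2 < L\<^sup>2" using ne by auto
    then have "sqrt (L\<^sup>2 - (dist (g a) (g t))\<^sup>2) < L"
      using \<open>L > 0\<close> by (intro real_less_lsqrt) auto
    then show ?thesis using \<open>L > 0\<close> by (simp add: ennreal_lessI)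
  qed
  finally have 1: "variation f a t < variation h a t" using L by simp
  have 2: "variation f t b \<le> variation h t b"
  proof (rule variation_mono_dist)
    fix x y assume "x \<in> {t..b}" "y \<in> {t..b}"
    then show "dist (f x) (f y) \<le> dist (h x) (h y)"
      using sum_squares_le_imp_le[OF firm[of x y]] t' by simp
  qed
  \<comment> \<open>Finiteness of the remaining part permits the cancellation in
    \<open>ennreal\<close>.\<close>
  have "variation h t b < top" using fin add by (metis ennreal_add_eq_top less_top)
  then have fin': "variation h t b \<noteq> \<infinity>" by simp
  have "variation f a t + variation f t b \<le> variation h t b + variation f a t"
    using add_left_mono[OF 2, of "variation f a t"] by (simp only: add.commute)
  also have "\<dots> < variation h t b + variation h a t"
    using fin' 1 by (simp only: ennreal_add_left_cancel_less) simp
  finally have "variation f a b < variation h a b"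
    unfolding add variation_add[OF t', of f] by (simp only: add.commute)
  then show False using le by simp
qed

subsection \<open>Retraction onto a convex set\<close>

text \<open>Stopping at \<open>s < 1\<close> keeps outer points outside \<open>K\<close>, so a
  homotopy built from this map reaches \<open>K\<close> only at its final moment.\<close>

definition retr :: "complex set \<Rightarrow> real \<Rightarrow> complex \<Rightarrow> complex" where
  "retr K s z = (1 - s) *\<^sub>R z + s *\<^sub>R closest_point K z"

lemma retr_in: "z \<in> K \<Longrightarrow> retr K s z = z"
  by (simp add: retr_def closest_point_self flip: scaleR_add_left)

lemma retr_0 [simp]: "retr K 0 z = z" and retr_1 [simp]: "retr K 1 z = closest_point K z"
  by (auto simp: retr_def)

lemma retr_diff: "retr K s z - closest_point K z = (1 - s) *\<^sub>R (z - closest_point K z)"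
  by (simp add: retr_def algebra_simps)

text \<open>A point of \<open>K\<close> on the way would be closer to \<open>z\<close> than the
  nearest point is.\<close>

lemma retr_notin:
  assumes "closed K" "z \<notin> K" "0 \<le> s" "s < 1"
  shows "retr K s z \<notin> K"
proof
  assume "retr K s z \<in> K"
  then have "dist z (closest_point K z) \<le> dist z (retr K s z)"
    by (rule closest_point_le[OF assms(1)])
  also have "dist z (retr K s z) = s * dist z (closest_point K z)"
  proof -
    have "z - retr K s z = s *\<^sub>R (z - closest_point K z)" by (simp add: retr_def algebra_simps)
    then show ?thesis using assms(3) by (simp add: dist_norm)
  qed
  finally have "dist z (closest_point K z) * (1 - s) \<le> 0" by (simp add: algebra_simps)
  then have "dist z (closest_point K z) \<le> 0" using assms(4) by (simp add: mult_le_0_iff)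
  then have "z = closest_point K z" by simp
  moreover have "closest_point K z \<in> K"
    using closest_point_in_set[OF assms(1)] \<open>retr K s z \<in> K\<close> by blast
  ultimately show False using assms(2) by simp
qed

lemma continuous_on_retr:
  assumes "convex K" "closed K" "K \<noteq> {}" "continuous_on S f" "continuous_on S t"
  shows "continuous_on S (\<lambda>x. retr K (t x) (f x))"
  unfolding retr_def
  by (intro continuous_intros assms continuous_on_compose2[OF continuous_on_closest_point[OF assms(1-3), of UNIV]]) auto

text \<open>Firm nonexpansiveness of the projection. Expanding the norm of \<open>x - y\<close>
  leaves two cross terms, and both have the right sign because the displacement of a point makes no
  acute angle with any direction into \<open>K\<close>.\<close>

lemma closest_point_firm:
  fixes K :: "complex set"
  assumes "convex K" "closed K" "K \<noteq> {}"
  shows "(dist (closest_point K x) (closest_point K y))\<^sup>2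
     + (dist (x - closest_point K x) (y - closest_point K y))\<^sup>2 \<le> (dist x y)\<^sup>2"
proof -
  let ?a = "closest_point K x" and ?b = "closest_point K y"
  have a: "?a \<in> K" and b: "?b \<in> K" using closest_point_in_set[OF assms(2,3)] by auto
  have "(x - ?a) \<bullet> (?b - ?a) \<le> 0" "(y - ?b) \<bullet> (?a - ?b) \<le> 0"
    using closest_point_dot[OF assms(1,2)] a b by auto
  moreover have "(norm (x - y))\<^sup>2 = (norm (?a - ?b))\<^sup>2 + (norm ((x - ?a) - (y - ?b)))\<^sup>2
      - 2 * ((x - ?a) \<bullet> (?b - ?a)) - 2 * ((y - ?b) \<bullet> (?a - ?b))"
    unfolding power2_norm_eq_inner by (simp add: inner_diff_left inner_diff_right inner_commute)
  ultimately show ?thesis unfolding dist_norm by linarith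
qed

section \<open>Shortest homotopic curves stay inside a convex core\<close>

lemma homotopic_paths_obstE:
  assumes "homotopic_paths_obst P g h"
  obtains H :: "real \<times> real \<Rightarrow> complex" where "continuous_on ({0..1} \<times> {0..1}) H"
     "\<And>t. t\<in>{0..1} \<Longrightarrow> H (0, t) = g t \<and> H (1, t) = h t"
     "\<And>s. s\<in>{0..1} \<Longrightarrow> H (s, 0) = g 0 \<and> H (s, 1) = g 1"
     "\<And>s t. s\<in>{0..<1} \<Longrightarrow> t\<in>{0<..<1} \<Longrightarrow> H (s, t) \<notin> P"
  using assms unfolding homotopic_paths_obst_def
  by (elim exE conjE, rule_tac H = H in that) (simp_all only: Ball_def, simp_all)

lemma homotopic_loops_obstE:
  assumes "homotopic_loops_obst P g h"
  obtains H :: "real \<times> real \<Rightarrow> complex" where "continuous_on ({0..1} \<times> {0..1}) H"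
     "\<And>t. t\<in>{0..1} \<Longrightarrow> H (0, t) = g t \<and> H (1, t) = h t"
     "\<And>s. s\<in>{0..1} \<Longrightarrow> H (s, 0) = H (s, 1)"
     "\<And>s t. s\<in>{0..<1} \<Longrightarrow> t\<in>{0..1} \<Longrightarrow> H (s, t) \<notin> P"
  using assms unfolding homotopic_loops_obst_def
  by (elim exE conjE, rule_tac H = H in that) (simp_all only: Ball_def, simp_all)

text \<open>Running \<open>H\<close> to its end and retracting afterwards is impossible, since the
  end may already touch obstacles. Instead the start curve is retracted up to a time
  \<open>r\<close> near 1, as \<open>st\<close> permits, and only then is \<open>H\<close> run while
  the retraction goes on to \<open>q\<close>. From time \<open>r\<close> on nothing is met before
  the end: inner points do not move, and outer points stay outside \<open>K\<close> but closer to it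
  than any obstacle outside \<open>K\<close>. The set \<open>A\<close> is the open interval for
  paths and the closed one for loops; the last clause lets fixed end points and closedness be
  inherited.\<close>

lemma retract_homotopy:
  fixes H :: "real \<times> real \<Rightarrow> complex"
  assumes P: "finite P" and K: "convex K" "compact K" "K \<noteq> {}"
    and H: "continuous_on ({0..1} \<times> {0..1}) H"
    and A: "A \<subseteq> {0..1}" and av: "\<And>s t. s \<in> {0..<1} \<Longrightarrow> t \<in> A \<Longrightarrow> H (s, t) \<notin> P"
    and st: "\<And>s t. s \<in> {0..<1} \<Longrightarrow> t \<in> A \<Longrightarrow> retr K s (H (0, t)) \<notin> P"
  obtains r where "r < 1" "0 \<le> r" "\<And>q. r \<le> q \<Longrightarrow> q \<le> 1 \<Longrightarrow>
     \<exists>G :: real \<times> real \<Rightarrow> complex. continuous_on ({0..1} \<times> {0..1}) G \<and>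
       (\<forall>t\<in>{0..1}. G (0, t) = H (0, t) \<and> G (1, t) = retr K q (H (1, t))) \<and>
       (\<forall>s\<in>{0..<1}. \<forall>t\<in>A. G (s, t) \<notin> P) \<and>
       (\<forall>s\<in>{0..1}. \<exists>k\<in>{0..1}. \<exists>u\<in>{0..1}. \<forall>t. G (s, t) = retr K u (H (k, t)))"
proof -
  have clK: "closed K" using K compact_imp_closed by blast
  have "compact (H ` ({0..1} \<times> {0..1}) \<union> K)"
    using H K by (intro compact_Un compact_continuous_image compact_Times) auto
  then obtain e where e: "\<forall>x \<in> H ` ({0..1} \<times> {0..1}) \<union> K. \<forall>y \<in> H ` ({0..1} \<times> {0..1}) \<union> K. dist x y \<le> e"
    using compact_imp_bounded bounded_two_points by metis
  obtain B where B: "B > 0" "\<And>x y. x \<in> H ` ({0..1} \<times> {0..1}) \<union> K \<Longrightarrow> y \<in> H ` ({0..1} \<times> {0..1}) \<union> K \<Longrightarrow> dist x y \<le> B"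
    by (rule that[of "max 1 e"]) (use e in \<open>auto simp: le_max_iff_disj\<close>)
  obtain d where d: "d > 0" "\<And>p y. p \<in> P - K \<Longrightarrow> y \<in> K \<Longrightarrow> d \<le> dist p y"
  proof -
    have "closed (P - K)" "compact K" using P K by (auto intro: finite_imp_closed)
    moreover have "(P - K) \<inter> K = {}" by auto
    ultimately show ?thesis using that separate_closed_compact[of "P - K" K] by blast
  qed
  \<comment> \<open>\<open>B\<close> bounds every displacement, and obstacles outside
    \<open>K\<close> have distance at least \<open>d\<close> from \<open>K\<close>; after time
    \<open>r\<close> the remaining displacement is below \<open>d\<close>.\<close>
  define r where "r = 1 - min 1 (d / (2 * B))"
  have r: "r < 1" "0 \<le> r" "(1 - r) * B < d"
  proof -
    show "r < 1" "0 \<le> r" using d B by (auto simp: r_def min_def)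
    have "(1 - r) * B \<le> d / (2 * B) * B" unfolding r_def using B(1) by (intro mult_right_mono) auto
    also have "\<dots> < d" using B(1) d(1) by simp
    finally show "(1 - r) * B < d" .
  qed
  have near: "retr K u z \<notin> P" if "r \<le> u" "u < 1" "z \<notin> P" "z \<in> H ` ({0..1} \<times> {0..1})" for u z
  proof (cases "z \<in> K")
    case True
    then show ?thesis using that retr_in by simp
  next
    case False
    have nK: "retr K u z \<notin> K" using retr_notin[OF clK False] that r by simp
    have cK: "closest_point K z \<in> K" using closest_point_in_set[OF clK K(3)] .
    have "dist (retr K u z) (closest_point K z) = (1 - u) * dist z (closest_point K z)"
      unfolding dist_norm retr_diff using that by simp
    also have "\<dots> \<le> (1 - r) * B" using that cK B by (intro mult_mono) auto
    finally have "dist (retr K u z) (closest_point K z) < d" using r by simp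
    then show ?thesis using d(2)[OF _ cK, of "retr K u z"] nK by force
  qed
  show thesis
  proof (rule that[OF r(1,2)])
    fix q assume q: "r \<le> q" "q \<le> 1"
    \<comment> \<open>The schedule: up to \<open>s = 1/2\<close> only the retraction time
      \<open>\<tau>\<close> grows, from 0 to \<open>r\<close>; afterwards \<open>\<tau>\<close> goes
      from \<open>r\<close> to \<open>q\<close> while the stage \<open>\<kappa>\<close> of
      \<open>H\<close> runs from 0 to 1.\<close>
    define \<tau> where "\<tau> s = min (2 * s) 1 * r + (q - r) * max 0 (2 * s - 1)" for s :: real
    define \<kappa> where "\<kappa> s = max 0 (2 * s - 1)" for s :: real
    have \<tau>1: "\<tau> s \<in> {0..<1}" "s \<le> 1/2 \<or> r \<le> \<tau> s" if "s \<in> {0..<1}" for s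
    proof -
      show "s \<le> 1/2 \<or> r \<le> \<tau> s" using that q by (auto simp: \<tau>_def min_def)
      show "\<tau> s \<in> {0..<1}"
      proof (cases "s \<le> 1/2")
        case True
        then have "\<tau> s = 2 * s * r" using that by (auto simp: \<tau>_def min_def max_def)
        moreover have "2 * s * r \<le> 1 * r" using True r by (intro mult_right_mono) auto
        ultimately show ?thesis using that r by auto
      next
        case False
        then have e: "\<tau> s = r + (q - r) * (2 * s - 1)" using that by (auto simp: \<tau>_def min_def max_def)
        have "(q - r) * (2 * s - 1) \<le> (1 - r) * (2 * s - 1)" using False q by (intro mult_right_mono) auto
        also have "\<dots> < (1 - r) * 1" using that r by (intro mult_strict_left_mono) auto
        finally have "\<tau> s < 1" using e by simp
        moreover have "(q - r) * (2 * s - 1) \<ge> 0" using False q by simp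
        ultimately show ?thesis using e r by simp
      qed
    qed
    have \<tau>e: "\<tau> 0 = 0" "\<tau> 1 = q" by (auto simp: \<tau>_def)
    have \<kappa>1: "\<kappa> s \<in> {0..1}" if "s \<in> {0..1}" for s using that by (auto simp: \<kappa>_def)
    have \<kappa>2: "\<kappa> s < 1" if "s \<in> {0..<1}" for s using that by (auto simp: \<kappa>_def)
    define G where "G = (\<lambda>(s, t). retr K (\<tau> s) (H (\<kappa> s, t)))"
    show "\<exists>G :: real \<times> real \<Rightarrow> complex. continuous_on ({0..1} \<times> {0..1}) G \<and>
       (\<forall>t\<in>{0..1}. G (0, t) = H (0, t) \<and> G (1, t) = retr K q (H (1, t))) \<and>
       (\<forall>s\<in>{0..<1}. \<forall>t\<in>A. G (s, t) \<notin> P) \<and>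
       (\<forall>s\<in>{0..1}. \<exists>k\<in>{0..1}. \<exists>u\<in>{0..1}. \<forall>t. G (s, t) = retr K u (H (k, t)))"
    proof (intro exI[of _ G] conjI ballI)
      show "continuous_on ({0..1} \<times> {0..1}) G"
        unfolding G_def case_prod_beta
      proof (rule continuous_on_retr[OF K(1) clK K(3)])
        show "continuous_on ({0..1} \<times> {0..1}) (\<lambda>x. H (\<kappa> (fst x), snd x))"
        proof (rule continuous_on_compose2[OF H])
          show "continuous_on ({0..1} \<times> {0..1}) (\<lambda>x. (\<kappa> (fst x), snd x))"
            unfolding \<kappa>_def by (intro continuous_intros)
        qed (use \<kappa>1 in auto)
        show "continuous_on ({0..1} \<times> {0..1}) (\<lambda>x. \<tau> (fst x :: real))"
          unfolding \<tau>_def by (intro continuous_intros)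
      qed
      show "G (0, t) = H (0, t)" for t by (simp add: G_def \<tau>e \<kappa>_def)
      show "G (1, t) = retr K q (H (1, t))" for t by (simp add: G_def \<tau>e \<kappa>_def)
      show "G (s, t) \<notin> P" if s: "s \<in> {0..<1}" and t: "t \<in> A" for s t
      proof (cases "s \<le> 1/2")
        case True
        then have "\<kappa> s = 0" by (simp add: \<kappa>_def)
        then show ?thesis using st[OF \<tau>1(1)[OF s] t] by (simp add: G_def)
      next
        case False
        then have "r \<le> \<tau> s" "\<tau> s < 1" using \<tau>1[OF s] by auto
        moreover have "\<kappa> s \<in> {0..1}" using \<kappa>1[of s] s by auto
        ultimately show ?thesis
          using near[of "\<tau> s" "H (\<kappa> s, t)"] av[of "\<kappa> s" t] \<kappa>2[OF s] t A by (auto simp: G_def)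
      qed
      show "\<exists>k\<in>{0..1}. \<exists>u\<in>{0..1}. \<forall>t. G (s, t) = retr K u (H (k, t))" if "s \<in> {0..1}" for s
      proof -
        have "\<tau> s \<in> {0..1}"
        proof (cases "s = 1")
          case True
          then show ?thesis using \<tau>e q r by simp
        next
          case False
          then show ?thesis using \<tau>1(1)[of s] that by auto
        qed
        then show ?thesis using \<kappa>1[OF that]
          by (intro bexI[of _ "\<kappa> s"] bexI[of _ "\<tau> s"]) (simp_all add: G_def)
      qed
    qed
  qed
qed

text \<open>The nearest-point image of \<open>h\<close> is itself homotopic to \<open>g\<close>, so
  by minimality it is not shorter than \<open>h\<close>, and the displacement must be constant. It
  vanishes at the end points, which lie in \<open>K\<close>.\<close>

lemma shortest_homotopic_path_subset_convex:
  assumes P: "finite P" and K: "convex K" "compact K" "K \<noteq> {}"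
    and sh: "shortest_homotopic_path P g h" and fin: "path_length h < top"
    and ends: "g 0 \<in> K" "g 1 \<in> K"
    and st: "\<And>s t. s \<in> {0..<1} \<Longrightarrow> t \<in> {0<..<1} \<Longrightarrow> retr K s (g t) \<notin> P"
  shows "path_image h \<subseteq> K"
proof -
  have clK: "closed K" using K compact_imp_closed by blast
  obtain H :: "real \<times> real \<Rightarrow> complex" where H: "continuous_on ({0..1} \<times> {0..1}) H"
     "\<And>t. t\<in>{0..1} \<Longrightarrow> H (0, t) = g t \<and> H (1, t) = h t"
     "\<And>s. s\<in>{0..1} \<Longrightarrow> H (s, 0) = g 0 \<and> H (s, 1) = g 1"
     "\<And>s t. s\<in>{0..<1} \<Longrightarrow> t\<in>{0<..<1} \<Longrightarrow> H (s, t) \<notin> P"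
    by (rule homotopic_paths_obstE[OF conjunct1[OF conjunct2[OF sh[unfolded shortest_homotopic_path_def]]]]) (rule that)
  obtain r where r: "r < 1" "0 \<le> r" "\<And>q. r \<le> q \<Longrightarrow> q \<le> 1 \<Longrightarrow>
     \<exists>G :: real \<times> real \<Rightarrow> complex. continuous_on ({0..1} \<times> {0..1}) G \<and>
       (\<forall>t\<in>{0..1}. G (0, t) = H (0, t) \<and> G (1, t) = retr K q (H (1, t))) \<and>
       (\<forall>s\<in>{0..<1}. \<forall>t\<in>{0<..<1}. G (s, t) \<notin> P) \<and>
       (\<forall>s\<in>{0..1}. \<exists>k\<in>{0..1}. \<exists>u\<in>{0..1}. \<forall>t. G (s, t) = retr K u (H (k, t)))"
    by (rule retract_homotopy[OF P K H(1), of "{0<..<1}"]) (use H st in auto)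
  obtain G :: "real \<times> real \<Rightarrow> complex" where G: "continuous_on ({0..1} \<times> {0..1}) G"
       "\<And>t. t\<in>{0..1} \<Longrightarrow> G (0, t) = H (0, t) \<and> G (1, t) = retr K 1 (H (1, t))"
       "\<And>s t. s\<in>{0..<1} \<Longrightarrow> t\<in>{0<..<1} \<Longrightarrow> G (s, t) \<notin> P"
       "\<And>s. s\<in>{0..1} \<Longrightarrow> \<exists>k\<in>{0..1}. \<exists>u\<in>{0..1}. \<forall>t. G (s, t) = retr K u (H (k, t))"
    using r(3)[of 1] r(1) by (auto simp del: retr_1)
  have cont: "continuous_on UNIV (closest_point K)" by (rule continuous_on_closest_point[OF K(1) clK K(3)])
  have ph: "path h" using sh by (simp add: shortest_homotopic_path_def)
  have "homotopic_paths_obst P g (closest_point K \<circ> h)"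
    unfolding homotopic_paths_obst_def
  proof (intro exI[of _ G] conjI ballI)
    fix t :: real assume t: "t \<in> {0..1}"
    show "G (0, t) = g t" "G (1, t) = (closest_point K \<circ> h) t" using G(2)[OF t] H(2)[OF t] by auto
    show "G (t, 0) = g 0" "G (t, 1) = g 1"
      using G(4)[OF t] H(3) ends retr_in by (auto simp: Ball_def Bex_def) 
  qed (use G in auto)
  moreover have "path (closest_point K \<circ> h)"
    using ph cont unfolding path_def by (metis continuous_on_compose continuous_on_subset subset_UNIV)
  ultimately have le: "path_length h \<le> path_length (closest_point K \<circ> h)"
    using sh by (simp add: shortest_homotopic_path_def)
  have h0: "h 0 = g 0" using H(2)[of 0] H(3)[of 1] by simp
  have "h t \<in> K" if t: "t \<in> {0..1}" for t
  proof -
    have "(\<lambda>t. h t - closest_point K (h t)) t = (\<lambda>t. h t - closest_point K (h t)) 0"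
    proof (rule variation_eq_imp_complement_const[of 0 1 "closest_point K \<circ> h" _ h])
      show "variation h 0 1 < top" using fin by (simp add: path_length_variation)
      show "variation h 0 1 \<le> variation (closest_point K \<circ> h) 0 1" using le by (simp add: path_length_variation)
    qed (use closest_point_firm[OF K(1) clK K(3)] t in auto)
    then have "h t = closest_point K (h t)" using h0 ends by (simp add: closest_point_self)
    then show ?thesis using closest_point_in_set[OF clK K(3)] by metis
  qed
  then show ?thesis by (auto simp: path_image_def)
qed

text \<open>Once the final loop is free of obstacles as well, the relation is ordinary homotopy in
  the complement, which is transitive and open to Cauchy's theorem.\<close>

lemma homotopic_loops_obst_imp:
  assumes "homotopic_loops_obst P g h" "\<And>t. t \<in> {0..1} \<Longrightarrow> h t \<notin> P"
  shows "homotopic_loops (- P) g h"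
proof -
  obtain H :: "real \<times> real \<Rightarrow> complex" where H: "continuous_on ({0..1} \<times> {0..1}) H"
     "\<And>t. t\<in>{0..1} \<Longrightarrow> H (0, t) = g t \<and> H (1, t) = h t"
     "\<And>s. s\<in>{0..1} \<Longrightarrow> H (s, 0) = H (s, 1)"
     "\<And>s t. s\<in>{0..<1} \<Longrightarrow> t\<in>{0..1} \<Longrightarrow> H (s, t) \<notin> P"
    by (rule homotopic_loops_obstE[OF assms(1)]) (rule that)
  have "H (s, t) \<notin> P" if "s \<in> {0..1}" "t \<in> {0..1}" for s t
    using H(2)[OF that(2)] H(4)[of s t] assms(2)[OF that(2)] that by (cases "s = 1") auto
  then show ?thesis unfolding homotopic_loops
    using H by (intro exI[of _ H]) (auto simp: pathfinish_def pathstart_def)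
qed

lemma homotopic_loops_imp_obst:
  assumes "homotopic_loops (- P) g h"
  shows "homotopic_loops_obst P g h"
proof -
  obtain H :: "real \<times> real \<Rightarrow> complex" where H: "continuous_on ({0..1} \<times> {0..1}) H" "H \<in> ({0..1} \<times> {0..1}) \<rightarrow> - P"
     "\<forall>x\<in>{0..1}. H (0, x) = g x" "\<forall>x\<in>{0..1}. H (1, x) = h x"
     "\<forall>t\<in>{0..1}. pathfinish (H \<circ> Pair t) = pathstart (H \<circ> Pair t)"
    using assms unfolding homotopic_loops by (elim exE conjE) (rule that)
  show ?thesis unfolding homotopic_loops_obst_def
  proof (intro exI[of _ H] conjI ballI)
    show "H (s, t) \<notin> P" if "s \<in> {0..<1}" "t \<in> {0..1}" for s t
    proof -
      have "(s, t) \<in> {0..1} \<times> {0..1}" using that by auto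
      then show ?thesis using H(2) by (metis ComplD PiE)
    qed
  qed (use H in \<open>auto simp: pathfinish_def pathstart_def\<close>)
qed

text \<open>Without fixed end points, minimality only makes the displacement a constant vector
  \<open>c\<close>. If \<open>c\<close> were not 0, the loop would be a translate of a loop in a
  face of \<open>K\<close>; stopped slightly earlier or later on its way to that face it misses all
  obstacles and can be contracted inside the translated face, against its positive length.\<close>

lemma shortest_homotopic_loop_subset_convex:
  assumes P: "finite P" and K: "convex K" "compact K" "K \<noteq> {}"
    and sh: "shortest_homotopic_loop P g h" and fin: "path_length h < top" "path_length h \<noteq> 0"
    and st: "\<And>s t. s \<in> {0..<1} \<Longrightarrow> t \<in> {0..1} \<Longrightarrow> retr K s (g t) \<notin> P"
  shows "path_image h \<subseteq> K"
proof -
  have clK: "closed K" using K compact_imp_closed by blast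
  obtain H :: "real \<times> real \<Rightarrow> complex" where H: "continuous_on ({0..1} \<times> {0..1}) H"
     "\<And>t. t\<in>{0..1} \<Longrightarrow> H (0, t) = g t \<and> H (1, t) = h t"
     "\<And>s. s\<in>{0..1} \<Longrightarrow> H (s, 0) = H (s, 1)"
     "\<And>s t. s\<in>{0..<1} \<Longrightarrow> t\<in>{0..1} \<Longrightarrow> H (s, t) \<notin> P"
    by (rule homotopic_loops_obstE[OF conjunct1[OF conjunct2[OF conjunct2[OF sh[unfolded shortest_homotopic_loop_def]]]]]) (rule that)
  obtain r where r: "r < 1" "0 \<le> r" "\<And>q. r \<le> q \<Longrightarrow> q \<le> 1 \<Longrightarrow>
     \<exists>G :: real \<times> real \<Rightarrow> complex. continuous_on ({0..1} \<times> {0..1}) G \<and>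
       (\<forall>t\<in>{0..1}. G (0, t) = H (0, t) \<and> G (1, t) = retr K q (H (1, t))) \<and>
       (\<forall>s\<in>{0..<1}. \<forall>t\<in>{0..1}. G (s, t) \<notin> P) \<and>
       (\<forall>s\<in>{0..1}. \<exists>k\<in>{0..1}. \<exists>u\<in>{0..1}. \<forall>t. G (s, t) = retr K u (H (k, t)))"
    by (rule retract_homotopy[OF P K H(1), of "{0..1}"]) (use H st in auto)
  have cont: "continuous_on UNIV (closest_point K)" by (rule continuous_on_closest_point[OF K(1) clK K(3)])
  have ph: "path h" "pathfinish h = pathstart h" using sh by (auto simp: shortest_homotopic_loop_def)
  have hom: "homotopic_loops_obst P g (\<lambda>t. retr K q (h t))" if q: "r \<le> q" "q \<le> 1" for q
  proof -
    obtain G :: "real \<times> real \<Rightarrow> complex" where G: "continuous_on ({0..1} \<times> {0..1}) G"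
       "\<And>t. t\<in>{0..1} \<Longrightarrow> G (0, t) = H (0, t) \<and> G (1, t) = retr K q (H (1, t))"
       "\<And>s t. s\<in>{0..<1} \<Longrightarrow> t\<in>{0..1} \<Longrightarrow> G (s, t) \<notin> P"
       "\<And>s. s\<in>{0..1} \<Longrightarrow> \<exists>k\<in>{0..1}. \<exists>u\<in>{0..1}. \<forall>t. G (s, t) = retr K u (H (k, t))"
      using r(3)[OF q] by blast
    have "G (s, 0) = G (s, 1)" if "s \<in> {0..1}" for s
      using G(4)[OF that] H(3) by metis
    then show ?thesis unfolding homotopic_loops_obst_def using G H(2) by (intro exI[of _ G]) auto
  qed
  have "path (\<lambda>t. closest_point K (h t))"
    using ph(1) cont unfolding path_def by (metis continuous_on_compose2 subset_UNIV)
  then have le: "path_length h \<le> path_length (\<lambda>t. closest_point K (h t))"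
    using sh hom[of 1] r(1) ph(2) by (simp add: shortest_homotopic_loop_def pathfinish_def pathstart_def)
  define c where "c = h 0 - closest_point K (h 0)"
  have c: "h t - closest_point K (h t) = c" if t: "t \<in> {0..1}" for t
    unfolding c_def
  proof (rule variation_eq_imp_complement_const[of 0 1 "\<lambda>t. closest_point K (h t)" "\<lambda>t. h t - closest_point K (h t)" h])
    show "variation h 0 1 < top" using fin by (simp add: path_length_variation)
    show "variation h 0 1 \<le> variation (\<lambda>t. closest_point K (h t)) 0 1" using le by (simp add: path_length_variation)
  qed (use closest_point_firm[OF K(1) clK K(3)] t in auto)
  have inK: "closest_point K z \<in> K" for z using closest_point_in_set[OF clK K(3)] .
  have "c = 0"
  proof (rule ccontr)
    assume c0: "c \<noteq> 0"
    \<comment> \<open>All nearest points maximise \<open>c \<bullet> k\<close> over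
      \<open>K\<close>, so the projected loop runs in one face of \<open>K\<close>.\<close>
    define M where "M = c \<bullet> closest_point K (h 0)"
    have dot: "c \<bullet> k \<le> c \<bullet> closest_point K (h t)" if "k \<in> K" "t \<in> {0..1}" for k t
      using closest_point_dot[OF K(1) clK that(1), of "h t"] c[OF that(2)] by (simp add: inner_diff_right)
    have M: "c \<bullet> k \<le> M" if "k \<in> K" for k using dot[OF that, of 0] by (simp add: M_def)
    have Mh: "c \<bullet> closest_point K (h t) = M" if "t \<in> {0..1}" for t
      using M[OF inK, of "h t"] dot[OF inK that, of "h 0"] by (simp add: M_def)
    \<comment> \<open>The finitely many \<open>q\<close> for which an obstacle lies on the line that
      carries the loop retracted up to time \<open>q\<close>; for any other \<open>q\<close> the
      translated face \<open>W\<close> is free of obstacles.\<close>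
    define bad where "bad = (\<lambda>p. 1 - (c \<bullet> p - M) / (c \<bullet> c)) ` P"
    have "finite bad" using P by (simp add: bad_def)
    then have "infinite ({r<..<1} - bad)" using r(1) by (simp add: Diff_infinite_finite)
    then obtain q where q: "r < q" "q < 1" "q \<notin> bad"
      by (metis Diff_iff finite.emptyI greaterThanLessThan_iff ex_in_conv)
    define W where "W = (\<lambda>k. k + (1 - q) *\<^sub>R c) ` (K \<inter> {k. c \<bullet> k = M})"
    have "W = (+) ((1 - q) *\<^sub>R c) ` (K \<inter> {k. c \<bullet> k = M})"
      by (simp add: W_def add.commute)
    then have "convex W" using K(1) by (simp add: convex_translation convex_Int convex_hyperplane)
    have WP: "W \<subseteq> - P"
    proof
      fix p assume "p \<in> W"
      then obtain k where "p = k + (1 - q) *\<^sub>R c" "c \<bullet> k = M" by (auto simp: W_def)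
      then have "c \<bullet> p = M + (1 - q) * (c \<bullet> c)" by (simp add: inner_add_right)
      then have "q = 1 - (c \<bullet> p - M) / (c \<bullet> c)" using c0 by simp
      then show "p \<in> - P" using q(3) by (auto simp: bad_def)
    qed
    define L where "L = (\<lambda>t. retr K q (h t))"
    have LW: "L t \<in> W" if "t \<in> {0..1}" for t
    proof -
      have "L t = closest_point K (h t) + (1 - q) *\<^sub>R c"
        using retr_diff[of K q "h t"] c[OF that] by (simp add: L_def algebra_simps)
      then show ?thesis using Mh[OF that] inK by (auto simp: W_def)
    qed
    have 1: "homotopic_loops (- P) g L"
      by (rule homotopic_loops_obst_imp) (use hom[of q] q LW WP in \<open>auto simp: L_def\<close>)
    have 2: "homotopic_loops (- P) L (linepath (L 0) (L 0))"
    proof (rule homotopic_loops_linear)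
      show "path L" using homotopic_loops_imp_path[OF 1] by blast
      show "pathfinish L = pathstart L" using homotopic_loops_imp_loop[OF 1] by blast
      show "closed_segment (L t) (linepath (L 0) (L 0) t) \<subseteq> - P" if "t \<in> {0..1}" for t
        using closed_segment_subset[OF LW[OF that] LW[of 0] \<open>convex W\<close>] WP by auto
    qed auto
    have "homotopic_loops_obst P g (linepath (L 0) (L 0))"
      by (rule homotopic_loops_imp_obst[OF homotopic_loops_trans[OF 1 2]])
    then have "path_length h \<le> path_length (linepath (L 0) (L 0))"
      using conjunct2[OF conjunct2[OF conjunct2[OF sh[unfolded shortest_homotopic_loop_def]]], rule_format, of "linepath (L 0) (L 0)"]
      by (simp del: linepath_refl)
    then show False using fin(2) by (simp add: path_length_linepath del: linepath_refl)
  qed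
  then have "h t \<in> K" if "t \<in> {0..1}" for t using c[OF that] inK[of "h t"] by simp
  then show ?thesis by (auto simp: path_image_def)
qed

subsection \<open>Shortcutting a polygonal curve\<close>

lemma path_image_polypath_subset:
  assumes "length ws \<ge> 2" "successively (\<lambda>p q. closed_segment p q \<subseteq> B) ws"
  shows "path_image (polypath ws) \<subseteq> B"
  using assms
proof (induction ws rule: polypath.induct)
  case (4 p q r rs)
  then have "path_image (polypath (q # r # rs)) \<subseteq> B" "closed_segment p q \<subseteq> B" by auto
  then show ?case using path_image_join_subset[of "linepath p q" "polypath (q # r # rs)"] by auto
qed auto

lemma polypath_left_open:
  assumes "us \<noteq> []" "successively (\<lambda>p q. closed_segment p q \<subseteq> B) us"
    "closed_segment (last us) b - {b} \<subseteq> B" "last us \<noteq> b" "0 \<le> t" "t < 1"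
  shows "polypath (us @ [b]) t \<in> B"
  using assms
proof (induction us arbitrary: t rule: induct_list012)
  case (2 a)
  have "linepath a b t \<noteq> b"
  proof
    assume "linepath a b t = b"
    then have "(1 - t) *\<^sub>R (a - b) = 0" by (simp add: linepath_def algebra_simps)
    then show False using 2 by simp
  qed
  moreover have "linepath a b t \<in> closed_segment a b" using 2 by (simp add: linepath_in_path)
  ultimately show ?case using 2 by auto
next
  case (3 a a' us)
  obtain c cs where c: "us @ [b] = c # cs" by (cases us) auto
  have p: "polypath ((a # a' # us) @ [b]) = linepath a a' +++ polypath ((a' # us) @ [b])"
    using c by simp
  show ?case
  proof (cases "t \<le> 1/2")
    case True
    then have "linepath a a' (2 * t) \<in> closed_segment a a'" using 3 by (intro linepath_in_path) auto
    then show ?thesis using 3 True unfolding p by (auto simp: joinpaths_def)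
  next
    case False
    have "polypath ((a' # us) @ [b]) (2 * t - 1) \<in> B"
      by (rule 3(2)) (use 3 False in auto)
    then show ?thesis using False unfolding p by (simp add: joinpaths_def)
  qed
qed simp

text \<open>The end points of a piece are obstacles, so an obstacle-free region \<open>B\<close>
  contains the piece only at interior parameters; hence the first and the last edge enter without
  their outer end.\<close>

lemma polypath_interior:
  assumes "us \<noteq> []" "successively (\<lambda>p q. closed_segment p q \<subseteq> B) us"
    "closed_segment a (hd us) - {a} \<subseteq> B" "a \<noteq> hd us"
    "closed_segment (last us) b - {b} \<subseteq> B" "last us \<noteq> b" "0 < t" "t < 1"
  shows "polypath (a # us @ [b]) t \<in> B"
proof -
  obtain u us' where us: "us = u # us'" using assms(1) by (cases us) auto
  obtain c cs where c: "us' @ [b] = c # cs" by (cases us') auto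
  have p: "polypath (a # us @ [b]) = linepath a u +++ polypath (us @ [b])"
    using c us by simp
  show ?thesis
  proof (cases "t \<le> 1/2")
    case True
    have "linepath a u (2 * t) \<noteq> a"
    proof
      assume "linepath a u (2 * t) = a"
      then have "(2 * t) *\<^sub>R (u - a) = 0" by (simp add: linepath_def algebra_simps)
      then show False using assms us by simp
    qed
    moreover have "linepath a u (2 * t) \<in> closed_segment a u" using assms True by (intro linepath_in_path) auto
    ultimately show ?thesis using assms us True unfolding p by (auto simp: joinpaths_def)
  next
    case False
    have "polypath (us @ [b]) (2 * t - 1) \<in> B"
      by (rule polypath_left_open) (use assms False in auto)
    then show ?thesis using False unfolding p by (simp add: joinpaths_def)
  qed
qed

lemma set_subset_path_image_polypath:
  assumes "ws \<noteq> []"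
  shows "set ws \<subseteq> path_image (polypath ws)"
  using assms
proof (induction ws rule: polypath.induct)
  case (4 p q r rs)
  have e: "polypath (p # q # r # rs) = linepath p q +++ polypath (q # r # rs)" by simp
  have "path_image (polypath (p # q # r # rs)) = closed_segment p q \<union> path_image (polypath (q # r # rs))"
    unfolding e using polypath_ends(1)[of "q # r # rs"] by (subst path_image_join) auto
  then show ?case using 4 by auto
qed auto

lemma polypath_image_subset_hull: "ws \<noteq> [] \<Longrightarrow> path_image (polypath ws) \<subseteq> convex hull (set ws)"
proof (induction ws rule: polypath.induct)
  case (4 p q r rs)
  have e: "polypath (p # q # r # rs) = linepath p q +++ polypath (q # r # rs)" by simp
  have "path_image (polypath (p # q # r # rs)) \<subseteq> closed_segment p q \<union> path_image (polypath (q # r # rs))"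
    unfolding e using path_image_join_subset by fastforce
  moreover have "closed_segment p q \<subseteq> convex hull (set (p # q # r # rs))"
    by (intro closed_segment_subset hull_inc convex_convex_hull) auto
  moreover have "path_image (polypath (q # r # rs)) \<subseteq> convex hull (set (p # q # r # rs))"
    using 4 hull_mono[of "set (q # r # rs)" "set (p # q # r # rs)" convex] by auto
  ultimately show ?case by blast
qed (auto simp: segment_convex_hull)

section \<open>Cyclic indices, edges and nailed vertices\<close>

lemma cyc_in_set: "vs \<noteq> [] \<Longrightarrow> cyc vs i \<in> set vs"
  by (simp add: cyc_def)

lemma cyc_add_length: "cyc vs (i + length vs) = cyc vs i"
  by (simp add: cyc_def)

lemma cyc_mod: "cyc vs (i mod length vs) = cyc vs i"
  by (simp add: cyc_def)

lemma cyc_pred: "vs \<noteq> [] \<Longrightarrow> cyc vs (Suc k + length vs - 1) = cyc vs k"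
  by (simp add: cyc_def)

lemma cyc_Suc_mod: "cyc vs (Suc (i mod length vs)) = cyc vs (Suc i)"
  by (simp add: cyc_def mod_Suc_eq)

lemma pcurve_edge:
  assumes "pcurve P vs"
  shows "cyc vs i \<in> P" "cyc vs i \<noteq> cyc vs (Suc i)" "open_segment (cyc vs i) (cyc vs (Suc i)) \<inter> P = {}"
proof -
  have ne: "vs \<noteq> []" using assms by (auto simp: pcurve_def)
  show "cyc vs i \<in> P" using assms cyc_in_set[OF ne] by (auto simp: pcurve_def)
  have "i mod length vs < length vs" using ne by simp
  then have "cyc vs (i mod length vs) \<noteq> cyc vs (Suc (i mod length vs)) \<and>
    open_segment (cyc vs (i mod length vs)) (cyc vs (Suc (i mod length vs))) \<inter> P = {}"
    using assms unfolding pcurve_def by blast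
  then show "cyc vs i \<noteq> cyc vs (Suc i)" "open_segment (cyc vs i) (cyc vs (Suc i)) \<inter> P = {}"
    by (simp_all add: cyc_mod cyc_Suc_mod)
qed

lemma vec_angle_pi_iff:
  assumes "u \<noteq> 0" "w \<noteq> 0"
  shows "vec_angle u w = pi \<longleftrightarrow> (\<exists>k>0. u = - (k *\<^sub>R w))"
proof
  assume "vec_angle u w = pi"
  then have "Arg (u / w) = pi" unfolding vec_angle_def using mpi_less_Arg[of "u/w"] by linarith
  then have "Re (u / w) < 0" "Im (u / w) = 0" by (auto simp: Arg_eq_pi)
  then have "u / w = - of_real (- Re (u / w))" by (simp add: complex_eq_iff)
  then have "u = - of_real (- Re (u / w)) * w" using assms by (metis nonzero_eq_divide_eq)
  then show "\<exists>k>0. u = - (k *\<^sub>R w)" using \<open>Re (u / w) < 0\<close>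
    by (intro exI[of _ "- Re (u / w)"]) (simp add: scaleR_conv_of_real)
next
  assume "\<exists>k>0. u = - (k *\<^sub>R w)"
  then obtain k where k: "k > 0" "u = - (k *\<^sub>R w)" by blast
  then have "u / w = - of_real k" using assms by (simp add: scaleR_conv_of_real)
  then have "Arg (u / w) = pi" using k by (simp add: Arg_eq_pi)
  then show "vec_angle u w = pi" by (simp add: vec_angle_def)
qed

lemma in_open_segment_iff_opposite:
  fixes a b c :: complex
  assumes "a \<noteq> b" "c \<noteq> b"
  shows "b \<in> open_segment a c \<longleftrightarrow> (\<exists>k>0. a - b = - (k *\<^sub>R (c - b)))"
proof
  assume "b \<in> open_segment a c"
  then obtain u where u: "0 < u" "u < 1" "b = (1 - u) *\<^sub>R a + u *\<^sub>R c" by (auto simp: in_segment)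
  have "(1 - u) *\<^sub>R (a - b) = - (u *\<^sub>R (c - b))"
  proof -
    have "(1 - u) *\<^sub>R (a - b) + u *\<^sub>R (c - b) = ((1 - u) *\<^sub>R a + u *\<^sub>R c) - b"
      by (simp add: algebra_simps)
    also have "\<dots> = 0" using u(3) by simp
    finally show ?thesis by (simp add: eq_neg_iff_add_eq_0)
  qed
  then have "(1 / (1 - u)) *\<^sub>R ((1 - u) *\<^sub>R (a - b)) = (1 / (1 - u)) *\<^sub>R (- (u *\<^sub>R (c - b)))" by simp
  then have "a - b = - ((u / (1 - u)) *\<^sub>R (c - b))" using u by simp
  then show "\<exists>k>0. a - b = - (k *\<^sub>R (c - b))" using u by (intro exI[of _ "u / (1 - u)"]) auto
next
  assume "\<exists>k>0. a - b = - (k *\<^sub>R (c - b))"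
  then obtain k where k: "k > 0" "a - b = - (k *\<^sub>R (c - b))" by blast
  have ac: "a \<noteq> c"
  proof
    assume "a = c"
    then have "(1 + k) *\<^sub>R (c - b) = 0" using k by (simp add: algebra_simps)
    then show False using k assms by simp
  qed
  have "(1 + k) *\<^sub>R b = a + k *\<^sub>R c" using k(2) by (simp add: algebra_simps)
  moreover have "(1 + k) *\<^sub>R ((1 - k / (1 + k)) *\<^sub>R a + (k / (1 + k)) *\<^sub>R c) = a + k *\<^sub>R c"
  proof -
    have l: "(1 + k) * (1 - k / (1 + k)) = 1" "(1 + k) * (k / (1 + k)) = k" using k by (auto simp: field_simps)
    show ?thesis by (simp only: scaleR_add_right scaleR_scaleR l scaleR_one)
  qed
  ultimately have "b = (1 - k / (1 + k)) *\<^sub>R a + (k / (1 + k)) *\<^sub>R c"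
    using k by (metis add_pos_pos less_irrefl scaleR_left_imp_eq zero_less_one)
  then show "b \<in> open_segment a c" using k ac by (auto simp: in_segment intro!: exI[of _ "k / (1 + k)"])
qed

text \<open>Stated at a successor index so that the preceding vertex is \<open>cyc vs k\<close>,
  without the subtraction in \<open>nailed\<close>.\<close>

lemma nailed_Suc_iff:
  assumes "pcurve P vs"
  shows "nailed vs (Suc k) \<longleftrightarrow> cyc vs (Suc k) \<in> open_segment (cyc vs k) (cyc vs (Suc (Suc k)))"
proof -
  have ne: "vs \<noteq> []" using assms by (auto simp: pcurve_def)
  show ?thesis
    unfolding nailed_def cyc_pred[OF ne]
    using pcurve_edge(2)[OF assms, of k] pcurve_edge(2)[OF assms, of "Suc k"]
    by (subst vec_angle_pi_iff) (auto simp: in_open_segment_iff_opposite)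
qed

lemma nailed_mod: "nailed vs (i mod length vs) \<longleftrightarrow> nailed vs i"
proof (cases "vs = []")
  case False
  have "(i mod length vs + length vs - 1) mod length vs = (i + length vs - 1) mod length vs"
  proof -
    have "length vs \<ge> 1" using False by (simp add: Suc_leI)
    then have "i mod length vs + length vs - 1 = i mod length vs + (length vs - 1)"
      "i + length vs - 1 = i + (length vs - 1)" by auto
    then show ?thesis by (simp only: mod_add_left_eq)
  qed
  then show ?thesis unfolding nailed_def
    by (simp add: cyc_mod cyc_Suc_mod) (simp add: cyc_def)
qed simp

lemma nailed_add_length: "nailed vs (i + length vs) \<longleftrightarrow> nailed vs i"
  using nailed_mod[of vs "i + length vs"] nailed_mod[of vs i] by simp

section \<open>Cut points and chords\<close>

lemma sc_x_Suc: "vs \<noteq> [] \<Longrightarrow> sc_x vs eps (Suc k) = cyc vs (Suc k) + of_real eps * sgn (cyc vs k - cyc vs (Suc k))"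
  unfolding sc_x_def by (subst cyc_pred) auto

lemma sc_x_add_length: "vs \<noteq> [] \<Longrightarrow> sc_x vs eps (k + length vs) = sc_x vs eps k"
  unfolding sc_x_def cyc_add_length
  using cyc_add_length[of vs "k + length vs - 1"] by (simp add: Suc_leI)

lemma sc_y_add_length: "sc_y vs eps (k + length vs) = sc_y vs eps k"
  unfolding sc_y_def using cyc_add_length[of vs "Suc k"] by (simp add: cyc_add_length)

text \<open>With twice the radius below every distance of two obstacles, the cut point
  \<open>sc_y\<close> comes before the next \<open>sc_x\<close> on each edge, and a chord can reach
  no obstacle other than its own vertex.\<close>

definition small_radius :: "complex set \<Rightarrow> real \<Rightarrow> bool" where
  "small_radius P eps \<longleftrightarrow> eps > 0 \<and> (\<forall>p\<in>P. \<forall>q\<in>P. p \<noteq> q \<longrightarrow> 2 * eps < dist p q)"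

lemma eventually_less_at_right_0:
  fixes c :: real
  assumes "c > 0"
  shows "\<forall>\<^sub>F e in at_right 0. k * e < c"
proof -
  have "((\<lambda>e. k * e) \<longlongrightarrow> k * 0) (at_right 0)" by (intro tendsto_intros)
  then show ?thesis using order_tendstoD(2)[of "\<lambda>e. k * e" "k * 0" "at_right 0" c] assms by simp
qed

lemma eventually_small_radius:
  assumes "finite P"
  shows "\<forall>\<^sub>F eps in at_right 0. small_radius P eps"
proof -
  have "\<forall>\<^sub>F eps in at_right 0. \<forall>p\<in>P. \<forall>q\<in>P. p \<noteq> q \<longrightarrow> 2 * eps < dist p q"
    using assms by (intro eventually_ball_finite ballI) (auto intro: eventually_less_at_right_0)
  moreover have "\<forall>\<^sub>F eps::real in at_right 0. eps > 0" by (rule eventually_at_right_less)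
  ultimately show ?thesis unfolding small_radius_def by eventually_elim auto
qed

lemma edge_points:
  fixes a b :: complex
  assumes "0 < eps" "2 * eps < dist a b"
  shows "a + of_real eps * sgn (b - a) \<in> open_segment a b"
proof -
  have ab: "a \<noteq> b" using assms by auto
  have "a + of_real eps * sgn (b - a) = (1 - eps / dist a b) *\<^sub>R a + (eps / dist a b) *\<^sub>R b"
    using ab by (simp add: sgn_div_norm scaleR_conv_of_real dist_norm norm_minus_commute field_simps)
  moreover have "0 < dist a b" using ab by simp
  then have "0 < eps / dist a b" "eps / dist a b < 1" using assms by (auto simp: field_simps)
  ultimately show ?thesis using ab by (auto simp: in_segment)
qed

lemma sc_y_in_edge:
  assumes "pcurve P vs" "small_radius P eps"
  shows "sc_y vs eps i \<in> open_segment (cyc vs i) (cyc vs (Suc i))"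
  unfolding sc_y_def using assms pcurve_edge[OF assms(1), of i] pcurve_edge(1)[OF assms(1), of "Suc i"]
  by (intro edge_points) (auto simp: small_radius_def)

lemma sc_x_in_edge:
  assumes "pcurve P vs" "small_radius P eps"
  shows "sc_x vs eps (Suc i) \<in> open_segment (cyc vs i) (cyc vs (Suc i))"
proof -
  have "vs \<noteq> []" using assms by (auto simp: pcurve_def)
  then have "sc_x vs eps (Suc i) = cyc vs (Suc i) + of_real eps * sgn (cyc vs i - cyc vs (Suc i))"
    by (rule sc_x_Suc)
  also have "\<dots> \<in> open_segment (cyc vs (Suc i)) (cyc vs i)"
    using assms pcurve_edge[OF assms(1), of i] pcurve_edge(1)[OF assms(1), of "Suc i"]
    by (intro edge_points) (auto simp: small_radius_def)
  finally show ?thesis by (metis open_segment_commute)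
qed

lemma sc_edge_subset:
  assumes "pcurve P vs" "small_radius P eps"
  shows "closed_segment (sc_y vs eps i) (sc_x vs eps (Suc i)) \<subseteq> open_segment (cyc vs i) (cyc vs (Suc i))"
  using sc_y_in_edge[OF assms] sc_x_in_edge[OF assms] by (intro closed_segment_subset) auto

lemma half_segment_subset:
  fixes a b x :: complex
  assumes "x \<in> open_segment a b"
  shows "closed_segment a x - {a} \<subseteq> open_segment a b"
proof
  fix z assume z: "z \<in> closed_segment a x - {a}"
  obtain u where u: "0 < u" "u < 1" "x = (1 - u) *\<^sub>R a + u *\<^sub>R b" and ab: "a \<noteq> b"
    using assms by (auto simp: in_segment)
  obtain w where w: "0 \<le> w" "w \<le> 1" "z = (1 - w) *\<^sub>R a + w *\<^sub>R x" using z by (auto simp: in_segment)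
  have "w \<noteq> 0" using w z by auto
  then have "0 < w * u" "w * u < 1" using w u mult_le_one[of w u]
    by (auto simp: mult_less_cancel_right1) (smt (verit) mult_less_cancel_right1 mult_less_cancel_right2)
  moreover have "z = (1 - w * u) *\<^sub>R a + (w * u) *\<^sub>R b" unfolding w(3) u(3) by (simp add: algebra_simps)
  ultimately show "z \<in> open_segment a b" using ab by (auto simp: in_segment)
qed

lemma chord_near:
  assumes "z \<in> closed_segment (sc_x vs eps i) (sc_y vs eps i)" "eps > 0"
  shows "dist z (cyc vs i) \<le> eps"
proof -
  have "norm (of_real eps * sgn w :: complex) \<le> eps" for w :: complex
    using assms(2) by (simp add: norm_mult norm_sgn)
  then have "sc_x vs eps i \<in> cball (cyc vs i) eps" "sc_y vs eps i \<in> cball (cyc vs i) eps"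
    by (auto simp: sc_x_def sc_y_def dist_norm)
  then have "closed_segment (sc_x vs eps i) (sc_y vs eps i) \<subseteq> cball (cyc vs i) eps"
    by (intro closed_segment_subset) auto
  then show ?thesis using assms by (auto simp: dist_commute)
qed

text \<open>Only the vertex itself is within reach of the chord. The chord joins two points at the
  same distance from the vertex, so it passes through it only if the two edge directions are
  opposite, which is the nailed case.\<close>

lemma chord_avoids:
  assumes vs: "pcurve P vs" "small_radius P eps" and nn: "\<not> nailed vs (Suc k)"
    and z: "z \<in> closed_segment (sc_x vs eps (Suc k)) (sc_y vs eps (Suc k))"
  shows "z \<notin> P"
proof
  assume zP: "z \<in> P"
  have ne: "vs \<noteq> []" using vs by (auto simp: pcurve_def)
  have eps: "eps > 0" using vs by (simp add: small_radius_def)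
  have zv: "z = cyc vs (Suc k)"
    using chord_near[OF z eps] zP pcurve_edge(1)[OF vs(1), of "Suc k"] vs(2) by (force simp: small_radius_def)
  define a where "a = sgn (cyc vs k - cyc vs (Suc k))"
  define b where "b = sgn (cyc vs (Suc (Suc k)) - cyc vs (Suc k))"
  have nz: "cyc vs k - cyc vs (Suc k) \<noteq> 0" "cyc vs (Suc (Suc k)) - cyc vs (Suc k) \<noteq> 0"
    using pcurve_edge(2)[OF vs(1), of k] pcurve_edge(2)[OF vs(1), of "Suc k"] by auto
  have n1: "norm a = 1" "norm b = 1" using nz by (auto simp: a_def b_def norm_sgn)
  obtain u where u: "0 \<le> u" "u \<le> 1" "z = (1 - u) *\<^sub>R sc_x vs eps (Suc k) + u *\<^sub>R sc_y vs eps (Suc k)"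
    using z by (auto simp: in_segment)
  have "z = cyc vs (Suc k) + eps *\<^sub>R ((1 - u) *\<^sub>R a + u *\<^sub>R b)"
    unfolding u(3) sc_x_Suc[OF ne] sc_y_def a_def b_def by (simp add: algebra_simps scaleR_conv_of_real)
  then have 0: "(1 - u) *\<^sub>R a + u *\<^sub>R b = 0" using eps zv by simp
  then have "(1 - u) *\<^sub>R a = - (u *\<^sub>R b)" by (simp add: eq_neg_iff_add_eq_0)
  then have "norm ((1 - u) *\<^sub>R a) = norm (- (u *\<^sub>R b))" by simp
  then have u12: "u = 1/2" using u n1 by simp
  have "(1/2) *\<^sub>R (a + b) = 0" using 0 unfolding u12 by (simp add: scaleR_add_right)
  then have ab: "a = - b" by (simp add: eq_neg_iff_add_eq_0)
  define k1 where "k1 = norm (cyc vs k - cyc vs (Suc k))"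
  define k2 where "k2 = norm (cyc vs (Suc (Suc k)) - cyc vs (Suc k))"
  have "cyc vs k - cyc vs (Suc k) = k1 *\<^sub>R a" unfolding a_def k1_def using nz by (simp add: sgn_div_norm)
  also have "\<dots> = - ((k1 / k2) *\<^sub>R (cyc vs (Suc (Suc k)) - cyc vs (Suc k)))"
    unfolding ab b_def k2_def sgn_div_norm by (simp add: divide_inverse)
  finally have "vec_angle (cyc vs k - cyc vs (Suc k)) (cyc vs (Suc (Suc k)) - cyc vs (Suc k)) = pi"
    using nz by (subst vec_angle_pi_iff) (auto simp: k1_def k2_def intro!: exI[of _ "k1 / k2"])
  then show False using nn unfolding nailed_def cyc_pred[OF ne] by blast
qed

lemma chord_in_hull:
  assumes vs: "pcurve P vs" "small_radius P eps"
  shows "closed_segment (sc_x vs eps (Suc k)) (sc_y vs eps (Suc k)) \<subseteq> convex hull (set vs)"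
proof (rule closed_segment_subset)
  have ne: "vs \<noteq> []" using vs by (auto simp: pcurve_def)
  have "open_segment (cyc vs i) (cyc vs (Suc i)) \<subseteq> convex hull (set vs)" for i
    by (meson closed_segment_subset convex_convex_hull cyc_in_set hull_inc ne open_closed_segment subset_iff)
  then show "sc_x vs eps (Suc k) \<in> convex hull (set vs)" "sc_y vs eps (Suc k) \<in> convex hull (set vs)"
    using sc_x_in_edge[OF vs] sc_y_in_edge[OF vs] by blast+
qed simp

text \<open>The vertex list of a shortcut curve: chords from \<open>f l\<close> to
  \<open>g l\<close> alternate with edge parts from \<open>g l\<close> to \<open>f (Suc l)\<close>.
  Keeping \<open>f\<close> and \<open>g\<close> abstract lets the same induction serve for points,
  for points paired with angles, and for every relation along the list.\<close>

definition interleave :: "(nat \<Rightarrow> 'a) \<Rightarrow> (nat \<Rightarrow> 'a) \<Rightarrow> nat \<Rightarrow> nat \<Rightarrow> 'a list" where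
  "interleave f g m n = concat (map (\<lambda>l. [f l, g l]) [m..<n])"

lemma interleave_Suc: "m \<le> n \<Longrightarrow> interleave f g m (Suc n) = interleave f g m n @ [f n, g n]"
  by (simp add: interleave_def)

lemma interleave_props:
  assumes "m < n"
  shows "interleave f g m n \<noteq> []" "hd (interleave f g m n) = f m" "last (interleave f g m n) = g (n - 1)"
proof -
  obtain n' where "n = Suc n'" "m \<le> n'" using assms by (cases n) auto
  then show "last (interleave f g m n) = g (n - 1)" by (simp add: interleave_Suc)
qed (use assms in \<open>simp_all add: interleave_def upt_conv_Cons\<close>)

lemma interleave_successively:
  assumes "m < n" and chord: "\<And>l. m \<le> l \<Longrightarrow> l < n \<Longrightarrow> R (f l) (g l)"
    and edge: "\<And>l. m \<le> l \<Longrightarrow> Suc l < n \<Longrightarrow> R (g l) (f (Suc l))"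
  shows "successively R (interleave f g m n)"
  using assms
proof (induction n)
  case (Suc n)
  show ?case
  proof (cases "m = n")
    case True
    then show ?thesis using Suc by (simp add: interleave_def)
  next
    case False
    then have mn: "m < n" using Suc by simp
    then have "successively R (interleave f g m n)" using Suc by auto
    moreover have "R (g (n - 1)) (f n)" using Suc(4)[of "n - 1"] mn by auto
    ultimately show ?thesis
      using mn interleave_props[OF mn, of f g] Suc(3)[of n] by (simp add: interleave_Suc successively_append_iff)
  qed
qed simp

text \<open>A piece between two adjacent nailed vertices has no chord at all; this single edge is
  the case \<open>short\<close>.\<close>

lemma wrap_successively:
  assumes "s < e" and chord: "\<And>l. s < l \<Longrightarrow> l < e \<Longrightarrow> R (f l) (g l)"
    and edge: "\<And>l. s < l \<Longrightarrow> Suc l < e \<Longrightarrow> R (g l) (f (Suc l))"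
    and short: "e = Suc s \<Longrightarrow> R p q"
    and ends: "Suc s < e \<Longrightarrow> R p (f (Suc s))" "Suc s < e \<Longrightarrow> R (g (e - 1)) q"
  shows "successively R (p # interleave f g (Suc s) e @ [q])"
proof (cases "e = Suc s")
  case True
  then show ?thesis using short by (simp add: interleave_def)
next
  case False
  then have se: "Suc s < e" using assms(1) by simp
  have "successively R (interleave f g (Suc s) e)"
    by (rule interleave_successively[OF se]) (use chord edge in auto)
  then show ?thesis using interleave_props[OF se, of f g] ends[OF se]
    by (simp add: successively_append_iff successively_Cons)
qed

lemma closed_successively:
  assumes "0 < n" "\<And>l. R (f l) (g l)" "\<And>l. R (g l) (f (Suc l))" "f n = q"
  shows "successively R (interleave f g 0 n @ [q])"
proof -
  have "successively R (interleave f g 0 n)"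
    by (rule interleave_successively[OF assms(1)]) (use assms in auto)
  then show ?thesis using interleave_props[OF assms(1), of f g] assms(4) assms(3)[of "n - 1"] assms(1)
    by (simp add: successively_append_iff)
qed

section \<open>Shortcut pieces and shortcut loops\<close>

lemma shortcut_piece_eq:
  "shortcut_piece vs eps j = cyc vs (piece_start vs j) #
     interleave (sc_x vs eps) (sc_y vs eps) (Suc (piece_start vs j)) (piece_end vs j) @ [cyc vs (piece_end vs j)]"
  by (simp add: shortcut_piece_def interleave_def)

lemma shortcut_closed_eq: "shortcut_closed vs eps = interleave (sc_x vs eps) (sc_y vs eps) 0 (length vs)"
  by (simp add: shortcut_closed_def interleave_def)

lemma closed_poly_shortcut_closed:
  assumes "vs \<noteq> []"
  shows "closed_poly (shortcut_closed vs eps) =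
     polypath (interleave (sc_x vs eps) (sc_y vs eps) 0 (length vs) @ [sc_x vs eps 0])"
  using interleave_props(2)[of 0 "length vs" "sc_x vs eps" "sc_y vs eps"] assms
  by (simp add: closed_poly_def shortcut_closed_eq)

text \<open>The last piece wraps around, so its end index is at least \<open>length vs\<close>;
  indices beyond the list are compared with the nailed ones after subtracting
  \<open>length vs\<close>.\<close>

lemma piece_props:
  assumes "j < length (nailed_idx vs)"
  shows "piece_start vs j < piece_end vs j" "nailed vs (piece_start vs j)" "nailed vs (piece_end vs j)"
    "\<And>l. piece_start vs j < l \<Longrightarrow> l < piece_end vs j \<Longrightarrow> \<not> nailed vs l"
    "piece_start vs j < length vs"
proof -
  let ?N = "nailed_idx vs"
  have s: "sorted_wrt (<) ?N" unfolding nailed_idx_def by (intro sorted_wrt_filter sorted_wrt_upt)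
  have set: "set ?N = {i. i < length vs \<and> nailed vs i}" unfolding nailed_idx_def by auto
  have nth: "?N ! i < length vs \<and> nailed vs (?N ! i)" if "i < length ?N" for i
    using nth_mem[OF that] set by blast
  have less: "?N ! i < ?N ! k" if "i < k" "k < length ?N" for i k
    using s that sorted_wrt_nth_less by blast
  have mono: "?N ! i \<le> ?N ! k" if "i \<le> k" "k < length ?N" for i k
    using less[of i k] that by (cases "i = k") auto
  have ps: "piece_start vs j = ?N ! j" by (simp add: piece_start_def)
  show "piece_start vs j < length vs" "nailed vs (piece_start vs j)" using nth[OF assms] ps by auto
  show "piece_start vs j < piece_end vs j"
    using less[of j "Suc j"] nth[OF assms] by (auto simp: ps piece_end_def)
  show "nailed vs (piece_end vs j)"
  proof -
    have "0 < length ?N" using assms by linarith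
    then show ?thesis using nth[of "Suc j"] nth[of 0] by (auto simp: piece_end_def nailed_add_length)
  qed
  fix l assume l: "piece_start vs j < l" "l < piece_end vs j"
  show "\<not> nailed vs l"
  proof
    assume nl: "nailed vs l"
    show False
    proof (cases "l < length vs")
      case True
      then obtain k where k: "k < length ?N" "?N ! k = l" using nl set by (metis (mono_tags, lifting) in_set_conv_nth mem_Collect_eq)
      have "j < k" using mono[of k j] k l ps assms by (cases "k \<le> j") auto
      then have "Suc j < length ?N" "?N ! Suc j \<le> l" using k mono[of "Suc j" k] by auto
      then show False using l by (simp add: piece_end_def)
    next
      case False
      then have e: "piece_end vs j = ?N ! 0 + length vs"
        using l nth[of "Suc j"] by (auto simp: piece_end_def split: if_splits)
      define l' where "l' = l - length vs"
      have l': "l = l' + length vs" "l' < ?N ! 0" using False l e by (auto simp: l'_def)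
      then have "nailed vs l'" using nl nailed_add_length by metis
      moreover have "l' < length vs" 
      proof -
        have "0 < length ?N" using assms by linarith
        then show ?thesis using l' nth[of 0] by linarith
      qed
      ultimately obtain k where k: "k < length ?N" "?N ! k = l'" using set by (metis (mono_tags, lifting) in_set_conv_nth mem_Collect_eq)
      then show False using mono[of 0 k] l' by simp
    qed
  qed
qed

text \<open>The region \<open>B\<close> is a parameter because two are used: the obstacle-free part
  of the hull of a layer, and the same without the interior of the core.\<close>

lemma shortcut_piece_interior:
  assumes vs: "pcurve P vs" "small_radius P eps" and j: "j < length (nailed_idx vs)"
    and edge: "\<And>i. open_segment (cyc vs i) (cyc vs (Suc i)) \<subseteq> B"
    and chord: "\<And>k. \<not> nailed vs (Suc k) \<Longrightarrow> closed_segment (sc_x vs eps (Suc k)) (sc_y vs eps (Suc k)) \<subseteq> B"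
    and t: "0 < t" "t < 1"
  shows "polypath (shortcut_piece vs eps j) t \<in> B"
proof -
  let ?s = "piece_start vs j" and ?e = "piece_end vs j"
  note pp = piece_props[OF j]
  show ?thesis
  proof (cases "?e = Suc ?s")
    case True
    then have "shortcut_piece vs eps j = [cyc vs ?s, cyc vs (Suc ?s)]"
      by (simp add: shortcut_piece_eq interleave_def)
    moreover have "linepath (cyc vs ?s) (cyc vs (Suc ?s)) t \<in> open_segment (cyc vs ?s) (cyc vs (Suc ?s))"
      using t pcurve_edge(2)[OF vs(1)] by (auto simp: in_segment linepath_def)
    ultimately show ?thesis using edge by (metis polypath.simps(3) subset_iff)
  next
    case False
    then have se: "Suc ?s < ?e" using pp(1) by simp
    then obtain e' where e': "?e = Suc e'" by (metis Suc_lessE)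
    note lp = interleave_props[OF se, of "sc_x vs eps" "sc_y vs eps"]
    show ?thesis unfolding shortcut_piece_eq
    proof (rule polypath_interior[OF lp(1) _ _ _ _ _ t])
      show "successively (\<lambda>p q. closed_segment p q \<subseteq> B) (interleave (sc_x vs eps) (sc_y vs eps) (Suc ?s) ?e)"
      proof (rule interleave_successively[OF se])
        show "closed_segment (sc_x vs eps l) (sc_y vs eps l) \<subseteq> B" if "Suc ?s \<le> l" "l < ?e" for l
          using that pp(4)[of l] chord by (cases l) auto
        show "closed_segment (sc_y vs eps l) (sc_x vs eps (Suc l)) \<subseteq> B" for l
          using sc_edge_subset[OF vs, of l] edge[of l] by blast
      qed
      have x: "sc_x vs eps (Suc ?s) \<in> open_segment (cyc vs ?s) (cyc vs (Suc ?s))" by (rule sc_x_in_edge[OF vs])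
      show "closed_segment (cyc vs ?s) (hd (interleave (sc_x vs eps) (sc_y vs eps) (Suc ?s) ?e)) - {cyc vs ?s} \<subseteq> B"
        using half_segment_subset[OF x] edge[of ?s] unfolding lp(2) by (rule order_trans)
      show "cyc vs ?s \<noteq> hd (interleave (sc_x vs eps) (sc_y vs eps) (Suc ?s) ?e)" 
      proof -
        have "sc_x vs eps (Suc ?s) \<noteq> cyc vs ?s" using x unfolding open_segment_def by blast
        then show ?thesis using lp(2) by metis
      qed
      have y: "sc_y vs eps e' \<in> open_segment (cyc vs ?e) (cyc vs e')"
        using sc_y_in_edge[OF vs, of e'] e' by (metis open_segment_commute)
      have "closed_segment (cyc vs ?e) (sc_y vs eps e') - {cyc vs ?e} \<subseteq> B"
        using half_segment_subset[OF y] edge[of e'] e' by (metis open_segment_commute order_trans)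
      then show "closed_segment (last (interleave (sc_x vs eps) (sc_y vs eps) (Suc ?s) ?e)) (cyc vs ?e) - {cyc vs ?e} \<subseteq> B"
        unfolding lp(3) using e' by (simp add: closed_segment_commute)
      show "last (interleave (sc_x vs eps) (sc_y vs eps) (Suc ?s) ?e) \<noteq> cyc vs ?e" 
      proof -
        have "sc_y vs eps e' \<noteq> cyc vs ?e" using y unfolding open_segment_def by blast
        then show ?thesis unfolding lp(3) using e' by simp
      qed
    qed
  qed
qed

lemma shortcut_closed_subset:
  assumes vs: "pcurve P vs" "small_radius P eps" and n: "nailed_idx vs = []"
    and edge: "\<And>i. open_segment (cyc vs i) (cyc vs (Suc i)) \<subseteq> B"
    and chord: "\<And>k. \<not> nailed vs (Suc k) \<Longrightarrow> closed_segment (sc_x vs eps (Suc k)) (sc_y vs eps (Suc k)) \<subseteq> B"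
  shows "path_image (closed_poly (shortcut_closed vs eps)) \<subseteq> B"
proof -
  have ne: "vs \<noteq> []" using vs by (auto simp: pcurve_def)
  have nn: "\<not> nailed vs i" for i
  proof
    assume "nailed vs i"
    then have "nailed vs (i mod length vs)" by (simp add: nailed_mod)
    moreover have "i mod length vs < length vs" using ne by simp
    ultimately have "i mod length vs \<in> set (nailed_idx vs)" unfolding nailed_idx_def by simp
    then show False using n by simp
  qed
  have ch: "closed_segment (sc_x vs eps l) (sc_y vs eps l) \<subseteq> B" for l
  proof -
    \<comment> \<open>A full turn makes every index a successor, as \<open>chord\<close>
      demands.\<close>
    obtain k where k: "l + length vs = Suc k" using ne by (cases "l + length vs") auto
    have "closed_segment (sc_x vs eps (l + length vs)) (sc_y vs eps (l + length vs)) \<subseteq> B"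
      unfolding k by (rule chord[OF nn])
    then show ?thesis by (simp add: sc_x_add_length[OF ne] sc_y_add_length)
  qed
  have ed: "closed_segment (sc_y vs eps l) (sc_x vs eps (Suc l)) \<subseteq> B" for l
    using sc_edge_subset[OF vs, of l] edge[of l] by blast
  have l0: "0 < length vs" using ne by simp
  have x0: "sc_x vs eps (length vs) = sc_x vs eps 0" using sc_x_add_length[OF ne, of eps 0] by simp
  show ?thesis unfolding closed_poly_shortcut_closed[OF ne]
  proof (rule path_image_polypath_subset)
    show "2 \<le> length (interleave (sc_x vs eps) (sc_y vs eps) 0 (length vs) @ [sc_x vs eps 0])"
      using interleave_props(1)[OF l0, of "sc_x vs eps" "sc_y vs eps"]
      by (cases "interleave (sc_x vs eps) (sc_y vs eps) 0 (length vs)") auto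
    show "successively (\<lambda>p q. closed_segment p q \<subseteq> B) (interleave (sc_x vs eps) (sc_y vs eps) 0 (length vs) @ [sc_x vs eps 0])"
      by (rule closed_successively[OF l0]) (use ch ed x0 in auto)
  qed
qed

subsection \<open>Convex layers\<close>

text \<open>Points on the boundary of the hull that are not corners stay; a nailed vertex may be one
  of them.\<close>

definition peel :: "complex set \<Rightarrow> complex set" where
  "peel Q = {x \<in> Q. \<not> x extreme_point_of (convex hull Q)}"

lemma peel_subset: "peel Q \<subseteq> Q"
  by (auto simp: peel_def)

lemma extreme_notin_hull_peel:
  assumes "x extreme_point_of (convex hull Q)"
  shows "x \<notin> convex hull (peel Q)"
proof
  assume x: "x \<in> convex hull (peel Q)"
  have "x extreme_point_of (convex hull (peel Q))"
    using assms x hull_mono[OF peel_subset[of Q], of convex] unfolding extreme_point_of_def by blast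
  then have "x \<in> peel Q" by (rule extreme_point_of_convex_hull)
  then show False using assms by (simp add: peel_def)
qed

text \<open>The invariant that a layer contains every obstacle in its hull. A point in the hull of
  the next layer cannot be extreme for the present one, so it survives the deletion.\<close>

lemma peel_closed:
  assumes "P \<inter> convex hull Q = Q"
  shows "P \<inter> convex hull (peel Q) = peel Q"
proof
  show "peel Q \<subseteq> P \<inter> convex hull (peel Q)" using assms hull_subset[of "peel Q" convex] peel_subset[of Q] by auto
  show "P \<inter> convex hull (peel Q) \<subseteq> peel Q"
  proof
    fix x assume x: "x \<in> P \<inter> convex hull (peel Q)"
    then have "x \<in> convex hull Q" using peel_subset hull_mono by blast
    then have "x \<in> Q" using x assms by auto
    moreover have "\<not> x extreme_point_of (convex hull Q)" using x extreme_notin_hull_peel by blast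
    ultimately show "x \<in> peel Q" by (simp add: peel_def)
  qed
qed

text \<open>An obstacle met on the way outside \<open>K\<close> belongs to \<open>Q\<close> but not
  to \<open>peel Q\<close>, so it is an extreme point, and an extreme point is not inside a segment
  of the hull. The target \<open>w\<close> is left open to cover both the nearest-point and the
  radial projection.\<close>

lemma segment_to_core_avoids:
  assumes Q: "P \<inter> convex hull Q = Q" and K: "K \<subseteq> convex hull Q" "peel Q \<subseteq> K"
    and z: "z \<in> convex hull Q" "z \<notin> P" and w: "w \<in> K"
    and s: "0 \<le> s" "s < 1" and out: "z = w \<or> (1 - s) *\<^sub>R z + s *\<^sub>R w \<notin> K"
  shows "(1 - s) *\<^sub>R z + s *\<^sub>R w \<notin> P"
proof (cases "z = w")
  case True
  then show ?thesis using z by (simp flip: scaleR_add_left)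
next
  case False
  let ?x = "(1 - s) *\<^sub>R z + s *\<^sub>R w"
  show ?thesis
  proof
    assume x: "?x \<in> P"
    have s0: "0 < s" using x z s by (cases "s = 0") auto
    have "?x \<in> convex hull Q" using z w K s by (intro convexD) auto
    then have "?x \<in> Q" using x Q by auto
    moreover have "?x \<notin> peel Q" using out False K by auto
    ultimately have "?x extreme_point_of (convex hull Q)" by (simp add: peel_def)
    moreover have "?x \<in> open_segment z w" using False s0 s by (auto simp: in_segment)
    ultimately show False using z w K by (auto simp: extreme_point_of_def)
  qed
qed

lemma retr_core_avoids:
  assumes Q: "P \<inter> convex hull Q = Q" and K: "K \<subseteq> convex hull Q" "peel Q \<subseteq> K" "closed K" "K \<noteq> {}"
    and z: "z \<in> convex hull Q" "z \<notin> P" and s: "0 \<le> s" "s < 1"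
  shows "retr K s z \<notin> P"
  unfolding retr_def
proof (rule segment_to_core_avoids[OF Q K(1,2) z _ s])
  show "closest_point K z \<in> K" using closest_point_in_set K by blast
  show "z = closest_point K z \<or> (1 - s) *\<^sub>R z + s *\<^sub>R closest_point K z \<notin> K"
  proof (cases "z \<in> K")
    case True
    then show ?thesis by (simp add: closest_point_self)
  next
    case False
    then show ?thesis using retr_notin[OF K(3) False s] by (simp add: retr_def)
  qed
qed

lemma edge_in_region:
  assumes "pcurve P vs" "set vs \<subseteq> Q"
  shows "open_segment (cyc vs i) (cyc vs (Suc i)) \<subseteq> convex hull Q - P"
proof -
  have ne: "vs \<noteq> []" using assms by (auto simp: pcurve_def)
  have "cyc vs k \<in> convex hull Q" for k using cyc_in_set[OF ne] assms by (meson hull_inc subsetD)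
  then have "open_segment (cyc vs i) (cyc vs (Suc i)) \<subseteq> convex hull Q"
    using closed_segment_subset[OF _ _ convex_convex_hull] open_closed_segment by blast
  then show ?thesis using pcurve_edge(3)[OF assms(1), of i] by auto
qed

lemma chord_in_region:
  assumes "pcurve P vs" "set vs \<subseteq> Q" "small_radius P eps" "\<not> nailed vs (Suc k)"
  shows "closed_segment (sc_x vs eps (Suc k)) (sc_y vs eps (Suc k)) \<subseteq> convex hull Q - P"
  using chord_avoids[OF assms(1,3,4)] chord_in_hull[OF assms(1,3), of k] hull_mono[OF assms(2), of convex] by blast

lemma nailed_in_peel:
  assumes vs: "pcurve P vs" and Q: "set vs \<subseteq> Q" and n: "nailed vs i"
  shows "cyc vs i \<in> peel Q"
proof -
  have ne: "vs \<noteq> []" using assms by (auto simp: pcurve_def)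
  obtain k where k: "i + length vs = Suc k" using ne by (cases "i + length vs") auto
  have "nailed vs (Suc k)" using n nailed_add_length k by metis
  then have "cyc vs (Suc k) \<in> open_segment (cyc vs k) (cyc vs (Suc (Suc k)))" using nailed_Suc_iff[OF vs] by blast
  moreover have "cyc vs j \<in> Q" "cyc vs j \<in> convex hull Q" for j using cyc_in_set[OF ne] Q hull_subset[of Q convex] by blast+
  ultimately have "cyc vs (Suc k) \<in> peel Q" unfolding peel_def extreme_point_of_def by blast
  then show ?thesis using k cyc_add_length by metis
qed

text \<open>The ends of a piece are nailed and hence already in the next layer, so its hull can
  serve as the core of the retraction.\<close>

lemma hcs_piece_in_peel:
  assumes P: "finite P" and Q: "P \<inter> convex hull Q = Q" and vs: "pcurve P vs" "set vs \<subseteq> Q"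
    and j: "j < length (nailed_idx vs)" and w: "ppath P w \<or> length w = 1"
    and hd: "hd w = cyc vs (piece_start vs j)"
    and sh: "\<forall>\<^sub>F eps in at_right 0. shortest_homotopic_path P (polypath (shortcut_piece vs eps j)) (polypath w)"
  shows "set w \<subseteq> peel Q"
proof -
  obtain eps where eps: "small_radius P eps" "shortest_homotopic_path P (polypath (shortcut_piece vs eps j)) (polypath w)"
    using eventually_happens'[OF _ eventually_conj[OF eventually_small_radius[OF P] sh]] by (auto simp: trivial_limit_at_right_real)
  let ?g = "polypath (shortcut_piece vs eps j)"
  have QP: "Q \<subseteq> P" using Q by auto
  have finQ: "finite Q" using QP P finite_subset by blast
  have ends: "?g 0 = cyc vs (piece_start vs j)" "?g 1 = cyc vs (piece_end vs j)"
    using polypath_ends[of "shortcut_piece vs eps j"] by (auto simp: shortcut_piece_eq pathstart_def pathfinish_def)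
  note pp = piece_props[OF j]
  have endp: "?g 0 \<in> peel Q" "?g 1 \<in> peel Q" using nailed_in_peel[OF vs pp(2)] nailed_in_peel[OF vs pp(3)] ends by auto
  have ne: "peel Q \<noteq> {}" using endp by auto
  have fin': "finite (peel Q)" using finQ peel_subset finite_subset by blast
  have "path_image (polypath w) \<subseteq> convex hull (peel Q)"
  proof (rule shortest_homotopic_path_subset_convex[OF P _ _ _ eps(2)])
    show "compact (convex hull (peel Q))" using fin' by (simp add: finite_imp_compact_convex_hull)
    show "path_length (polypath w) < top" by (simp add: path_length_polypath)
    show "?g 0 \<in> convex hull (peel Q)" "?g 1 \<in> convex hull (peel Q)" using endp hull_inc by metis+
    fix s t :: real assume s: "s \<in> {0..<1}" and t: "t \<in> {0<..<1}"
    have "?g t \<in> convex hull Q - P"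
      by (rule shortcut_piece_interior[OF vs(1) eps(1) j]) (use edge_in_region[OF vs] chord_in_region[OF vs eps(1)] t in auto)
    then show "retr (convex hull (peel Q)) s (?g t) \<notin> P"
      using s ne fin' by (intro retr_core_avoids[OF Q]) (auto simp: hull_subset hull_mono[OF peel_subset] finite_imp_compact_convex_hull compact_imp_closed)
  qed (use ne in auto)
  moreover have "w \<noteq> []" using w by (auto simp: ppath_def)
  ultimately have "set w \<subseteq> convex hull (peel Q)" using set_subset_path_image_polypath by blast
  moreover have "set w \<subseteq> P"
  proof (cases "ppath P w")
    case True
    then show ?thesis by (simp add: ppath_def)
  next
    case False
    then obtain x where "w = [x]" using w by (auto simp: length_Suc_conv)
    then show ?thesis using hd pcurve_edge(1)[OF vs(1)] by simp
  qed
  ultimately show ?thesis using peel_closed[OF Q] by blast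
qed

lemma hcs_loop_in_peel:
  assumes P: "finite P" and Q: "P \<inter> convex hull Q = Q" and vs: "pcurve P vs" "set vs \<subseteq> Q"
    and n: "nailed_idx vs = []" and r: "pcurve P r"
    and sh: "\<forall>\<^sub>F eps in at_right 0. shortest_homotopic_loop P (closed_poly (shortcut_closed vs eps)) (closed_poly r)"
  shows "set r \<subseteq> peel Q"
proof -
  obtain eps where eps: "small_radius P eps" "shortest_homotopic_loop P (closed_poly (shortcut_closed vs eps)) (closed_poly r)"
    using eventually_happens'[OF _ eventually_conj[OF eventually_small_radius[OF P] sh]] by (auto simp: trivial_limit_at_right_real)
  let ?g = "closed_poly (shortcut_closed vs eps)"
  have QP: "Q \<subseteq> P" using Q by auto
  have finQ: "finite Q" using QP P finite_subset by blast
  have fin': "finite (peel Q)" using finQ peel_subset finite_subset by blast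
  have gim: "path_image ?g \<subseteq> convex hull Q - P"
    by (rule shortcut_closed_subset[OF vs(1) eps(1) n]) (use edge_in_region[OF vs] chord_in_region[OF vs eps(1)] in auto)
  have gt: "?g t \<in> convex hull Q" "?g t \<notin> P" if "t \<in> {0..1}" for t
  proof -
    have "?g t \<in> path_image ?g" unfolding path_image_def using that by (rule imageI)
    then show "?g t \<in> convex hull Q" "?g t \<notin> P" using gim by auto
  qed
  have "length r \<ge> 2" using r by (simp add: pcurve_def)
  then obtain a b rs where rr: "r = a # b # rs" by (cases r; cases "tl r") auto
  have ab: "a \<noteq> b" using pcurve_edge(2)[OF r, of 0] rr by (simp add: cyc_def)
  have sub: "set r \<subseteq> path_image (closed_poly r)"
    unfolding closed_poly_def using set_subset_path_image_polypath[of "r @ [hd r]"] by auto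
  \<comment> \<open>The core is kept variable because the next layer may be empty. Then any single
    point of the hull serves as core, and a curve inside one point contradicts
    \<open>ab\<close>.\<close>
  have key: "path_image (closed_poly r) \<subseteq> K"
    if K: "convex K" "compact K" "K \<noteq> {}" "K \<subseteq> convex hull Q" "peel Q \<subseteq> K" for K
  proof (rule shortest_homotopic_loop_subset_convex[OF P K(1-3) eps(2)])
    show "path_length (closed_poly r) < top" by (simp add: closed_poly_def path_length_polypath)
    have "0 < psum dist (r @ [hd r])" using ab psum_nonneg[of dist "(b # rs) @ [hd r]"] by (simp add: rr add_pos_nonneg)
    then show "path_length (closed_poly r) \<noteq> 0" by (simp add: closed_poly_def path_length_polypath)
    show "retr K s (?g t) \<notin> P" if "s \<in> {0..<1}" "t \<in> {0..1}" for s t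
      by (rule retr_core_avoids[OF Q]) (use K gt[of t] that in \<open>auto simp: compact_imp_closed\<close>)
  qed
  show ?thesis
  proof (cases "peel Q = {}")
    case True
    have "path_image (closed_poly r) \<subseteq> {?g 0}" by (rule key) (use True gt[of 0] in auto)
    then show ?thesis using sub ab rr by auto
  next
    case False
    have "path_image (closed_poly r) \<subseteq> convex hull (peel Q)"
      by (rule key) (use False fin' in \<open>auto simp: hull_subset hull_mono[OF peel_subset] finite_imp_compact_convex_hull\<close>)
    moreover have "set r \<subseteq> P" using r by (simp add: pcurve_def)
    ultimately show ?thesis using sub peel_closed[OF Q] by blast
  qed
qed

lemma hcs_step_pieces:
  assumes "hcs_step P vs r" "nailed_idx vs \<noteq> []"
  obtains ws where "length ws = length (nailed_idx vs)" "r = concat (map tl ws)"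
    "\<And>j. j < length ws \<Longrightarrow> ppath P (ws ! j) \<or> length (ws ! j) = 1"
    "\<And>j. j < length ws \<Longrightarrow> hd (ws ! j) = cyc vs (piece_start vs j)"
    "\<And>j. j < length ws \<Longrightarrow> last (ws ! j) = cyc vs (piece_end vs j)"
    "\<And>j. j < length ws \<Longrightarrow> \<forall>\<^sub>F eps in at_right 0.
        shortest_homotopic_path P (polypath (shortcut_piece vs eps j)) (polypath (ws ! j))"
  using assms unfolding hcs_step_def by auto

lemma hcs_step_in_peel:
  assumes P: "finite P" and Q: "P \<inter> convex hull Q = Q" and st: "hcs_step P vs r" "set vs \<subseteq> Q"
    and r: "pcurve P r"
  shows "set r \<subseteq> peel Q"
proof (cases "nailed_idx vs = []")
  case True
  then show ?thesis using st by (intro hcs_loop_in_peel[OF P Q _ _ True r]) (auto simp: hcs_step_def)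
next
  case False
  have vs: "pcurve P vs" using st by (simp add: hcs_step_def)
  obtain ws where ws: "length ws = length (nailed_idx vs)" "r = concat (map tl ws)"
    "\<And>j. j < length ws \<Longrightarrow> ppath P (ws ! j) \<or> length (ws ! j) = 1"
    "\<And>j. j < length ws \<Longrightarrow> hd (ws ! j) = cyc vs (piece_start vs j)"
    "\<And>j. j < length ws \<Longrightarrow> last (ws ! j) = cyc vs (piece_end vs j)"
    "\<And>j. j < length ws \<Longrightarrow> \<forall>\<^sub>F eps in at_right 0.
        shortest_homotopic_path P (polypath (shortcut_piece vs eps j)) (polypath (ws ! j))"
    using hcs_step_pieces[OF st(1) False] by blast
  have "set w \<subseteq> peel Q" if "w \<in> set ws" for w
  proof -
    obtain j where j: "j < length ws" "w = ws ! j" using \<open>w \<in> set ws\<close> by (auto simp: in_set_conv_nth)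
    show ?thesis using hcs_piece_in_peel[OF P Q vs st(2) _ ws(3)[OF j(1)] ws(4)[OF j(1)] ws(6)[OF j(1)]] j ws(1) by simp
  qed
  moreover have "set (tl w) \<subseteq> set w" for w :: "complex list" by (cases w) auto
  ultimately show ?thesis unfolding ws(2) by fastforce
qed

subsection \<open>Convex polygons\<close>

text \<open>The planar cross product, positive if and only if \<open>b\<close> points to the left of
  \<open>a\<close>.\<close>

definition cr :: "complex \<Rightarrow> complex \<Rightarrow> real" where
  "cr a b = Im (cnj a * b)"

lemma cr_inner: "cr a b = (\<i> * a) \<bullet> b"
  by (simp add: cr_def inner_complex_def algebra_simps)

lemma cr_diff_right: "cr a (b - c) = cr a b - cr a c"
  and cr_add_right: "cr a (b + c) = cr a b + cr a c"
  and cr_diff_left: "cr (b - c) a = cr b a - cr c a"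
  and cr_scale_right: "cr a (k *\<^sub>R b) = k * cr a b"
  and cr_scale_left: "cr (k *\<^sub>R a) b = k * cr a b"
  by (simp_all add: cr_def algebra_simps)

lemma cr_self [simp]: "cr a a = 0"
  by (simp add: cr_def)

lemma cr_zero_right [simp]: "cr a 0 = 0"
  by (simp add: cr_def)

lemma perp_inner: "(\<i> * d) \<bullet> d = 0"
  by (simp add: inner_complex_def)

lemma cr_swap: "cr a b = - cr b a"
  by (simp add: cr_def)

text \<open>The signed area of a triangle read at another corner: "\<open>z\<close> is to the left
  of the edge" becomes "the edge turns counterclockwise around \<open>z\<close>".\<close>

lemma cr_triangle: "cr (b - a) (z - a) = cr (a - z) (b - z)"
  by (simp add: cr_def algebra_simps)

lemma cr_eq_0_imp: "cr p q = 0 \<Longrightarrow> p \<noteq> 0 \<Longrightarrow> \<exists>k. q = k *\<^sub>R p"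
proof -
  assume c: "cr p q = 0" and p: "p \<noteq> 0"
  have "q / p = cnj p * q / (cnj p * p)" using p by simp
  moreover have "cnj p * p = of_real ((norm p)\<^sup>2)" by (metis complex_norm_square mult.commute)
  moreover have "cnj p * q = of_real (Re (cnj p * q))" using c by (simp add: cr_def complex_eq_iff)
  ultimately have "q / p = of_real (Re (cnj p * q) / (norm p)\<^sup>2)" by (metis of_real_divide)
  then have "q = of_real (Re (cnj p * q) / (norm p)\<^sup>2) * p" using p by (metis nonzero_eq_divide_eq)
  then show ?thesis by (metis scaleR_conv_of_real)
qed

lemma exists_off_line:
  assumes "interior (convex hull S) \<noteq> {}" "d \<noteq> 0"
  shows "\<exists>y\<in>S. cr d (y - a) \<noteq> 0"
proof (rule ccontr)
  assume "\<not> ?thesis"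
  then have "S \<subseteq> {z. (\<i> * d) \<bullet> z = cr d a}" by (auto simp: inner_diff_right cr_inner)
  then have "convex hull S \<subseteq> {z. (\<i> * d) \<bullet> z = cr d a}"
    by (intro hull_minimal convex_hyperplane)
  then have "interior (convex hull S) \<subseteq> interior {z. (\<i> * d) \<bullet> z = cr d a}" by (rule interior_mono)
  then show False using assms by (simp add: interior_hyperplane)
qed

text \<open>The combinatorial form of convexity of a closed polygon that survives a step: no line is crossed
  four times.\<close>

definition no_alt :: "(nat \<Rightarrow> complex) \<Rightarrow> nat \<Rightarrow> bool" where
  "no_alt v M \<longleftrightarrow> \<not> (\<exists>u c i1 i2 i3 i4. i1 < i2 \<and> i2 < i3 \<and> i3 < i4 \<and> i4 < i1 + M \<and>
     u \<bullet> v i1 > c \<and> u \<bullet> v i2 < c \<and> u \<bullet> v i3 > c \<and> u \<bullet> v i4 < c)"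

lemma no_altD:
  "no_alt v M \<Longrightarrow> i1 < i2 \<Longrightarrow> i2 < i3 \<Longrightarrow> i3 < i4 \<Longrightarrow> i4 < i1 + M \<Longrightarrow>
     u \<bullet> v i1 > c \<Longrightarrow> u \<bullet> v i2 < c \<Longrightarrow> u \<bullet> v i3 > c \<Longrightarrow> u \<bullet> v i4 < c \<Longrightarrow> False"
  unfolding no_alt_def by blast

lemma cyc_index:
  assumes "x \<in> set vs"
  obtains k where "i \<le> k" "k < i + length vs" "cyc vs k = x"
proof -
  obtain m where m: "m < length vs" "vs ! m = x" using assms by (auto simp: in_set_conv_nth)
  define M where "M = length vs"
  define k where "k = (if i mod M \<le> m then i + (m - i mod M) else i + (m + M - i mod M))"
  have M: "M > 0" using m unfolding M_def by linarith
  then have im: "i mod M < M" by simp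
  have im2: "i = M * (i div M) + i mod M" by simp
  have "i \<le> k" "k < i + M" using m im by (auto simp: k_def M_def)
  moreover have "k mod M = m"
  proof (cases "i mod M \<le> m")
    case True
    then have "k = i + (m - i mod M)" by (simp add: k_def)
    then have "k = M * (i div M) + m" using im2 True by linarith
    then show ?thesis using m by (simp add: M_def)
  next
    case False
    then have "k = i + (m + M - i mod M)" by (simp add: k_def)
    then have "k = M * (i div M) + (m + M)" using im2 im by linarith
    then show ?thesis using m by (simp add: M_def)
  qed
  ultimately show thesis using that[of k] m by (simp add: cyc_def M_def)
qed

lemma small_eta:
  fixes A B p q :: real
  assumes "A > 0" "B > 0"
  obtains e where "e > 0" "p * e < A" "q * e < B"
proof -
  have "\<forall>\<^sub>F e in at_right 0. 0 < e \<and> p * e < A \<and> q * e < B"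
    using assms by (intro eventually_conj eventually_less_at_right_0 eventually_at_right_less)
  then show thesis using that eventually_happens'[of "at_right (0::real)"] by (auto simp: trivial_limit_at_right_real)
qed

text \<open>If two vertices lie on opposite sides of the line through an edge, that line is turned
  slightly about the midpoint of the edge. It then also separates the two ends of the edge and is
  crossed four times.\<close>

lemma no_alt_edge_aux:
  assumes na: "no_alt v M" and d: "v (Suc i) - v i = d" "d \<noteq> 0" and e: "e \<bullet> d = 0"
    and k: "Suc i < k" "k < l" "l < i + M"
    and x: "e \<bullet> (v k - v i) > 0" and y: "e \<bullet> (v l - v i) < 0"
  shows False
proof -
  define m where "m = v i + (1/2) *\<^sub>R d"
  \<comment> \<open>The turn is small enough to move neither \<open>v k\<close> nor
    \<open>v l\<close> across the line.\<close>
  obtain h where h: "h > 0" "(d \<bullet> (v k - m)) * h < e \<bullet> (v k - v i)" "(- (d \<bullet> (v l - m))) * h < - (e \<bullet> (v l - v i))"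
    using small_eta[of "e \<bullet> (v k - v i)" "- (e \<bullet> (v l - v i))" "d \<bullet> (v k - m)" "- (d \<bullet> (v l - m))"] x y by auto
  define u where "u = e - h *\<^sub>R d"
  have em: "e \<bullet> m = e \<bullet> v i" by (simp add: m_def inner_add_right e)
  have vi: "v i = m - (1/2) *\<^sub>R d" "v (Suc i) = m + (1/2) *\<^sub>R d"
  proof -
    have "(1/2) *\<^sub>R d + (1/2) *\<^sub>R d = d" by (simp flip: scaleR_add_left)
    then have "m + (1/2) *\<^sub>R d = v i + d" by (simp add: m_def add.assoc)
    then show "v (Suc i) = m + (1/2) *\<^sub>R d" using d(1) by (simp add: algebra_simps)
  qed (simp add: m_def)
  have "d \<bullet> d > 0" using d by simp
  then have dd: "h * (d \<bullet> d) > 0" using h(1) by simp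
  have "u \<bullet> v i - u \<bullet> m = h * (d \<bullet> d) / 2"
    unfolding vi(1) by (simp add: u_def inner_diff_left inner_diff_right e)
  then have 1: "u \<bullet> v i > u \<bullet> m" using dd by linarith
  have "u \<bullet> v (Suc i) - u \<bullet> m = - (h * (d \<bullet> d) / 2)"
    unfolding vi(2) by (simp add: u_def inner_diff_left inner_add_right e)
  then have 2: "u \<bullet> v (Suc i) < u \<bullet> m" using dd by linarith
  have 3: "u \<bullet> v k > u \<bullet> m" using h(2) em by (simp add: u_def inner_diff_left inner_diff_right algebra_simps)
  have 4: "u \<bullet> v l < u \<bullet> m" using h(3) em by (simp add: u_def inner_diff_left inner_diff_right algebra_simps)
  show False by (rule no_altD[OF na, of i "Suc i" k l "u \<bullet> m" u]) (use k 1 2 3 4 in auto)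
qed

lemma no_alt_edge_supports:
  assumes na: "no_alt (cyc vs) (length vs)" and ne: "cyc vs i \<noteq> cyc vs (Suc i)"
    and xy: "x \<in> set vs" "y \<in> set vs"
    and x: "cr (cyc vs (Suc i) - cyc vs i) (x - cyc vs i) > 0"
    and y: "cr (cyc vs (Suc i) - cyc vs i) (y - cyc vs i) < 0"
  shows False
proof -
  let ?d = "cyc vs (Suc i) - cyc vs i"
  have d: "?d \<noteq> 0" using ne by simp
  have gt: "Suc i < k" if "i \<le> k" "cr ?d (cyc vs k - cyc vs i) \<noteq> 0" for k
  proof -
    have "k \<noteq> i" "k \<noteq> Suc i" using that by auto
    then show ?thesis using that by simp
  qed
  obtain k where k: "i \<le> k" "k < i + length vs" "cyc vs k = x" by (rule cyc_index[OF xy(1), of i])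
  obtain l where l: "i \<le> l" "l < i + length vs" "cyc vs l = y" by (rule cyc_index[OF xy(2), of i])
  have kl: "Suc i < k" "Suc i < l" using gt k l x y by auto
  have ee: "(\<i> * ?d) \<bullet> ?d = 0" by (rule perp_inner)
  have "k \<noteq> l" using k l x y by auto
  then consider "k < l" | "l < k" by linarith
  then show False
  proof cases
    case 1
    show ?thesis
      by (rule no_alt_edge_aux[OF na refl d ee kl(1) 1 l(2)]) (use x y k l in \<open>auto simp: cr_inner\<close>)
  next
    case 2
    show ?thesis
      by (rule no_alt_edge_aux[OF na refl d _ kl(2) 2 k(2), of "- (\<i> * ?d)"]) (use x y k l ee in \<open>auto simp: cr_inner\<close>)
  qed
qed

text \<open>For a spike from \<open>a\<close> to \<open>b\<close> and back, a line that separates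
  \<open>a\<close> from both \<open>b\<close> and \<open>y\<close> is crossed four times.\<close>

lemma no_alt_no_spike:
  assumes na: "no_alt (cyc vs) (length vs)" and ne: "cyc vs i \<noteq> cyc vs (Suc i)"
    and y: "y \<in> set vs" "cr (cyc vs (Suc i) - cyc vs i) (y - cyc vs i) \<noteq> 0"
  shows "cyc vs (Suc (Suc i)) \<noteq> cyc vs i"
proof
  assume sp: "cyc vs (Suc (Suc i)) = cyc vs i"
  define a b where "a = cyc vs i" and "b = cyc vs (Suc i)"
  define e where "e = \<i> * (b - a)"
  have ee: "e \<bullet> (b - a) = 0" unfolding e_def by (rule perp_inner)
  have ey: "e \<bullet> (a - y) \<noteq> 0" using y(2) by (simp add: e_def a_def b_def cr_inner inner_diff_right)
  obtain k where k: "i \<le> k" "k < i + length vs" "cyc vs k = y" by (rule cyc_index[OF y(1), of i])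
  have "k \<noteq> i" "k \<noteq> Suc i" "k \<noteq> Suc (Suc i)" using k y(2) sp by auto
  then have k2: "Suc (Suc i) < k" using k by simp
  \<comment> \<open>With this factor the \<open>e\<close> component of \<open>u\<close> outweighs
    the other one at \<open>y\<close>, while at \<open>b\<close> it has no effect because
    \<open>e\<close> is orthogonal to \<open>b - a\<close>.\<close>
  define l where "l = (1 + \<bar>(a - b) \<bullet> (a - y)\<bar>) / (e \<bullet> (a - y))"
  define u where "u = (a - b) + l *\<^sub>R e"
  have ab: "(a - b) \<bullet> (a - b) > 0" using ne by (simp add: a_def b_def)
  have "u \<bullet> (a - b) = (a - b) \<bullet> (a - b)" using ee by (simp add: u_def inner_add_left inner_diff_right)
  then have 1: "u \<bullet> (a - b) > 0" using ab by simp
  have "u \<bullet> (a - y) = (a - b) \<bullet> (a - y) + (1 + \<bar>(a - b) \<bullet> (a - y)\<bar>)"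
    using ey by (simp add: u_def inner_add_left l_def)
  then have 2: "u \<bullet> (a - y) > 0" by linarith
  define c where "c = (u \<bullet> a + max (u \<bullet> b) (u \<bullet> y)) / 2"
  have c: "u \<bullet> a > c" "u \<bullet> b < c" "u \<bullet> y < c"
    using 1 2 by (auto simp: c_def max_def inner_diff_right)
  show False
    by (rule no_altD[OF na, of i "Suc i" "Suc (Suc i)" k c u]) (use c k k2 sp in \<open>auto simp: a_def b_def\<close>)
qed

text \<open>The hull lies to the left of each edge for \<open>\<sigma> = 1\<close>, a
  counterclockwise curve, and to the right for \<open>\<sigma> = -1\<close>; the sign lets one
  argument treat both senses.\<close>

definition oriented :: "real \<Rightarrow> complex list \<Rightarrow> bool" where
  "oriented \<sigma> vs \<longleftrightarrow> (\<forall>i. \<forall>x\<in>convex hull (set vs). \<sigma> * cr (cyc vs (Suc i) - cyc vs i) (x - cyc vs i) \<ge> 0)"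

lemma halfplane_hull:
  assumes "\<forall>x\<in>S. s * cr d (x - a) \<ge> 0"
  shows "\<forall>x\<in>convex hull S. s * cr d (x - a) \<ge> 0"
proof -
  have eq: "s * cr d (x - a) = (s *\<^sub>R (\<i> * d)) \<bullet> x - (s *\<^sub>R (\<i> * d)) \<bullet> a" for x
    by (simp add: cr_inner inner_diff_right algebra_simps)
  have "convex hull S \<subseteq> {x. (s *\<^sub>R (\<i> * d)) \<bullet> x \<ge> (s *\<^sub>R (\<i> * d)) \<bullet> a}"
  proof (rule hull_minimal)
    show "S \<subseteq> {x. (s *\<^sub>R (\<i> * d)) \<bullet> x \<ge> (s *\<^sub>R (\<i> * d)) \<bullet> a}"
      using assms unfolding eq by auto
  qed (rule convex_halfspace_ge)
  then show ?thesis unfolding eq by auto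
qed

text \<open>If the curve reversed on its line without returning to \<open>cyc vs i\<close>, one of
  two overlapping edges would end inside the other, whose interior holds no obstacle.\<close>

lemma pcurve_forward:
  assumes vs: "pcurve P vs" and ac: "cyc vs (Suc (Suc i)) \<noteq> cyc vs i"
    and k: "cyc vs (Suc (Suc i)) - cyc vs (Suc i) = k *\<^sub>R (cyc vs (Suc i) - cyc vs i)"
  shows "k > 0"
proof (rule ccontr)
  assume "\<not> k > 0"
  define a b c where "a = cyc vs i" and "b = cyc vs (Suc i)" and "c = cyc vs (Suc (Suc i))"
  have ab: "a \<noteq> b" "b \<noteq> c" using pcurve_edge(2)[OF vs] by (auto simp: a_def b_def c_def)
  have kk: "c - b = k *\<^sub>R (b - a)" using k by (simp add: a_def b_def c_def)
  then have kn: "k < 0" using \<open>\<not> k > 0\<close> ab by (cases "k = 0") auto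
  have c: "c = b + k *\<^sub>R (b - a)" using kk by (simp add: algebra_simps)
  have P: "a \<in> P" "c \<in> P" using pcurve_edge(1)[OF vs] by (auto simp: a_def c_def)
  have ops: "open_segment a b \<inter> P = {}" "open_segment b c \<inter> P = {}"
    using pcurve_edge(3)[OF vs] by (auto simp: a_def b_def c_def)
  consider "k = -1" | "k > -1" | "k < -1" by linarith
  then show False
  proof cases
    case 1
    then show ?thesis using ac c by (simp add: a_def c_def)
  next
    case 2
    have "c = (1 - (1 + k)) *\<^sub>R a + (1 + k) *\<^sub>R b" unfolding c by (simp add: algebra_simps)
    then have "c \<in> open_segment a b" using 2 kn ab by (auto simp: in_segment intro!: exI[of _ "1 + k"])
    then show ?thesis using ops P by auto
  next
    case 3
    have "k *\<^sub>R a = k *\<^sub>R b - (c - b)" unfolding c by (simp add: algebra_simps)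
    then have "(1/k) *\<^sub>R (k *\<^sub>R a) = (1/k) *\<^sub>R (k *\<^sub>R b - (c - b))" by simp
    then have "a = (1 - (- 1/k)) *\<^sub>R b + (- 1/k) *\<^sub>R c"
      using kn by (simp add: algebra_simps)
    moreover have "0 < - 1/k" "- 1/k < 1" using 3 by (auto simp: field_simps)
    ultimately have "a \<in> open_segment b c" using ab unfolding in_segment by blast
    then show ?thesis using ops P by auto
  qed
qed

text \<open>Each edge has all vertices on one side; what remains is that the side does not change
  from an edge to the next. A change would force the two edges onto one line. Going straight on
  would then put a vertex off the line on both sides, and turning back is a spike or ends inside an
  edge.\<close>

lemma no_alt_oriented:
  assumes vs: "pcurve P vs" and na: "no_alt (cyc vs) (length vs)"
    and int: "interior (convex hull (set vs)) \<noteq> {}"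
  obtains \<sigma> where "\<sigma> = 1 \<or> \<sigma> = -1" "oriented \<sigma> vs"
proof -
  define D where "D i = cyc vs (Suc i) - cyc vs i" for i
  define S where "S s i \<longleftrightarrow> (\<forall>x\<in>set vs. s * cr (D i) (x - cyc vs i) \<ge> 0)" for s :: real and i
  have ne: "vs \<noteq> []" using vs by (auto simp: pcurve_def)
  have D0: "D i \<noteq> 0" for i using pcurve_edge(2)[OF vs, of i] by (auto simp: D_def)
  have sg: "S 1 i \<or> S (-1) i" for i
    using no_alt_edge_supports[OF na, of i] D0[of i] unfolding S_def D_def by (force simp: not_le)
  have step: "S s (Suc i)" if s: "s = 1 \<or> s = -1" and Si: "S s i" for s i
  proof (rule ccontr)
    assume nS: "\<not> S s (Suc i)"
    then have S': "S (-s) (Suc i)" using sg[of "Suc i"] s by auto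
    define p q where "p = D i" and "q = D (Suc i)"
    define a b c where "a = cyc vs i" and "b = cyc vs (Suc i)" and "c = cyc vs (Suc (Suc i))"
    have pq: "p = b - a" "q = c - b" by (auto simp: p_def q_def D_def a_def b_def c_def)
    \<comment> \<open>Testing each edge against the far end of the other gives opposite signs for
      the same number \<open>cr p q\<close>.\<close>
    have "s * cr p (c - a) \<ge> 0" using Si cyc_in_set[OF ne] unfolding S_def p_def a_def c_def by blast
    moreover have "- s * cr q (a - b) \<ge> 0" using S' cyc_in_set[OF ne] unfolding S_def q_def a_def b_def by blast
    moreover have "cr p (c - a) = cr p q" unfolding pq by (simp add: cr_def algebra_simps)
    moreover have "cr q (a - b) = cr p q" unfolding pq by (simp add: cr_def algebra_simps)
    ultimately have c0: "cr p q = 0" using s by auto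
    have p0: "p \<noteq> 0" using D0 by (auto simp: p_def q_def)
    obtain k where k: "q = k *\<^sub>R p" using cr_eq_0_imp[OF c0 p0] by blast
    obtain y where y: "y \<in> set vs" "cr p (y - a) \<noteq> 0" using exists_off_line[OF int p0] by blast
    show False
    proof (cases "k > 0")
      case True
      have "cr q (y - b) = k * cr p (y - a)"
      proof -
        have yb: "y - b = (y - a) - p" using pq by simp
        show ?thesis unfolding k cr_scale_left yb cr_diff_right[of p "y - a" p] cr_self by simp
      qed
      moreover have "s * cr p (y - a) \<ge> 0" using Si y unfolding S_def p_def a_def by blast
      moreover have "- s * cr q (y - b) \<ge> 0" using S' y unfolding S_def q_def b_def by blast
      ultimately have "k * (s * cr p (y - a)) \<le> 0" "s * cr p (y - a) \<ge> 0" by (auto simp: algebra_simps)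
      then show False using True s y by (auto simp: mult_le_0_iff)
    next
      case False
      have "cyc vs (Suc (Suc i)) \<noteq> cyc vs i"
        using no_alt_no_spike[OF na pcurve_edge(2)[OF vs, of i] y(1)] y(2) by (auto simp: p_def D_def a_def)
      then show False using pcurve_forward[OF vs] k False by (auto simp: p_def q_def D_def)
    qed
  qed
  obtain s where s: "s = 1 \<or> s = -1" "S s 0" using sg[of 0] by blast
  have "S s i" for i by (induction i) (use s step in auto)
  then have "oriented s vs" unfolding oriented_def using halfplane_hull unfolding S_def D_def by blast
  then show thesis using that s by blast
qed

lemma oriented_interior:
  assumes o: "oriented \<sigma> vs" "\<sigma> = 1 \<or> \<sigma> = -1" and vs: "pcurve P vs"
    and z: "z \<in> interior (convex hull (set vs))"
  shows "\<sigma> * cr (cyc vs (Suc i) - cyc vs i) (z - cyc vs i) > 0"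
proof -
  let ?e = "\<sigma> *\<^sub>R (\<i> * (cyc vs (Suc i) - cyc vs i))"
  have eq: "\<sigma> * cr (cyc vs (Suc i) - cyc vs i) (x - cyc vs i) = ?e \<bullet> x - ?e \<bullet> cyc vs i" for x
    by (simp add: cr_inner inner_diff_right algebra_simps)
  have "convex hull (set vs) \<subseteq> {x. ?e \<bullet> x \<ge> ?e \<bullet> cyc vs i}" 
  proof
    fix x assume "x \<in> convex hull (set vs)"
    then have "\<sigma> * cr (cyc vs (Suc i) - cyc vs i) (x - cyc vs i) \<ge> 0" using o(1) unfolding oriented_def by blast
    then show "x \<in> {x. ?e \<bullet> x \<ge> ?e \<bullet> cyc vs i}" unfolding eq by simp
  qed
  then have "z \<in> interior {x. ?e \<bullet> x \<ge> ?e \<bullet> cyc vs i}" using z interior_mono by blast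
  moreover have e0: "?e \<noteq> 0" using pcurve_edge(2)[OF vs, of i] o(2) by auto
  ultimately have "z \<in> {x. ?e \<bullet> x > ?e \<bullet> cyc vs i}" using interior_halfspace_ge[OF e0] by blast
  then show ?thesis unfolding eq by simp
qed

text \<open>The angle \<open>a\<close> is a lifted one, not reduced modulo 2 pi, and is counted clockwise if \<open>\<sigma> = -1\<close>.\<close>

definition ang :: "complex \<Rightarrow> real \<Rightarrow> complex \<Rightarrow> real \<Rightarrow> bool" where
  "ang z0 \<sigma> z a \<longleftrightarrow> z \<noteq> z0 \<and> z - z0 = of_real (norm (z - z0)) * cis (\<sigma> * a)"

section \<open>Lifted angles along segments and polygons\<close>

lemma ang_cr:
  assumes "\<sigma> = 1 \<or> \<sigma> = -1" "ang z0 \<sigma> z a" "ang z0 \<sigma> w b"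
  shows "\<sigma> * cr (z - z0) (w - z0) = norm (z - z0) * norm (w - z0) * sin (b - a)"
proof -
  have "cnj (z - z0) * (w - z0) = of_real (norm (z - z0) * norm (w - z0)) * (cis (- (\<sigma> * a)) * cis (\<sigma> * b))"
    using assms unfolding ang_def by (metis (no_types, lifting) cis_cnj complex_cnj_complex_of_real complex_cnj_mult mult.assoc mult.left_commute of_real_mult)
  also have "\<dots> = of_real (norm (z - z0) * norm (w - z0)) * cis (\<sigma> * (b - a))"
    by (simp add: cis_mult algebra_simps)
  finally have "cr (z - z0) (w - z0) = norm (z - z0) * norm (w - z0) * sin (\<sigma> * (b - a))"
    by (simp add: cr_def del: of_real_mult)
  then show ?thesis using assms(1) by (auto simp: sin_diff)
qed

lemma angI:
  assumes "z - z0 = of_real r * cis (\<sigma> * a)" "r > 0"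
  shows "ang z0 \<sigma> z a"
proof -
  have n: "norm (z - z0) = r" using assms by (simp add: norm_mult)
  have "z \<noteq> z0" using n assms(2) by auto
  then show ?thesis using assms unfolding ang_def n by simp
qed

lemma sin_neg_abs: "- pi < x \<Longrightarrow> x < 0 \<Longrightarrow> sin x < 0" for x :: real
  using sin_gt_zero[of "- x"] by simp

lemma mult3_nonneg_cancel:
  fixes x y s :: real
  assumes "0 \<le> x * y * s" "0 < x" "0 < y"
  shows "0 \<le> s"
proof -
  have "0 < x * y" using assms by simp
  then show ?thesis using assms(1) by (metis mult_pos_neg not_less)
qed

text \<open>Below an aperture of \<open>pi\<close>, the sine of an angle difference has the sign of
  the difference, so the cross products of \<open>z\<close> with \<open>A\<close> and with
  \<open>B\<close> place its angle between \<open>a\<close> and \<open>b\<close>.\<close>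

lemma ang_segment:
  assumes \<sigma>: "\<sigma> = 1 \<or> \<sigma> = -1" and A: "ang z0 \<sigma> A a" and B: "ang z0 \<sigma> B b" and ab: "a \<le> b" "b < a + pi"
    and z: "z \<in> closed_segment A B"
  shows "\<exists>c\<in>{a..b}. ang z0 \<sigma> z c"
proof -
  obtain t where t: "0 \<le> t" "t \<le> 1" "z = (1 - t) *\<^sub>R A + t *\<^sub>R B" using z by (auto simp: in_segment)
  have zz: "z - z0 = (1 - t) *\<^sub>R (A - z0) + t *\<^sub>R (B - z0)" unfolding t by (simp add: algebra_simps)
  have n: "norm (A - z0) > 0" "norm (B - z0) > 0" using A B by (auto simp: ang_def)
  show ?thesis
  proof (cases "a = b")
    case True
    have "z - z0 = of_real ((1 - t) * norm (A - z0) + t * norm (B - z0)) * cis (\<sigma> * a)"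
    proof -
      define C nA nB where "C = cis (\<sigma> * a)" and "nA = norm (A - z0)" and "nB = norm (B - z0)"
      have "A - z0 = of_real nA * C" "B - z0 = of_real nB * C"
        using A B True unfolding ang_def C_def nA_def nB_def by auto
      then have "z - z0 = of_real ((1 - t) * nA + t * nB) * C"
        unfolding zz by (simp add: scaleR_conv_of_real algebra_simps)
      then show ?thesis unfolding C_def nA_def nB_def .
    qed
    moreover have "(1 - t) * norm (A - z0) + t * norm (B - z0) > 0"
      using t n by (cases "t = 0") (auto intro: add_nonneg_pos)
    ultimately have "ang z0 \<sigma> z a" by (rule angI)
    then show ?thesis using True by auto
  next
    case False
    then have S: "sin (b - a) > 0" using ab by (intro sin_gt_zero) auto
    have AB: "\<sigma> * cr (A - z0) (B - z0) = norm (A - z0) * norm (B - z0) * sin (b - a)" by (rule ang_cr[OF \<sigma> A B])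
    have z0: "z \<noteq> z0"
    proof
      assume "z = z0"
      then have "(1 - t) *\<^sub>R (A - z0) + t *\<^sub>R (B - z0) = 0" using zz by simp
      then have "cr (A - z0) ((1 - t) *\<^sub>R (A - z0) + t *\<^sub>R (B - z0)) = 0"
        "cr (B - z0) ((1 - t) *\<^sub>R (A - z0) + t *\<^sub>R (B - z0)) = 0" by (simp_all add: cr_def)
      then have "t * cr (A - z0) (B - z0) = 0" "(1 - t) * cr (A - z0) (B - z0) = 0"
        using cr_swap[of "A - z0" "B - z0"] by (simp_all add: cr_add_right cr_scale_right)
      moreover have "cr (A - z0) (B - z0) \<noteq> 0" using AB n S by auto
      ultimately show False by auto
    qed
    define w where "w = (z - z0) / cis (\<sigma> * a)"
    \<comment> \<open>The candidate is the angle within \<open>pi\<close> of \<open>a\<close>. The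
      sign condition at \<open>A\<close> leaves only \<open>c \<ge> a\<close> or
      \<open>c = a - pi\<close>, and the latter is excluded by the condition at
      \<open>B\<close>.\<close>
    define c where "c = a + \<sigma> * Arg w"
    have sg: "\<sigma> * (\<sigma> * x) = x" for x using \<sigma> by auto
    have wn: "norm w = norm (z - z0)" by (simp add: w_def norm_divide)
    have w0: "w \<noteq> 0" using z0 by (simp add: w_def)
    have "w = of_real (norm w) * cis (Arg w)" using w0 by (metis rcis_cmod_Arg rcis_def)
    then have "z - z0 = of_real (norm (z - z0)) * (cis (Arg w) * cis (\<sigma> * a))"
      unfolding wn by (metis cis_neq_zero mult.assoc nonzero_eq_divide_eq w_def)
    then have zc: "ang z0 \<sigma> z c" unfolding ang_def c_def using z0 by (simp add: cis_mult algebra_simps sg)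
    have "norm (A - z0) * norm (z - z0) * sin (c - a) = \<sigma> * cr (A - z0) (z - z0)" using ang_cr[OF \<sigma> A zc] by simp
    also have "\<dots> = t * (\<sigma> * cr (A - z0) (B - z0))" unfolding zz by (simp add: cr_add_right cr_scale_right)
    also have "\<dots> \<ge> 0" unfolding AB using t n S by simp
    finally have s1: "sin (c - a) \<ge> 0" by (rule mult3_nonneg_cancel) (use n z0 in simp_all)
    have "norm (z - z0) * norm (B - z0) * sin (b - c) = \<sigma> * cr (z - z0) (B - z0)" using ang_cr[OF \<sigma> zc B] by simp
    also have "\<dots> = (1 - t) * (\<sigma> * cr (A - z0) (B - z0))" unfolding zz
      by (subst cr_swap) (simp add: cr_add_right cr_scale_right cr_swap[of "B - z0"])
    also have "\<dots> \<ge> 0" unfolding AB using t n S by simp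
    finally have s2: "sin (b - c) \<ge> 0" by (rule mult3_nonneg_cancel) (use n z0 in simp_all)
    have "- pi \<le> c - a" "c - a \<le> pi" using \<sigma> mpi_less_Arg[of w] Arg_le_pi[of w] by (auto simp: c_def)
    have c1: "c - a \<ge> 0 \<or> c - a = - pi"
      using sin_neg_abs[of "c - a"] s1 \<open>- pi \<le> c - a\<close> by linarith
    show ?thesis
    proof (cases "c - a = - pi")
      case True
      have "sin (b - c) = - sin (b - a)"
      proof -
        have "b - c = (b - a) + pi" using True by simp
        then show ?thesis by (simp only: sin_periodic_pi)
      qed
      then show ?thesis using s2 S by simp
    next
      case F: False
      then have "c \<ge> a" using c1 by simp
      moreover have "b - c > - pi" using \<open>c - a \<le> pi\<close> False ab by linarith
      then have "b - c \<ge> 0" using sin_neg_abs[of "b - c"] s2 by linarith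
      ultimately show ?thesis using zc by auto
    qed
  qed
qed

lemma ang_mono_aux:
  assumes \<sigma>: "\<sigma> = 1 \<or> \<sigma> = -1" and "ang z0 \<sigma> z a" "ang z0 \<sigma> w b" "\<bar>a - b\<bar> < pi"
    and "\<sigma> * cr (z - z0) (w - z0) \<ge> 0"
  shows "a \<le> b"
proof (rule ccontr)
  assume "\<not> a \<le> b"
  then have "sin (b - a) < 0" using assms(4) by (intro sin_neg_abs) auto
  moreover have "norm (z - z0) > 0" "norm (w - z0) > 0" using assms by (auto simp: ang_def)
  ultimately have "norm (z - z0) * norm (w - z0) * sin (b - a) < 0" by (intro mult_pos_neg mult_pos_pos)
  then show False using ang_cr[OF assms(1-3)] assms(5) by simp
qed

text \<open>The angles are chosen point by point. Monotonicity comes from the sign of the cross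
  product of two points of the segment, and uniqueness within a window shorter than
  \<open>pi\<close> fixes the end values.\<close>

lemma ang_linepath:
  assumes \<sigma>: "\<sigma> = 1 \<or> \<sigma> = -1" and A: "ang z0 \<sigma> A a" and B: "ang z0 \<sigma> B b" and ab: "a \<le> b" "b < a + pi"
  obtains \<alpha> where "mono_on {0..1} \<alpha>" "\<alpha> 0 = a" "\<alpha> 1 = b" "\<And>t. t \<in> {0..1} \<Longrightarrow> ang z0 \<sigma> (linepath A B t) (\<alpha> t)"
proof -
  have "\<exists>c\<in>{a..b}. ang z0 \<sigma> (linepath A B t) c" if "t \<in> {0..1}" for t
    by (rule ang_segment[OF \<sigma> A B ab]) (use that linepath_in_path in blast)
  then obtain \<beta> where \<beta>: "\<And>t. t \<in> {0..1} \<Longrightarrow> \<beta> t \<in> {a..b} \<and> ang z0 \<sigma> (linepath A B t) (\<beta> t)" by metis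
  have ABp: "\<sigma> * cr (A - z0) (B - z0) \<ge> 0"
    unfolding ang_cr[OF \<sigma> A B] using ab by (intro mult_nonneg_nonneg sin_ge_zero) auto
  have mono: "\<beta> s \<le> \<beta> t" if "s \<in> {0..1}" "t \<in> {0..1}" "s \<le> t" for s t
  proof (rule ang_mono_aux[OF \<sigma>])
    show "\<bar>\<beta> s - \<beta> t\<bar> < pi" using \<beta>[OF that(1)] \<beta>[OF that(2)] ab by auto
    have l: "linepath A B t - z0 = (1 - t) *\<^sub>R (A - z0) + t *\<^sub>R (B - z0)" for t
      by (simp add: linepath_def algebra_simps)
    have c: "cr (linepath A B s - z0) (linepath A B t - z0) = (t - s) * cr (A - z0) (B - z0)"
      unfolding l by (simp add: cr_def algebra_simps)
    have "\<sigma> * cr (linepath A B s - z0) (linepath A B t - z0) = (t - s) * (\<sigma> * cr (A - z0) (B - z0))"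
      unfolding c by (rule mult.left_commute)
    also have "\<dots> \<ge> 0" using that by (intro mult_nonneg_nonneg[OF _ ABp]) auto
    finally show "\<sigma> * cr (linepath A B s - z0) (linepath A B t - z0) \<ge> 0" .
  qed (use \<beta> that in auto)
  have uniq: "c = d" if "ang z0 \<sigma> z c" "ang z0 \<sigma> z d" "c \<in> {a..b}" "d \<in> {a..b}" for z c d
  proof (rule antisym)
    show "c \<le> d" by (rule ang_mono_aux[OF \<sigma> that(1,2)]) (use that ab in auto)
    show "d \<le> c" by (rule ang_mono_aux[OF \<sigma> that(2,1)]) (use that ab in auto)
  qed
  show thesis
  proof (rule that[of \<beta>])
    show "mono_on {0..1} \<beta>" using mono by (auto simp: mono_on_def)
    show "\<beta> 0 = a" using uniq[of A "\<beta> 0" a] A \<beta>[of 0] ab by (auto simp: linepath_def)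
    show "\<beta> 1 = b" using uniq[of B "\<beta> 1" b] B \<beta>[of 1] ab by (auto simp: linepath_def)
  qed (use \<beta> in auto)
qed

lemma ang_polypath:
  assumes \<sigma>: "\<sigma> = 1 \<or> \<sigma> = -1" and len: "length zs \<ge> 2"
    and "\<forall>x\<in>set zs. ang z0 \<sigma> (fst x) (snd x)"
    and "successively (\<lambda>x y. snd x \<le> snd y \<and> snd y < snd x + pi) zs"
  shows "\<exists>\<alpha>. mono_on {0..1} \<alpha> \<and> \<alpha> 0 = snd (hd zs) \<and> \<alpha> 1 = snd (last zs) \<and>
    (\<forall>t\<in>{0..1}. ang z0 \<sigma> (polypath (map fst zs) t) (\<alpha> t))"
  using assms(2-)
proof (induction zs rule: induct_list012)
  case (3 x y zs)
  have xy: "ang z0 \<sigma> (fst x) (snd x)" "ang z0 \<sigma> (fst y) (snd y)" "snd x \<le> snd y" "snd y < snd x + pi" using 3 by auto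
  obtain \<alpha> where \<alpha>: "mono_on {0..1} \<alpha>" "\<alpha> 0 = snd x" "\<alpha> 1 = snd y"
     "\<And>t. t \<in> {0..1} \<Longrightarrow> ang z0 \<sigma> (linepath (fst x) (fst y) t) (\<alpha> t)"
    using ang_linepath[OF \<sigma> xy] by blast
  show ?case
  proof (cases zs)
    case Nil
    then show ?thesis using \<alpha> by (intro exI[of _ \<alpha>]) auto
  next
    case (Cons z zs')
    obtain \<beta> where \<beta>: "mono_on {0..1} \<beta>" "\<beta> 0 = snd y" "\<beta> 1 = snd (last (y # zs))"
      "\<And>t. t \<in> {0..1} \<Longrightarrow> ang z0 \<sigma> (polypath (map fst (y # zs)) t) (\<beta> t)"
      using 3(2) 3(3-) Cons by auto
    have p: "polypath (map fst (x # y # zs)) = linepath (fst x) (fst y) +++ polypath (map fst (y # zs))"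
      by (simp add: Cons)
    define \<gamma> where "\<gamma> t = (if t \<le> 1/2 then \<alpha> (2 * t) else \<beta> (2 * t - 1))" for t
    have "mono_on {0..1} \<gamma>"
    proof (rule mono_onI)
      fix s t :: real assume st: "s \<in> {0..1}" "t \<in> {0..1}" "s \<le> t"
      consider "t \<le> 1/2" | "s \<le> 1/2" "t > 1/2" | "s > 1/2" "t > 1/2" using st by linarith
      then show "\<gamma> s \<le> \<gamma> t"
      proof cases
        case 1
        then show ?thesis using st mono_onD[OF \<alpha>(1), of "2 * s" "2 * t"] by (auto simp: \<gamma>_def)
      next
        case 2
        then have "\<alpha> (2 * s) \<le> \<alpha> 1" "\<beta> 0 \<le> \<beta> (2 * t - 1)" using st
          by (auto intro!: mono_onD[OF \<alpha>(1)] mono_onD[OF \<beta>(1)])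
        then show ?thesis using 2 \<alpha> \<beta> by (auto simp: \<gamma>_def)
      next
        case 3
        then show ?thesis using st mono_onD[OF \<beta>(1), of "2 * s - 1" "2 * t - 1"] by (auto simp: \<gamma>_def)
      qed
    qed
    moreover have "ang z0 \<sigma> (polypath (map fst (x # y # zs)) t) (\<gamma> t)" if "t \<in> {0..1}" for t
      unfolding p using \<alpha>(4)[of "2 * t"] \<beta>(4)[of "2 * t - 1"] that by (auto simp: \<gamma>_def joinpaths_def)
    moreover have "\<gamma> 0 = snd x" "\<gamma> 1 = snd (last (x # y # zs))" using \<alpha>(2) \<beta>(3) by (auto simp: \<gamma>_def)
    ultimately show ?thesis by (intro exI[of _ \<gamma>] conjI ballI) auto
  qed
qed auto

text \<open>A converse of \<open>ang_segment\<close>: every direction of the cone is met. The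
  weights \<open>x\<close> and \<open>y\<close> come from the identity \<open>sin (b - c) * cis a +
  sin (c - a) * cis b = sin (b - a) * cis c\<close>, taken with the sign
  \<open>\<sigma>\<close>.\<close>

lemma ang_cone:
  assumes \<sigma>: "\<sigma> = 1 \<or> \<sigma> = -1" and A: "ang z0 \<sigma> A a" and B: "ang z0 \<sigma> B b" and ab: "a \<le> c" "c \<le> b" "b < a + pi"
  obtains r where "r > 0" "z0 + of_real r * cis (\<sigma> * c) \<in> closed_segment A B"
proof (cases "a = b")
  case True
  then have "A = z0 + of_real (norm (A - z0)) * cis (\<sigma> * c)" "norm (A - z0) > 0"
    using A ab by (auto simp: ang_def algebra_simps)
  then show thesis using that by (metis ends_in_segment(1))
next
  case False
  define x y where "x = sin (b - c) / norm (A - z0)" and "y = sin (c - a) / norm (B - z0)"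
  have n: "norm (A - z0) > 0" "norm (B - z0) > 0" using A B by (auto simp: ang_def)
  have S: "sin (b - a) > 0" using ab False by (intro sin_gt_zero) auto
  have xy: "x \<ge> 0" "y \<ge> 0" unfolding x_def y_def using ab by (auto intro!: divide_nonneg_nonneg sin_ge_zero)
  have id: "sin (b - c) *\<^sub>R cis (\<sigma> * a) + sin (c - a) *\<^sub>R cis (\<sigma> * b) = sin (b - a) *\<^sub>R cis (\<sigma> * c)"
  proof -
    have 1: "sin (b - c) * cos a + sin (c - a) * cos b = sin (b - a) * cos c"
      by (simp add: sin_diff algebra_simps)
    have 2: "sin (b - c) * sin a + sin (c - a) * sin b = sin (b - a) * sin c"
      by (simp add: sin_diff algebra_simps)
    show ?thesis using \<sigma> 1 2 by (auto simp: complex_eq_iff)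
  qed
  have A': "A - z0 = norm (A - z0) *\<^sub>R cis (\<sigma> * a)" and B': "B - z0 = norm (B - z0) *\<^sub>R cis (\<sigma> * b)"
    using A B by (auto simp: ang_def scaleR_conv_of_real)
  have "x *\<^sub>R (A - z0) = sin (b - c) *\<^sub>R cis (\<sigma> * a)" using n by (subst A') (simp add: x_def)
  moreover have "y *\<^sub>R (B - z0) = sin (c - a) *\<^sub>R cis (\<sigma> * b)" using n by (subst B') (simp add: y_def)
  ultimately have sum: "x *\<^sub>R (A - z0) + y *\<^sub>R (B - z0) = sin (b - a) *\<^sub>R cis (\<sigma> * c)" using id by simp
  have T: "x + y > 0"
  proof (rule ccontr)
    assume "\<not> x + y > 0"
    then have "x = 0" "y = 0" using xy by auto
    then have "sin (b - a) *\<^sub>R cis (\<sigma> * c) = 0" using sum by simp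
    then show False using S by simp
  qed
  define t where "t = y / (x + y)"
  have t: "0 \<le> t" "t \<le> 1" "1 - t = x / (x + y)" using xy T by (auto simp: t_def field_simps)
  have "z0 + (sin (b - a) / (x + y)) *\<^sub>R cis (\<sigma> * c) = (1 - t) *\<^sub>R A + t *\<^sub>R B"
  proof -
    have "(1 - t) *\<^sub>R (A - z0) + t *\<^sub>R (B - z0) = (1 / (x + y)) *\<^sub>R (x *\<^sub>R (A - z0) + y *\<^sub>R (B - z0))"
      unfolding t(3) by (simp add: t_def scaleR_add_right)
    also have "\<dots> = (sin (b - a) / (x + y)) *\<^sub>R cis (\<sigma> * c)" unfolding sum by simp
    finally show ?thesis by (simp add: algebra_simps)
  qed
  then have "z0 + (sin (b - a) / (x + y)) *\<^sub>R cis (\<sigma> * c) \<in> closed_segment A B" using t by (auto simp: in_segment)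
  then show thesis using that[of "sin (b - a) / (x + y)"] S T by (simp add: scaleR_conv_of_real)
qed

text \<open>Summing the angles between consecutive vertices gives a lift that grows by a multiple of
  2 pi over one period. A second turn around \<open>z0\<close> would make a line through
  \<open>z0\<close> be crossed four times, against \<open>no_alt\<close>.\<close>

lemma angle_lift_exists:
  assumes o: "oriented \<sigma> vs" "\<sigma> = 1 \<or> \<sigma> = -1" and vs: "pcurve P vs" and na: "no_alt (cyc vs) (length vs)"
    and z: "z0 \<in> interior (convex hull (set vs))"
  obtains a where "\<And>i. ang z0 \<sigma> (cyc vs i) (a i)" "\<And>i. a i < a (Suc i)" "\<And>i. a (Suc i) < a i + pi"
    "\<And>i. a (i + length vs) = a i + 2 * pi"
proof -
  let ?v = "cyc vs" and ?M = "length vs"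
  have ne: "vs \<noteq> []" using vs by (auto simp: pcurve_def)
  have pos: "\<sigma> * cr (?v i - z0) (?v (Suc i) - z0) > 0" for i
    using oriented_interior[OF o vs z, of i] by (simp add: cr_triangle)
  have nz: "?v i \<noteq> z0" for i using pos[of i] by (auto simp: cr_def)
  define \<delta> where "\<delta> i = \<sigma> * Arg ((?v (Suc i) - z0) / (?v i - z0))" for i
  have \<delta>: "0 < \<delta> i" "\<delta> i < pi" for i
  proof -
    let ?w = "(?v (Suc i) - z0) / (?v i - z0)"
    have "?w = ((?v (Suc i) - z0) * cnj (?v i - z0)) / of_real ((norm (?v i - z0))\<^sup>2)"
      using complex_div_cnj[of "?v (Suc i) - z0" "?v i - z0"] by simp
    then have "Im ?w = cr (?v i - z0) (?v (Suc i) - z0) / (norm (?v i - z0))\<^sup>2"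
      unfolding cr_def by (metis Im_divide_of_real mult.commute)
    then have "\<sigma> * Im ?w = (\<sigma> * cr (?v i - z0) (?v (Suc i) - z0)) / (norm (?v i - z0))\<^sup>2" by simp
    also have "\<dots> > 0" using pos[of i] nz[of i] by (intro divide_pos_pos) auto
    finally have "\<sigma> * Im ?w > 0" .
    then have "(\<sigma> = 1 \<and> Im ?w > 0) \<or> (\<sigma> = -1 \<and> Im ?w < 0)" using o(2) by auto
    then have "(\<sigma> = 1 \<and> 0 < Arg ?w \<and> Arg ?w < pi) \<or> (\<sigma> = -1 \<and> Arg ?w < 0)"
      using Arg_lt_pi[of ?w] Arg_neg_iff[of ?w] by auto
    then show "0 < \<delta> i" "\<delta> i < pi" using mpi_less_Arg[of ?w] by (auto simp: \<delta>_def)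
  qed
  define a where "a = rec_nat (\<sigma> * Arg (?v 0 - z0)) (\<lambda>i x. x + \<delta> i)"
  have a0: "a 0 = \<sigma> * Arg (?v 0 - z0)" and aS: "a (Suc i) = a i + \<delta> i" for i by (auto simp: a_def)
  have sg: "\<sigma> * (\<sigma> * x) = x" for x using o(2) by auto
  have an: "ang z0 \<sigma> (?v i) (a i)" for i
  proof (induction i)
    case 0
    show ?case unfolding ang_def a0 sg using nz[of 0]
      by (metis rcis_cmod_Arg rcis_def)
  next
    case (Suc i)
    let ?w = "(?v (Suc i) - z0) / (?v i - z0)"
    have "?w = of_real (norm ?w) * cis (Arg ?w)" by (metis rcis_cmod_Arg rcis_def)
    then have "?w = of_real (norm ?w) * cis (\<sigma> * \<delta> i)" by (simp add: \<delta>_def sg)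
    then have "?v (Suc i) - z0 = (?v i - z0) * (of_real (norm ?w) * cis (\<sigma> * \<delta> i))"
      using nz[of i] by (metis eq_iff_diff_eq_0 nonzero_mult_div_cancel_left times_divide_eq_right)
    also have "\<dots> = (of_real (norm (?v i - z0)) * cis (\<sigma> * a i)) * (of_real (norm ?w) * cis (\<sigma> * \<delta> i))"
      using Suc unfolding ang_def by metis
    also have "\<dots> = of_real (norm (?v i - z0) * norm ?w) * (cis (\<sigma> * a i) * cis (\<sigma> * \<delta> i))"
      by simp
    also have "\<dots> = of_real (norm (?v i - z0) * norm ?w) * cis (\<sigma> * a (Suc i))"
      by (simp add: cis_mult aS distrib_left)
    finally show ?case by (rule angI) (use nz[of i] nz[of "Suc i"] in auto)
  qed
  have mono: "a i < a (Suc i)" "a (Suc i) < a i + pi" for i using \<delta>[of i] by (auto simp: aS)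
  have smono: "strict_mono a" using mono(1) by (simp add: strict_mono_Suc_iff)
  have per: "a (i + ?M) - a i = a ?M - a 0" for i
  proof (induction i)
    case (Suc i)
    have "\<delta> (i + ?M) = \<delta> i" unfolding \<delta>_def using cyc_add_length[of vs i] cyc_add_length[of vs "Suc i"] by simp
    then show ?case using Suc by (simp add: aS)
  qed simp
  have "cis (\<sigma> * (a ?M - a 0)) = 1"
  proof -
    have "?v ?M = ?v 0" using cyc_add_length[of vs 0] by simp
    then have "cis (\<sigma> * a ?M) = cis (\<sigma> * a 0)" using an[of 0] an[of ?M] nz[of 0] unfolding ang_def
      by (metis mult_cancel_left norm_eq_zero of_real_eq_0_iff right_minus_eq)
    then have "cis (\<sigma> * a ?M) / cis (\<sigma> * a 0) = 1" by simp
    then show ?thesis by (simp add: cis_divide right_diff_distrib)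
  qed
  then have "cos (\<sigma> * (a ?M - a 0)) = 1" by (metis cis.simps(1) one_complex.simps(1))
  then have "cos (a ?M - a 0) = 1" using o(2) cos_minus[of "a ?M - a 0"] by auto
  then obtain n :: int where n: "a ?M - a 0 = of_int n * 2 * pi" using cos_one_2pi_int by blast
  have "a ?M - a 0 > 0" using smono ne by (simp add: strict_mono_less)
  then have np: "of_int n * (2 * pi) > 0" using n by simp
  have n1: "n \<ge> 1"
  proof (rule ccontr)
    assume "\<not> n \<ge> 1"
    then have "of_int n \<le> (0::real)" by simp
    then have "of_int n * (2 * pi) \<le> 0" by (intro mult_nonpos_nonneg) auto
    then show False using np by linarith
  qed
  have "n = 1"
  proof (rule ccontr)
    assume "n \<noteq> 1"
    then have "of_int n \<ge> (2::real)" using n1 by linarith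
    then have "of_int n * (2 * pi) \<ge> 2 * (2 * pi)" by (intro mult_right_mono) auto
    then have big: "a ?M \<ge> a 0 + 4 * pi" using n unfolding mult.assoc by linarith
    \<comment> \<open>The line through \<open>z0\<close> starts 1 radian behind the first vertex;
      any amount strictly between 0 and \<open>pi\<close> has the same effect.\<close>
    define \<phi> where "\<phi> = a 0 - 1"
    \<comment> \<open>Every step is shorter than \<open>pi\<close>, so none of the four half turns
      is jumped over: the first vertex past the start of a half turn lies in it. The signs of the
      sine alternate over these vertices.\<close>
    have "\<exists>i. a i - \<phi> > of_nat k * pi \<and> a i - \<phi> < of_nat (Suc k) * pi \<and> i < ?M \<and> (\<forall>j. a j - \<phi> > of_nat k * pi \<longrightarrow> i \<le> j)"
      if k: "k \<le> 3" for k :: nat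
    proof -
      define Q where "Q i \<longleftrightarrow> a i - \<phi> > of_nat k * pi" for i
      define i where "i = (LEAST i. Q i)"
      have "of_nat k * pi \<le> 3 * pi" using k by (intro mult_right_mono) auto
      then have "Q ?M" unfolding Q_def \<phi>_def using big pi_gt_zero by linarith
      then have Qi: "Q i" unfolding i_def by (rule LeastI)
      have lt: "a i - \<phi> < of_nat (Suc k) * pi"
      proof (cases i)
        case 0
        have "1 < pi" using pi_gt3 by simp
        moreover have "pi \<le> of_nat (Suc k) * pi" by simp
        ultimately show ?thesis unfolding 0 \<phi>_def by linarith
      next
        case (Suc j)
        then have "\<not> Q j" using not_less_Least[of j Q] i_def by auto
        then have "a j - \<phi> \<le> of_nat k * pi" by (simp add: Q_def)
        then have "a (Suc j) - \<phi> < of_nat k * pi + pi" using mono(2)[of j] by linarith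
        then show ?thesis using Suc by (simp add: algebra_simps)
      qed
      have "of_nat (Suc k) * pi \<le> 4 * pi" using k by (intro mult_right_mono) auto
      then have "a i < a ?M" using lt big unfolding \<phi>_def by linarith
      then have "i < ?M" using smono by (simp add: strict_mono_less)
      moreover have "i \<le> j" if "Q j" for j unfolding i_def using that by (rule Least_le)
      ultimately show ?thesis using Qi lt unfolding Q_def by blast
    qed
    then have "\<forall>k. \<exists>i. k \<le> 3 \<longrightarrow> a i - \<phi> > of_nat k * pi \<and> a i - \<phi> < of_nat (Suc k) * pi \<and> i < ?M \<and> (\<forall>j. a j - \<phi> > of_nat k * pi \<longrightarrow> i \<le> j)"
      by blast
    then obtain I where I: "\<And>k. k \<le> 3 \<Longrightarrow> a (I k) - \<phi> > of_nat k * pi \<and> a (I k) - \<phi> < of_nat (Suc k) * pi \<and> I k < ?M"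
      by metis
    have lt: "I k < I (Suc k)" if "Suc k \<le> 3" for k
    proof -
      have "a (I k) < a (I (Suc k))" using I[of k] I[of "Suc k"] that by linarith
      then show ?thesis using smono by (simp add: strict_mono_less)
    qed
    define u where "u = \<sigma> *\<^sub>R (\<i> * cis (\<sigma> * \<phi>))"
    have val: "u \<bullet> ?v i - u \<bullet> z0 = norm (?v i - z0) * sin (a i - \<phi>)" for i
    proof -
      have "u \<bullet> ?v i - u \<bullet> z0 = u \<bullet> (?v i - z0)" by (simp add: inner_diff_right)
      also have "\<dots> = u \<bullet> (of_real (norm (?v i - z0)) * cis (\<sigma> * a i))" using an[of i] unfolding ang_def by metis
      also have "\<dots> = \<sigma> * norm (?v i - z0) * sin (\<sigma> * (a i - \<phi>))"
        by (simp add: u_def inner_complex_def sin_diff right_diff_distrib algebra_simps)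
      also have "\<dots> = norm (?v i - z0) * sin (a i - \<phi>)" using o(2) by (auto simp: sin_diff)
      finally show ?thesis .
    qed
    have np: "norm (?v i - z0) > 0" for i using nz[of i] by simp
    have s0: "sin (a (I 0) - \<phi>) > 0" using I[of 0] by (intro sin_gt_zero) auto
    have s2: "sin (a (I 2) - \<phi>) > 0"
    proof -
      have "sin (a (I 2) - \<phi> - 2 * pi) > 0" using I[of 2] by (intro sin_gt_zero) auto
      then show ?thesis by (simp add: sin_diff)
    qed
    have s1: "sin (a (I 1) - \<phi>) < 0"
    proof -
      have "sin (a (I 1) - \<phi> - pi) > 0" using I[of 1] by (intro sin_gt_zero) auto
      then show ?thesis by (simp add: sin_diff)
    qed
    have s3: "sin (a (I 3) - \<phi>) < 0"
    proof -
      have "sin (a (I 3) - \<phi> - pi - 2 * pi) > 0" using I[of 3] by (intro sin_gt_zero) auto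
      then show ?thesis by (simp add: sin_diff)
    qed
    have "I 0 < I 1" "I 1 < I 2" "I 2 < I 3" using lt[of 0] lt[of 1] lt[of 2] by (auto simp: numeral_2_eq_2 numeral_3_eq_3)
    moreover have "u \<bullet> ?v (I 0) > u \<bullet> z0" "u \<bullet> ?v (I 2) > u \<bullet> z0"
      using val[of "I 0"] val[of "I 2"] s0 s2 np[of "I 0"] np[of "I 2"] by (smt (verit) mult_pos_pos)+
    moreover have "u \<bullet> ?v (I 1) < u \<bullet> z0" "u \<bullet> ?v (I 3) < u \<bullet> z0"
      using val[of "I 1"] val[of "I 3"] s1 s3 np[of "I 1"] np[of "I 3"] by (smt (verit) mult_pos_neg)+
    ultimately show False using no_altD[OF na, of "I 0" "I 1" "I 2" "I 3" "u \<bullet> z0" u] I[of 3] by auto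
  qed
  then have "a (i + ?M) = a i + 2 * pi" for i using per[of i] n by simp
  then show thesis using that[of a] an mono by blast
qed

lemma ang_shift: "\<sigma> = 1 \<or> \<sigma> = -1 \<Longrightarrow> ang z0 \<sigma> z (a + 2 * pi * of_int k) \<longleftrightarrow> ang z0 \<sigma> z a"
proof -
  assume \<sigma>: "\<sigma> = 1 \<or> \<sigma> = -1"
  have c: "cis (2 * pi * of_int k) = 1" for k by (simp add: complex_eq_iff)
  have "\<sigma> * (a + 2 * pi * of_int k) = \<sigma> * a + 2 * pi * of_int (if \<sigma> = 1 then k else - k)"
    using \<sigma> by (auto simp: distrib_left)
  then have "cis (\<sigma> * (a + 2 * pi * of_int k)) = cis (\<sigma> * a) * cis (2 * pi * of_int (if \<sigma> = 1 then k else - k))"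
    by (simp only: cis_mult)
  also have "\<dots> = cis (\<sigma> * a)" unfolding c by simp
  finally show ?thesis by (simp add: ang_def)
qed

lemma ang_exists:
  assumes "\<sigma> = 1 \<or> \<sigma> = -1" "z \<noteq> z0"
  obtains b where "x \<le> b" "b < x + 2 * pi" "ang z0 \<sigma> z b"
proof -
  define b0 where "b0 = \<sigma> * Arg (z - z0)"
  have "\<sigma> * b0 = Arg (z - z0)" using assms(1) by (auto simp: b0_def)
  then have b0: "ang z0 \<sigma> z b0" using assms(2) unfolding ang_def by (metis rcis_cmod_Arg rcis_def)
  define k where "k = \<lfloor>(b0 - x) / (2 * pi)\<rfloor>"
  have "of_int k \<le> (b0 - x) / (2 * pi)" "(b0 - x) / (2 * pi) < of_int k + 1" unfolding k_def by linarith+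
  then have "of_int k * (2 * pi) \<le> b0 - x" "b0 - x < (of_int k + 1) * (2 * pi)"
    by (simp_all add: pos_le_divide_eq pos_divide_less_eq)
  then have "x \<le> b0 + 2 * pi * of_int (- k)" "b0 + 2 * pi * of_int (- k) < x + 2 * pi"
    by (simp_all add: algebra_simps)
  then show thesis using that ang_shift[OF assms(1), of z0 z b0 "- k"] b0 by blast
qed

lemma lift_bracket:
  fixes a :: "nat \<Rightarrow> real"
  assumes "a 0 \<le> b" "b < a M"
  obtains i where "i < M" "a i \<le> b" "b < a (Suc i)"
proof -
  define j where "j = (LEAST j. b < a j)"
  have j: "b < a j" unfolding j_def by (rule LeastI[of _ M]) (use assms in simp)
  have jM: "j \<le> M" unfolding j_def by (rule Least_le) (use assms in simp)
  obtain i where i: "j = Suc i" using j assms by (cases j) auto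
  have "\<not> b < a i" using not_less_Least[of i "\<lambda>j. b < a j"] i by (simp add: j_def)
  then show thesis using that[of i] i j jM by auto
qed

subsection \<open>A convex curve still surrounds the next layer after a step\<close>

text \<open>The ray from \<open>z0\<close> through \<open>p\<close> meets an edge at some
  \<open>w\<close>. The side condition of that edge forbids \<open>p\<close> beyond
  \<open>w\<close>, and \<open>p\<close> before \<open>w\<close> would be interior. So
  \<open>p\<close> lies on an edge, and an obstacle on an edge is one of its ends.\<close>

lemma frontier_point_visited:
  assumes vs: "pcurve P vs" and na: "no_alt (cyc vs) (length vs)"
    and int: "interior (convex hull (set vs)) \<noteq> {}"
    and p: "p \<in> P" "p \<in> convex hull (set vs)" "p \<notin> interior (convex hull (set vs))"
  shows "p \<in> set vs"
proof -
  let ?C = "convex hull (set vs)"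
  have ne: "vs \<noteq> []" using vs by (auto simp: pcurve_def)
  obtain z0 where z0: "z0 \<in> interior ?C" using int by blast
  obtain \<sigma> where o: "\<sigma> = 1 \<or> \<sigma> = -1" "oriented \<sigma> vs" using no_alt_oriented[OF vs na int] .
  obtain a where a: "\<And>i. ang z0 \<sigma> (cyc vs i) (a i)" "\<And>i. a i < a (Suc i)" "\<And>i. a (Suc i) < a i + pi"
    "\<And>i. a (i + length vs) = a i + 2 * pi" by (rule angle_lift_exists[OF o(2,1) vs na z0]) (rule that)
  have pz: "p \<noteq> z0" using p z0 by auto
  obtain b where b: "a 0 \<le> b" "b < a 0 + 2 * pi" "ang z0 \<sigma> p b" using ang_exists[OF o(1) pz] .
  have "b < a (length vs)" using b a(4)[of 0] by simp
  then obtain i where i: "a i \<le> b" "b < a (Suc i)" using lift_bracket[of a b "length vs"] b(1) by metis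
  obtain r where r: "r > 0" "z0 + of_real r * cis (\<sigma> * b) \<in> closed_segment (cyc vs i) (cyc vs (Suc i))"
    using ang_cone[OF o(1) a(1)[of i] a(1)[of "Suc i"], of b] i a(3)[of i] by auto
  define w where "w = z0 + of_real r * cis (\<sigma> * b)"
  define l where "l = norm (p - z0) / r"
  have l0: "l > 0" using pz r by (simp add: l_def)
  have "p - z0 = of_real l * (of_real r * cis (\<sigma> * b))" using b(3) r(1) by (simp add: ang_def l_def)
  then have pw: "p = z0 + l *\<^sub>R (w - z0)" by (simp add: w_def scaleR_conv_of_real algebra_simps)
  let ?f = "\<lambda>x. \<sigma> * cr (cyc vs (Suc i) - cyc vs i) (x - cyc vs i)"
  have wC: "w \<in> ?C" using r(2) w_def closed_segment_subset[OF hull_inc hull_inc convex_convex_hull] cyc_in_set[OF ne] by blast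
  have fw: "?f w = 0"
  proof -
    obtain t where "w = (1 - t) *\<^sub>R cyc vs i + t *\<^sub>R cyc vs (Suc i)" using r(2) by (auto simp: w_def in_segment)
    then have "w - cyc vs i = t *\<^sub>R (cyc vs (Suc i) - cyc vs i)" by (simp add: algebra_simps)
    then show ?thesis by (simp only: cr_scale_right cr_self)
  qed
  have fz: "?f z0 > 0" by (rule oriented_interior[OF o(2,1) vs z0])
  have fp: "?f p \<ge> 0" using o(2) p(2) unfolding oriented_def by blast
  have "?f p = (1 - l) * ?f z0 + l * ?f w"
  proof -
    have "p - cyc vs i = (1 - l) *\<^sub>R (z0 - cyc vs i) + l *\<^sub>R (w - cyc vs i)" unfolding pw by (simp add: algebra_simps)
    then show ?thesis by (simp only: cr_add_right cr_scale_right) (simp add: algebra_simps)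
  qed
  moreover have "l * ?f w = 0" unfolding fw by simp
  ultimately have "0 \<le> (1 - l) * ?f z0" using fp by linarith
  then have l1: "l \<le> 1" using fz by (simp add: zero_le_mult_iff)
  have "l = 1"
  proof (rule ccontr)
    assume "l \<noteq> 1"
    then have "p = w - (1 - l) *\<^sub>R (w - z0)" "0 < 1 - l" "1 - l \<le> 1" using l1 l0 pw by (auto simp: algebra_simps)
    then have "p \<in> interior ?C" using mem_interior_convex_shrink[OF convex_convex_hull z0 wC, of "1 - l"] by simp
    then show False using p(3) by simp
  qed
  then have "p \<in> closed_segment (cyc vs i) (cyc vs (Suc i))" using pw r(2) w_def by simp
  then have "p = cyc vs i \<or> p = cyc vs (Suc i)" using pcurve_edge(3)[OF vs, of i] p(1) by (auto simp: open_segment_def)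
  then show ?thesis using cyc_in_set[OF ne] by auto
qed

text \<open>If the vertex were inside a segment of the hull, both adjacent edges, being supporting,
  would run along that segment. They then lie on one line, and since a spike is excluded the vertex
  is nailed.\<close>

lemma unnailed_extreme:
  assumes vs: "pcurve P vs" and na: "no_alt (cyc vs) (length vs)"
    and int: "interior (convex hull (set vs)) \<noteq> {}" and nn: "\<not> nailed vs (Suc k)"
  shows "cyc vs (Suc k) extreme_point_of (convex hull (set vs))"
proof (rule ccontr)
  assume nex: "\<not> ?thesis"
  have ne: "vs \<noteq> []" using vs by (auto simp: pcurve_def)
  define a b c where "a = cyc vs k" and "b = cyc vs (Suc k)" and "c = cyc vs (Suc (Suc k))"
  have ab: "a \<noteq> b" "b \<noteq> c" using pcurve_edge(2)[OF vs] by (auto simp: a_def b_def c_def)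
  obtain \<sigma> where o: "\<sigma> = 1 \<or> \<sigma> = -1" "oriented \<sigma> vs" using no_alt_oriented[OF vs na int] .
  have "b \<in> convex hull (set vs)" using cyc_in_set[OF ne] by (simp add: b_def hull_inc)
  then obtain y1 y2 where y: "y1 \<in> convex hull (set vs)" "y2 \<in> convex hull (set vs)" "b \<in> open_segment y1 y2"
    using nex unfolding extreme_point_of_def b_def by blast
  obtain u where u: "0 < u" "u < 1" "b = (1 - u) *\<^sub>R y1 + u *\<^sub>R y2" and y12: "y1 \<noteq> y2" using y(3) by (auto simp: in_segment)
  have key: "cr d (y2 - y1) = 0" if nn: "\<sigma> * cr d (y1 - b) \<ge> 0" "\<sigma> * cr d (y2 - b) \<ge> 0" for d
  proof -
    have "0 = (1 - u) *\<^sub>R (y1 - b) + u *\<^sub>R (y2 - b)" using u(3) by (simp add: algebra_simps)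
    then have "cr d ((1 - u) *\<^sub>R (y1 - b) + u *\<^sub>R (y2 - b)) = 0" by (metis cr_zero_right)
    then have "(1 - u) * (\<sigma> * cr d (y1 - b)) + u * (\<sigma> * cr d (y2 - b)) = 0"
      using o(1) by (auto simp: cr_add_right cr_scale_right)
    moreover have "(1 - u) * (\<sigma> * cr d (y1 - b)) \<ge> 0" "u * (\<sigma> * cr d (y2 - b)) \<ge> 0" using u nn by auto
    ultimately have "(1 - u) * (\<sigma> * cr d (y1 - b)) = 0" "u * (\<sigma> * cr d (y2 - b)) = 0" by linarith+
    then have "cr d (y1 - b) = 0" "cr d (y2 - b) = 0" using u o(1) by auto
    then show ?thesis by (simp add: cr_diff_right)
  qed
  have 1: "cr (b - a) (y2 - y1) = 0"
  proof (rule key)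
    have "cr (b - a) (x - b) = cr (b - a) (x - a)" for x by (simp add: cr_def algebra_simps)
    then show "\<sigma> * cr (b - a) (y1 - b) \<ge> 0" "\<sigma> * cr (b - a) (y2 - b) \<ge> 0"
      using o(2) y unfolding oriented_def a_def b_def by auto
  qed
  have 2: "cr (c - b) (y2 - y1) = 0"
    by (rule key) (use o(2) y in \<open>auto simp: oriented_def c_def b_def\<close>)
  obtain s where s: "y2 - y1 = s *\<^sub>R (b - a)" using cr_eq_0_imp[OF 1] ab by auto
  have "s \<noteq> 0" using s y12 by auto
  then have "cr (c - b) (b - a) = 0" using 2 s by (simp add: cr_scale_right)
  then have "cr (b - a) (c - b) = 0" by (subst cr_swap) simp
  then obtain t where t: "c - b = t *\<^sub>R (b - a)" using cr_eq_0_imp ab by (metis right_minus_eq)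
  obtain y where "y \<in> set vs" "cr (b - a) (y - a) \<noteq> 0" using exists_off_line[OF int, of "b - a"] ab by auto
  then have "c \<noteq> a" using no_alt_no_spike[OF na pcurve_edge(2)[OF vs, of k]] by (auto simp: a_def b_def c_def)
  then have t0: "t > 0" using pcurve_forward[OF vs, of k t] t by (simp add: a_def b_def c_def)
  have "a - b = - ((1 / t) *\<^sub>R (c - b))" unfolding t using t0 by simp
  then have "b \<in> open_segment a c" using t0 ab in_open_segment_iff_opposite[of a b c] by (metis zero_less_divide_1_iff)
  then show False using nn nailed_Suc_iff[OF vs, of k] by (simp add: a_def b_def c_def)
qed

lemma edge_params:
  assumes vs: "pcurve P vs" and eps: "small_radius P eps"
  obtains \<tau> where "0 < \<tau>" "\<tau> < 1/2" "sc_y vs eps i = cyc vs i + \<tau> *\<^sub>R (cyc vs (Suc i) - cyc vs i)"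
    "sc_x vs eps (Suc i) = cyc vs i + (1 - \<tau>) *\<^sub>R (cyc vs (Suc i) - cyc vs i)"
proof -
  have ne: "vs \<noteq> []" using vs by (auto simp: pcurve_def)
  let ?d = "cyc vs (Suc i) - cyc vs i"
  have e: "eps > 0" "2 * eps < dist (cyc vs i) (cyc vs (Suc i))"
    using eps pcurve_edge(1)[OF vs, of i] pcurve_edge(1)[OF vs, of "Suc i"] pcurve_edge(2)[OF vs, of i]
    by (auto simp: small_radius_def)
  have n: "2 * eps < norm ?d" using e(2) by (simp add: dist_norm norm_minus_commute)
  show thesis
  proof (rule that[of "eps / norm ?d"])
    have "0 < norm ?d" using e(1) n by linarith
    then show "0 < eps / norm ?d" "eps / norm ?d < 1/2" using e(1) n by (auto simp: field_simps)
    have s: "of_real eps * sgn ?d = (eps / norm ?d) *\<^sub>R ?d"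
      by (simp add: sgn_div_norm scaleR_conv_of_real divide_inverse)
    then show "sc_y vs eps i = cyc vs i + (eps / norm ?d) *\<^sub>R ?d" by (simp add: sc_y_def)
    have sg: "sgn (cyc vs i - cyc vs (Suc i)) = - sgn ?d" by (metis minus_diff_eq sgn_minus)
    show "sc_x vs eps (Suc i) = cyc vs i + (1 - eps / norm ?d) *\<^sub>R ?d"
      unfolding sc_x_Suc[OF ne] sg mult_minus_right s by (simp add: algebra_simps)
  qed
qed

text \<open>The point lies strictly on the inner side of the directed line; equivalently, the
  segment turns around \<open>p\<close> in the sense \<open>\<sigma>\<close>.\<close>

definition sees :: "real \<Rightarrow> complex \<Rightarrow> complex \<Rightarrow> complex \<Rightarrow> bool" where
  "sees \<sigma> p a b \<longleftrightarrow> \<sigma> * cr (b - a) (p - a) > 0"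

lemma sees_sub:
  assumes "sees \<sigma> p a b" "t < t'" "x = a + t *\<^sub>R (b - a)" "y = a + t' *\<^sub>R (b - a)"
  shows "sees \<sigma> p x y"
proof -
  have 1: "y - x = (t' - t) *\<^sub>R (b - a)" unfolding assms by (simp add: algebra_simps)
  have 2: "p - x = (p - a) - t *\<^sub>R (b - a)" unfolding assms by (simp add: algebra_simps)
  have 3: "cr ((t' - t) *\<^sub>R u) (w - t *\<^sub>R u) = (t' - t) * cr u w" for u w
    by (simp add: cr_scale_left cr_scale_right cr_diff_right)
  have "cr (y - x) (p - x) = (t' - t) * cr (b - a) (p - a)" unfolding 1 2 by (rule 3)
  then have "\<sigma> * cr (y - x) (p - x) = (t' - t) * (\<sigma> * cr (b - a) (p - a))" by (simp only: mult.left_commute)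
  then show ?thesis using assms(1,2) unfolding sees_def by (simp only: mult_pos_pos diff_gt_0_iff_gt)
qed

lemma sees_edge:
  assumes vs: "pcurve P vs" and eps: "small_radius P eps" and s: "sees \<sigma> p (cyc vs i) (cyc vs (Suc i))"
  shows "sees \<sigma> p (cyc vs i) (sc_x vs eps (Suc i))" "sees \<sigma> p (sc_y vs eps i) (sc_x vs eps (Suc i))"
    "sees \<sigma> p (sc_y vs eps i) (cyc vs (Suc i))"
proof -
  obtain \<tau> where \<tau>: "0 < \<tau>" "\<tau> < 1/2" "sc_y vs eps i = cyc vs i + \<tau> *\<^sub>R (cyc vs (Suc i) - cyc vs i)"
    "sc_x vs eps (Suc i) = cyc vs i + (1 - \<tau>) *\<^sub>R (cyc vs (Suc i) - cyc vs i)" using edge_params[OF vs eps] .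
  have "1 - \<tau> > 0" "\<tau> < 1 - \<tau>" "\<tau> < 1" using \<tau> by auto
  then show "sees \<sigma> p (cyc vs i) (sc_x vs eps (Suc i))" "sees \<sigma> p (sc_y vs eps i) (sc_x vs eps (Suc i))"
    "sees \<sigma> p (sc_y vs eps i) (cyc vs (Suc i))"
    by (auto intro: sees_sub[OF s _ _ \<tau>(4), of 0] sees_sub[OF s _ \<tau>(3) \<tau>(4)] sees_sub[OF s _ \<tau>(3), of 1])
qed

lemma sc_mod:
  assumes "vs \<noteq> []"
  shows "sc_x vs eps (l + k * length vs) = sc_x vs eps l" "sc_y vs eps (l + k * length vs) = sc_y vs eps l"
proof -
  show "sc_x vs eps (l + k * length vs) = sc_x vs eps l"
  proof (induction k)
    case (Suc k)
    then show ?case using sc_x_add_length[OF assms, of eps "l + k * length vs"] by (simp add: add.commute add.left_commute)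
  qed simp
  show "sc_y vs eps (l + k * length vs) = sc_y vs eps l"
  proof (induction k)
    case (Suc k)
    then show ?case using sc_y_add_length[of vs eps "l + k * length vs"] by (simp add: add.commute add.left_commute)
  qed simp
qed

lemma all_chords:
  assumes "vs \<noteq> []" and "\<forall>k<length vs. R (sc_x vs eps (Suc k)) (sc_y vs eps (Suc k))"
  shows "R (sc_x vs eps l) (sc_y vs eps l)"
proof -
  obtain k where k: "l + length vs = Suc k" using assms(1) by (cases "l + length vs") auto
  have "Suc k = Suc (k mod length vs) + (k div length vs) * length vs" by simp
  moreover have "k mod length vs < length vs" using assms(1) by simp
  ultimately have "R (sc_x vs eps (Suc k)) (sc_y vs eps (Suc k))"
    using assms(2) sc_mod[OF assms(1)] by metis
  then show ?thesis unfolding k[symmetric] sc_x_add_length[OF assms(1)] sc_y_add_length .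
qed

text \<open>Seen from \<open>p\<close>, the area under a chord is \<open>eps * A\<close> up to a
  term of second order in \<open>eps\<close>, where \<open>A > 0\<close> collects the contributions
  of the two adjacent edges. There are finitely many vertices, so one bound on \<open>eps\<close>
  serves all.\<close>

lemma eventually_sees_chord:
  assumes vs: "pcurve P vs" and s: "\<And>i. sees \<sigma> p (cyc vs i) (cyc vs (Suc i))"
  shows "\<forall>\<^sub>F eps in at_right 0. \<forall>l. sees \<sigma> p (sc_x vs eps l) (sc_y vs eps l)"
proof -
  have ne: "vs \<noteq> []" using vs by (auto simp: pcurve_def)
  have "\<forall>\<^sub>F eps in at_right 0. sees \<sigma> p (sc_x vs eps (Suc k)) (sc_y vs eps (Suc k))" for k
  proof -
    define a where "a = cyc vs k - cyc vs (Suc k)"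
    define b where "b = cyc vs (Suc (Suc k)) - cyc vs (Suc k)"
    define w where "w = p - cyc vs (Suc k)"
    have nz: "a \<noteq> 0" "b \<noteq> 0" using pcurve_edge(2)[OF vs, of k] pcurve_edge(2)[OF vs, of "Suc k"] by (auto simp: a_def b_def)
    have sb: "\<sigma> * cr b w > 0" using s[of "Suc k"] by (simp add: sees_def b_def w_def)
    have "cr (cyc vs (Suc k) - cyc vs k) (p - cyc vs k) = - cr a w"
      unfolding a_def w_def by (simp add: cr_def algebra_simps)
    then have sa: "- (\<sigma> * cr a w) > 0" using s[of k] by (simp add: sees_def)
    have ca: "cr (sgn u) x = cr u x / norm u" for u x by (simp add: sgn_div_norm cr_scale_left divide_inverse)
    define A where "A = \<sigma> * cr (sgn b) w - \<sigma> * cr (sgn a) w"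
    have A: "A > 0"
    proof -
      have "\<sigma> * cr (sgn b) w > 0" unfolding ca using sb nz by (metis divide_pos_pos times_divide_eq_right zero_less_norm_iff)
      moreover have "\<sigma> * cr (sgn a) w < 0" unfolding ca using sa nz
        by (metis divide_neg_pos neg_0_less_iff_less times_divide_eq_right zero_less_norm_iff)
      ultimately show ?thesis by (simp add: A_def)
    qed
    have "\<forall>\<^sub>F eps in at_right 0. (\<sigma> * cr (sgn b) (sgn a)) * eps < A \<and> eps > 0"
      using A by (intro eventually_conj eventually_less_at_right_0 eventually_at_right_less)
    then show ?thesis
    proof eventually_elim
      case (elim eps)
      have x: "sc_x vs eps (Suc k) = cyc vs (Suc k) + eps *\<^sub>R sgn a"
        unfolding sc_x_Suc[OF ne] a_def by (simp add: scaleR_conv_of_real)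
      have y: "sc_y vs eps (Suc k) = cyc vs (Suc k) + eps *\<^sub>R sgn b"
        unfolding sc_y_def b_def by (simp add: scaleR_conv_of_real)
      have 1: "sc_y vs eps (Suc k) - sc_x vs eps (Suc k) = eps *\<^sub>R (sgn b - sgn a)" unfolding x y by (simp add: algebra_simps)
      have 2: "p - sc_x vs eps (Suc k) = w - eps *\<^sub>R sgn a" unfolding x w_def by (simp add: algebra_simps)
      have e: "cr (sc_y vs eps (Suc k) - sc_x vs eps (Suc k)) (p - sc_x vs eps (Suc k))
         = eps * (cr (sgn b) w - cr (sgn a) w - eps * cr (sgn b) (sgn a))"
        unfolding 1 2 by (simp only: cr_scale_left cr_diff_left cr_diff_right cr_scale_right cr_self) (simp add: algebra_simps)
      have "\<sigma> * cr (sc_y vs eps (Suc k) - sc_x vs eps (Suc k)) (p - sc_x vs eps (Suc k))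
         = eps * (A - (\<sigma> * cr (sgn b) (sgn a)) * eps)" unfolding e by (simp add: A_def algebra_simps)
      also have "\<dots> > 0" using elim by simp
      finally show ?case unfolding sees_def .
    qed
  qed
  then have "\<forall>\<^sub>F eps in at_right 0. \<forall>k\<in>{..<length vs}. sees \<sigma> p (sc_x vs eps (Suc k)) (sc_y vs eps (Suc k))"
    by (intro eventually_ball_finite) auto
  then show ?thesis by eventually_elim (use all_chords[OF ne, of "sees \<sigma> p"] in auto)
qed

section \<open>Contour integrals around a seen point\<close>

lemma valid_path_polypath: "valid_path (polypath ws)"
proof (induction ws rule: polypath.induct)
  case (4 p q r rs)
  then show ?case using polypath_ends(1)[of "q # r # rs"] by (simp add: valid_path_join)
qed (simp_all only: polypath.simps valid_path_linepath)

text \<open>On the segment the quotient \<open>(z - p) / (a - p)\<close> runs straight from 1 to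
  \<open>R\<close>. As \<open>R\<close> is not real, this misses the cut of the logarithm, and the
  imaginary part of the integral is the signed angle under which the segment is seen.\<close>

lemma sees_contour_linepath:
  assumes \<sigma>: "\<sigma> = 1 \<or> \<sigma> = -1" and s: "sees \<sigma> p a b"
  shows "\<exists>I. ((\<lambda>z. 1 / (z - p)) has_contour_integral I) (linepath a b) \<and> \<sigma> * Im I > 0"
proof -
  have ap: "a \<noteq> p" using s by (auto simp: sees_def)
  define R where "R = (b - p) / (a - p)"
  have "cr (a - p) (b - p) = cr (b - a) (p - a)" by (simp add: cr_triangle)
  moreover have "Im R = cr (a - p) (b - p) / (norm (a - p))\<^sup>2"
  proof -
    have "R = ((b - p) * cnj (a - p)) / of_real ((norm (a - p))\<^sup>2)"
      unfolding R_def using complex_div_cnj[of "b - p" "a - p"] by simp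
    then show ?thesis unfolding cr_def by (metis Im_divide_of_real mult.commute)
  qed
  ultimately have "\<sigma> * Im R = (\<sigma> * cr (b - a) (p - a)) / (norm (a - p))\<^sup>2" by simp
  then have R: "\<sigma> * Im R > 0" using s ap unfolding sees_def by (metis divide_pos_pos right_minus_eq zero_less_norm_iff zero_less_power)
  let ?F = "\<lambda>z. Ln ((z - p) / (a - p))"
  have "((\<lambda>z. 1 / (z - p)) has_contour_integral (?F (pathfinish (linepath a b)) - ?F (pathstart (linepath a b)))) (linepath a b)"
  proof (rule contour_integral_primitive)
    fix z assume z: "z \<in> closed_segment a b"
    then obtain t where t: "0 \<le> t" "t \<le> 1" "z = (1 - t) *\<^sub>R a + t *\<^sub>R b" by (auto simp: in_segment)
    have e: "(z - p) / (a - p) = 1 + of_real t * (R - 1)"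
      unfolding t R_def using ap by (simp add: field_simps scaleR_conv_of_real)
    have nn: "(z - p) / (a - p) \<notin> \<real>\<^sub>\<le>\<^sub>0"
    proof
      assume n: "(z - p) / (a - p) \<in> \<real>\<^sub>\<le>\<^sub>0"
      then have "Im ((z - p) / (a - p)) = 0" by (auto simp: complex_nonpos_Reals_iff)
      then have "t * Im R = 0" unfolding e by simp
      then have "t = 0" using R by auto
      then show False using n e by simp
    qed
    then have "(z - p) / (a - p) \<noteq> 0" by auto
    then have zp: "z \<noteq> p" by auto
    show "(?F has_field_derivative 1 / (z - p)) (at z within closed_segment a b)"
      by (rule derivative_eq_intros refl nn | simp add: ap zp)+
  qed auto
  moreover have "?F (pathfinish (linepath a b)) - ?F (pathstart (linepath a b)) = Ln R" using ap by (simp add: R_def)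
  moreover have "\<sigma> * Im (Ln R) > 0"
  proof -
    have R0: "R \<noteq> 0" using R by auto
    have "(\<sigma> = 1 \<and> Im R > 0) \<or> (\<sigma> = -1 \<and> Im R < 0)" using R \<sigma> by auto
    then show ?thesis using Arg_lt_pi[of R] Arg_neg_iff[of R] R0 by (auto simp: Arg_eq_Im_Ln)
  qed
  ultimately show ?thesis by auto
qed

lemma sees_contour_polypath:
  assumes \<sigma>: "\<sigma> = 1 \<or> \<sigma> = -1" and "length ws \<ge> 2" "successively (sees \<sigma> p) ws"
  shows "\<exists>I. ((\<lambda>z. 1 / (z - p)) has_contour_integral I) (polypath ws) \<and> \<sigma> * Im I > 0"
  using assms(2,3)
proof (induction ws rule: polypath.induct)
  case (3 a b)
  then show ?case using sees_contour_linepath[OF \<sigma>, of p a b] by simp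
next
  case (4 a b c rs)
  obtain I where I: "((\<lambda>z. 1 / (z - p)) has_contour_integral I) (linepath a b)" "\<sigma> * Im I > 0"
    using sees_contour_linepath[OF \<sigma>, of p a b] 4 by auto
  obtain J where J: "((\<lambda>z. 1 / (z - p)) has_contour_integral J) (polypath (b # c # rs))" "\<sigma> * Im J > 0"
    using 4 by auto
  have "((\<lambda>z. 1 / (z - p)) has_contour_integral (I + J)) (linepath a b +++ polypath (b # c # rs))"
    by (rule has_contour_integral_join[OF I(1) J(1) valid_path_linepath valid_path_polypath])
  moreover have "\<sigma> * Im (I + J) > 0" using I J by (simp add: distrib_left)
  ultimately show ?case by auto
qed auto

text \<open>A branch of the logarithm of z - p.\<close>

lemma outside_hull_primitive:
  assumes p: "p \<notin> convex hull W" and W: "finite W" "W \<noteq> {}"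
  obtains F :: "complex \<Rightarrow> complex" where
    "\<And>ws. ws \<noteq> [] \<Longrightarrow> set ws \<subseteq> W \<Longrightarrow>
      ((\<lambda>z. 1 / (z - p)) has_contour_integral (F (last ws) - F (hd ws))) (polypath ws)"
proof -
  have "closed (convex hull W)" using W by (simp add: finite_imp_compact_convex_hull compact_imp_closed)
  then obtain e c where e: "e \<bullet> p < c" "\<And>x. x \<in> convex hull W \<Longrightarrow> e \<bullet> x > c"
    using separating_hyperplane_closed_point[OF convex_convex_hull _ p] by blast
  define S where "S = {x. e \<bullet> x > c}"
  have e0: "e \<noteq> 0" using e(1) e(2) W hull_inc[of _ W convex] by force
  have re: "Re (cnj e * (z - p)) = e \<bullet> z - e \<bullet> p" for z by (simp add: inner_complex_def algebra_simps)
  \<comment> \<open>Multiplication by \<open>cnj e\<close> carries the half-plane containing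
    \<open>W\<close>, seen from \<open>p\<close>, into the right half-plane, where the principal
    logarithm is holomorphic.\<close>
  let ?F = "\<lambda>z. Ln (cnj e * (z - p))"
  show thesis
  proof (rule that[of ?F])
    fix ws :: "complex list" assume ws: "ws \<noteq> []" "set ws \<subseteq> W"
    have "((\<lambda>z. 1 / (z - p)) has_contour_integral (?F (pathfinish (polypath ws)) - ?F (pathstart (polypath ws)))) (polypath ws)"
    proof (rule contour_integral_primitive[of S])
      fix z assume "z \<in> S"
      then have r: "Re (cnj e * (z - p)) > 0" using e(1) unfolding re by (simp add: S_def)
      then have nn: "cnj e * (z - p) \<notin> \<real>\<^sub>\<le>\<^sub>0" by (auto simp: complex_nonpos_Reals_iff)
      have zp: "z \<noteq> p" using r by auto
      show "(?F has_field_derivative 1 / (z - p)) (at z within S)"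
        by (rule derivative_eq_intros refl nn | simp add: zp e0 field_simps)+
    next
      have "convex hull (set ws) \<subseteq> convex hull W" using ws by (simp add: hull_mono)
      then show "path_image (polypath ws) \<subseteq> S" using polypath_image_subset_hull[OF ws(1)] e(2) unfolding S_def by blast
    qed (rule valid_path_polypath)
    then show "((\<lambda>z. 1 / (z - p)) has_contour_integral (?F (last ws) - ?F (hd ws))) (polypath ws)"
      using polypath_ends[OF ws(1)] by simp
  qed
qed

text \<open>Only the one obstacle \<open>p\<close> is removed, because the ends of the path and the
  final curve may lie on others.\<close>

lemma homotopic_paths_obst_imp:
  assumes "homotopic_paths_obst P g h" "p \<in> P" "p \<notin> path_image h" "g 0 \<noteq> p" "g 1 \<noteq> p"
  shows "homotopic_paths (- {p}) g h"
proof -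
  obtain H :: "real \<times> real \<Rightarrow> complex" where H: "continuous_on ({0..1} \<times> {0..1}) H"
     "\<And>t. t\<in>{0..1} \<Longrightarrow> H (0, t) = g t \<and> H (1, t) = h t"
     "\<And>s. s\<in>{0..1} \<Longrightarrow> H (s, 0) = g 0 \<and> H (s, 1) = g 1"
     "\<And>s t. s\<in>{0..<1} \<Longrightarrow> t\<in>{0<..<1} \<Longrightarrow> H (s, t) \<notin> P"
    by (rule homotopic_paths_obstE[OF assms(1)]) (rule that)
  have "H (s, t) \<noteq> p" if st: "s \<in> {0..1}" "t \<in> {0..1}" for s t
  proof -
    consider "s = 1" | "t = 0" | "t = 1" | "s \<in> {0..<1}" "t \<in> {0<..<1}" using st by fastforce
    then show ?thesis
    proof cases
      case 1
      have "h t \<in> path_image h" using st(2) unfolding path_image_def by (rule imageI)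
      then show ?thesis using H(2)[OF st(2)] 1 assms(3) by auto
    qed (use H(3)[OF st(1)] H(4)[of s t] assms in auto)
  qed
  then have "H \<in> ({0..1} \<times> {0..1}) \<rightarrow> - {p}" by (simp add: Pi_iff)
  then show ?thesis unfolding homotopic_paths
    using H(1-3) by (intro exI[of _ H]) (auto simp: pathfinish_def pathstart_def)
qed

lemma shortcut_piece_sees:
  assumes vs: "pcurve P vs" and eps: "small_radius P eps" and j: "j < length (nailed_idx vs)"
    and s: "\<And>i. sees \<sigma> p (cyc vs i) (cyc vs (Suc i))" and ch: "\<And>l. sees \<sigma> p (sc_x vs eps l) (sc_y vs eps l)"
  shows "successively (sees \<sigma> p) (shortcut_piece vs eps j)"
  unfolding shortcut_piece_eq
proof (rule wrap_successively[OF piece_props(1)[OF j]])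
  show "sees \<sigma> p (sc_y vs eps (piece_end vs j - 1)) (cyc vs (piece_end vs j))" if "Suc (piece_start vs j) < piece_end vs j"
    using sees_edge(3)[OF vs eps s, of "piece_end vs j - 1"] that by simp
qed (use ch s sees_edge[OF vs eps s] in simp_all)

lemma shortcut_closed_sees:
  assumes vs: "pcurve P vs" and eps: "small_radius P eps"
    and s: "\<And>i. sees \<sigma> p (cyc vs i) (cyc vs (Suc i))" and ch: "\<And>l. sees \<sigma> p (sc_x vs eps l) (sc_y vs eps l)"
  shows "successively (sees \<sigma> p) (interleave (sc_x vs eps) (sc_y vs eps) 0 (length vs) @ [sc_x vs eps 0])"
proof -
  have ne: "vs \<noteq> []" using vs by (auto simp: pcurve_def)
  show ?thesis
    by (rule closed_successively) (use ne ch sees_edge[OF vs eps s] sc_x_add_length[OF ne, of eps 0] in auto)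
qed

lemma piece_telescope:
  fixes F :: "complex \<Rightarrow> 'a::ab_group_add"
  assumes "nailed_idx vs \<noteq> []"
  shows "(\<Sum>j<length (nailed_idx vs). F (cyc vs (piece_end vs j)) - F (cyc vs (piece_start vs j))) = 0"
proof -
  obtain k where k: "length (nailed_idx vs) = Suc k" using assms by (cases "nailed_idx vs") auto
  let ?g = "\<lambda>j. F (cyc vs (piece_start vs j))"
  have 1: "(\<Sum>j<k. F (cyc vs (piece_end vs j)) - ?g j) = (\<Sum>j<k. ?g (Suc j) - ?g j)"
    by (rule sum.cong) (auto simp: piece_end_def piece_start_def k)
  have 2: "F (cyc vs (piece_end vs k)) = ?g 0" by (simp add: piece_end_def piece_start_def k cyc_add_length)
  show ?thesis unfolding k sum.lessThan_Suc 1 2 using sum_lessThan_telescope[of ?g k] by simp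
qed

text \<open>Each piece is homotopic to its replacement only by itself, so a logarithm
  \<open>F\<close> common to all replacements is needed: its increments over the pieces all have the
  sign \<open>\<sigma>\<close>, yet they cancel around the closed curve.\<close>

lemma hcs_hull_covers_pieces:
  assumes P: "finite P" and vs: "pcurve P vs" and n: "nailed_idx vs \<noteq> []"
    and \<sigma>: "\<sigma> = 1 \<or> \<sigma> = -1" and s: "\<And>i. sees \<sigma> p (cyc vs i) (cyc vs (Suc i))" and p: "p \<in> P"
    and ws: "length ws = length (nailed_idx vs)"
      "\<And>j. j < length ws \<Longrightarrow> ws ! j \<noteq> []"
      "\<And>j. j < length ws \<Longrightarrow> hd (ws ! j) = cyc vs (piece_start vs j)"
      "\<And>j. j < length ws \<Longrightarrow> last (ws ! j) = cyc vs (piece_end vs j)"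
      "\<And>j. j < length ws \<Longrightarrow> \<forall>\<^sub>F eps in at_right 0.
        shortest_homotopic_path P (polypath (shortcut_piece vs eps j)) (polypath (ws ! j))"
  shows "p \<in> convex hull (\<Union>(set ` set ws))"
proof (rule ccontr)
  assume pn: "\<not> ?thesis"
  let ?W = "\<Union>(set ` set ws)"
  have sub: "set (ws ! j) \<subseteq> ?W" if "j < length ws" for j using that nth_mem by blast
  have l0: "0 < length ws" using n ws(1) by simp
  have "?W \<noteq> {}" using sub[OF l0] ws(2)[OF l0] by (metis set_empty subset_empty)
  moreover have "finite ?W" by simp
  ultimately obtain F where F: "\<And>ws. ws \<noteq> [] \<Longrightarrow> set ws \<subseteq> ?W \<Longrightarrow>
      ((\<lambda>z. 1 / (z - p)) has_contour_integral (F (last ws) - F (hd ws))) (polypath ws)"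
    using outside_hull_primitive[of p ?W] pn by metis
  have vp: "cyc vs i \<noteq> p" for i using s[of i] by (auto simp: sees_def)
  have pos: "\<sigma> * Im (F (cyc vs (piece_end vs j)) - F (cyc vs (piece_start vs j))) > 0" if j: "j < length ws" for j
  proof -
    have "\<forall>\<^sub>F eps in at_right 0. small_radius P eps \<and> (\<forall>l. sees \<sigma> p (sc_x vs eps l) (sc_y vs eps l)) \<and>
        shortest_homotopic_path P (polypath (shortcut_piece vs eps j)) (polypath (ws ! j))"
      by (intro eventually_conj eventually_small_radius[OF P] eventually_sees_chord[OF vs s] ws(5)[OF j])
    then obtain eps where eps: "small_radius P eps" "\<And>l. sees \<sigma> p (sc_x vs eps l) (sc_y vs eps l)"
        "shortest_homotopic_path P (polypath (shortcut_piece vs eps j)) (polypath (ws ! j))"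
      using eventually_happens'[of "at_right (0::real)"] by (auto simp: trivial_limit_at_right_real)
    have j': "j < length (nailed_idx vs)" using j ws(1) by simp
    let ?g = "polypath (shortcut_piece vs eps j)"
    have ends: "?g 0 = cyc vs (piece_start vs j)" "?g 1 = cyc vs (piece_end vs j)"
      using polypath_ends[of "shortcut_piece vs eps j"] by (auto simp: shortcut_piece_eq pathstart_def pathfinish_def)
    have "path_image (polypath (ws ! j)) \<subseteq> convex hull ?W"
      using polypath_image_subset_hull[OF ws(2)[OF j]] hull_mono[OF sub[OF j], of convex] by blast
    then have pim: "p \<notin> path_image (polypath (ws ! j))" using pn by blast
    have "homotopic_paths (- {p}) ?g (polypath (ws ! j))"
      by (rule homotopic_paths_obst_imp[OF _ p pim]) (use eps(3) ends vp in \<open>auto simp: shortest_homotopic_path_def\<close>)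
    then have eq: "contour_integral ?g (\<lambda>z. 1 / (z - p)) = contour_integral (polypath (ws ! j)) (\<lambda>z. 1 / (z - p))"
      by (rule Cauchy_theorem_homotopic_paths) (auto intro!: holomorphic_intros valid_path_polypath)
    obtain I where I: "((\<lambda>z. 1 / (z - p)) has_contour_integral I) ?g" "\<sigma> * Im I > 0"
      using sees_contour_polypath[OF \<sigma> _ shortcut_piece_sees[OF vs eps(1) j' s eps(2)]] by (auto simp: shortcut_piece_eq)
    have "contour_integral (polypath (ws ! j)) (\<lambda>z. 1 / (z - p)) = F (last (ws ! j)) - F (hd (ws ! j))"
      by (rule contour_integral_unique[OF F[OF ws(2)[OF j] sub[OF j]]])
    then have "I = F (last (ws ! j)) - F (hd (ws ! j))" using eq contour_integral_unique[OF I(1)] by simp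
    then show ?thesis using I(2) ws(3,4)[OF j] by simp
  qed
  have "(\<Sum>j<length ws. \<sigma> * Im (F (cyc vs (piece_end vs j)) - F (cyc vs (piece_start vs j)))) > 0"
    using l0 by (intro sum_pos pos) auto
  moreover have "(\<Sum>j<length ws. \<sigma> * Im (F (cyc vs (piece_end vs j)) - F (cyc vs (piece_start vs j)))) =
    \<sigma> * Im (\<Sum>j<length ws. F (cyc vs (piece_end vs j)) - F (cyc vs (piece_start vs j)))"
    unfolding Im_sum by (simp add: sum_distrib_left)
  ultimately show False unfolding ws(1) piece_telescope[OF n] by simp
qed

lemma hcs_hull_covers_loop:
  assumes P: "finite P" and vs: "pcurve P vs"
    and \<sigma>: "\<sigma> = 1 \<or> \<sigma> = -1" and s: "\<And>i. sees \<sigma> p (cyc vs i) (cyc vs (Suc i))" and p: "p \<in> P"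
    and r: "r \<noteq> []"
    and sh: "\<forall>\<^sub>F eps in at_right 0. shortest_homotopic_loop P (closed_poly (shortcut_closed vs eps)) (closed_poly r)"
  shows "p \<in> convex hull (set r)"
proof (rule ccontr)
  assume pn: "\<not> ?thesis"
  have ne: "vs \<noteq> []" using vs by (auto simp: pcurve_def)
  obtain F where F: "\<And>ws. ws \<noteq> [] \<Longrightarrow> set ws \<subseteq> set r \<Longrightarrow>
      ((\<lambda>z. 1 / (z - p)) has_contour_integral (F (last ws) - F (hd ws))) (polypath ws)"
    using outside_hull_primitive[of p "set r"] pn r by auto
  have rr: "r @ [hd r] \<noteq> []" "set (r @ [hd r]) \<subseteq> set r" "hd (r @ [hd r]) = last (r @ [hd r])" using r by auto
  have "((\<lambda>z. 1 / (z - p)) has_contour_integral 0) (closed_poly r)"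
    using F[OF rr(1,2)] rr(3) by (simp add: closed_poly_def)
  then have 0: "contour_integral (closed_poly r) (\<lambda>z. 1 / (z - p)) = 0" by (rule contour_integral_unique)
  have "\<forall>\<^sub>F eps in at_right 0. small_radius P eps \<and> (\<forall>l. sees \<sigma> p (sc_x vs eps l) (sc_y vs eps l)) \<and>
        shortest_homotopic_loop P (closed_poly (shortcut_closed vs eps)) (closed_poly r)"
    by (intro eventually_conj eventually_small_radius[OF P] eventually_sees_chord[OF vs s] sh)
  then obtain eps where eps: "small_radius P eps" "\<And>l. sees \<sigma> p (sc_x vs eps l) (sc_y vs eps l)"
        "shortest_homotopic_loop P (closed_poly (shortcut_closed vs eps)) (closed_poly r)"
      using eventually_happens'[of "at_right (0::real)"] by (auto simp: trivial_limit_at_right_real)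
  let ?g = "closed_poly (shortcut_closed vs eps)"
  have "homotopic_loops_obst {p} ?g (closed_poly r)"
    using eps(3) p unfolding shortest_homotopic_loop_def homotopic_loops_obst_def by blast
  moreover have "path_image (closed_poly r) \<subseteq> convex hull (set r)"
    using polypath_image_subset_hull[OF rr(1)] hull_mono[OF rr(2), of convex] by (auto simp: closed_poly_def)
  then have "closed_poly r t \<notin> {p}" if "t \<in> {0..1}" for t
    using imageI[OF that, of "closed_poly r"] pn by (auto simp only: path_image_def)
  ultimately have "homotopic_loops (- {p}) ?g (closed_poly r)" by (rule homotopic_loops_obst_imp)
  then have eq: "contour_integral ?g (\<lambda>z. 1 / (z - p)) = contour_integral (closed_poly r) (\<lambda>z. 1 / (z - p))"
    by (rule Cauchy_theorem_homotopic_loops) (auto intro!: holomorphic_intros valid_path_polypath simp: closed_poly_def)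
  have len: "2 \<le> length (interleave (sc_x vs eps) (sc_y vs eps) 0 (length vs) @ [sc_x vs eps 0])"
    using interleave_props(1)[of 0 "length vs" "sc_x vs eps" "sc_y vs eps"] ne
    by (cases "interleave (sc_x vs eps) (sc_y vs eps) 0 (length vs)") auto
  obtain I where I: "((\<lambda>z. 1 / (z - p)) has_contour_integral I) ?g" "\<sigma> * Im I > 0"
    using sees_contour_polypath[OF \<sigma> len shortcut_closed_sees[OF vs eps(1) s eps(2)]]
    unfolding closed_poly_shortcut_closed[OF ne] by blast
  show False using contour_integral_unique[OF I(1)] eq 0 I(2) by simp
qed

text \<open>In the coordinate \<open>d \<bullet> x\<close> along the line, the curve has vertices on
  both sides of \<open>p\<close> and no edge can pass over the obstacle \<open>p\<close>. At a first
  passage to the upper side it must stop at \<open>p\<close>, and it enters and leaves in the same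
  direction.\<close>

lemma collinear_peel_nailed:
  assumes vs: "pcurve P vs" and Q: "Q \<subseteq> P" "set vs \<subseteq> Q" "Q \<subseteq> convex hull (set vs)"
    and int: "interior (convex hull Q) = {}" and p: "p \<in> peel Q"
  shows "\<exists>k. cyc vs (Suc k) = p \<and> nailed vs (Suc k)"
proof -
  have ne: "vs \<noteq> []" using vs by (auto simp: pcurve_def)
  obtain e c where e: "e \<noteq> 0" "convex hull Q \<subseteq> {x. e \<bullet> x = c}"
    using empty_interior_subset_hyperplane[OF convex_convex_hull int] .
  define d where "d = \<i> * e"
  have line: "e \<bullet> x = c" if "x \<in> Q" for x using e(2) hull_subset[of Q convex] that by blast
  have inj: "x = y" if "e \<bullet> x = e \<bullet> y" "d \<bullet> x = d \<bullet> y" for x y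
  proof -
    have "e \<bullet> (x - y) = 0" "cr e (x - y) = 0" using that by (auto simp: inner_diff_right cr_inner d_def)
    then have "cnj e * (x - y) = 0" by (auto simp: cr_def inner_complex_def complex_eq_iff)
    then show ?thesis using e(1) by simp
  qed
  have between: "y \<in> open_segment x z" if xyz: "e \<bullet> x = c" "e \<bullet> y = c" "e \<bullet> z = c" "d \<bullet> x < d \<bullet> y" "d \<bullet> y < d \<bullet> z" for x y z
  proof -
    define u where "u = (d \<bullet> y - d \<bullet> x) / (d \<bullet> z - d \<bullet> x)"
    have u: "0 < u" "u < 1" using xyz by (auto simp: u_def field_simps)
    have "y = (1 - u) *\<^sub>R x + u *\<^sub>R z"
    proof (rule inj)
      show "e \<bullet> y = e \<bullet> ((1 - u) *\<^sub>R x + u *\<^sub>R z)" using xyz by (simp add: inner_add_right algebra_simps)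
      have "u * (d \<bullet> z - d \<bullet> x) = d \<bullet> y - d \<bullet> x" using xyz by (simp add: u_def)
      then show "d \<bullet> y = d \<bullet> ((1 - u) *\<^sub>R x + u *\<^sub>R z)" by (simp add: inner_add_right algebra_simps)
    qed
    moreover have "x \<noteq> z" using xyz by auto
    ultimately show ?thesis using u by (auto simp: in_segment)
  qed
  have pQ: "p \<in> Q" "\<not> p extreme_point_of (convex hull Q)" using p by (auto simp: peel_def)
  then obtain y1 y2 where y: "y1 \<in> convex hull Q" "y2 \<in> convex hull Q" "p \<in> open_segment y1 y2"
    unfolding extreme_point_of_def by (auto simp: hull_inc)
  then obtain u where u: "0 < u" "u < 1" "p = (1 - u) *\<^sub>R y1 + u *\<^sub>R y2" and y12: "y1 \<noteq> y2" by (auto simp: in_segment)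
  have "e \<bullet> y1 = e \<bullet> y2" using e(2) y by auto
  then have dy: "d \<bullet> y1 \<noteq> d \<bullet> y2" using inj y12 by blast
  have dp: "d \<bullet> p = (1 - u) * (d \<bullet> y1) + u * (d \<bullet> y2)" unfolding u(3) by (simp add: inner_add_right)
  have hullQ: "convex hull Q \<subseteq> convex hull (set vs)" using Q(3) by (simp add: hull_minimal)
  have dy1: "d \<bullet> y1 - d \<bullet> p = u * (d \<bullet> y1 - d \<bullet> y2)" "d \<bullet> y2 - d \<bullet> p = (1 - u) * (d \<bullet> y2 - d \<bullet> y1)"
    unfolding dp by (simp_all add: algebra_simps)
  have ymm: "\<exists>y\<in>convex hull Q. d \<bullet> y < d \<bullet> p" "\<exists>y\<in>convex hull Q. d \<bullet> y > d \<bullet> p"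
  proof -
    consider "d \<bullet> y1 < d \<bullet> y2" | "d \<bullet> y2 < d \<bullet> y1" using dy by linarith
    then have "(d \<bullet> y1 < d \<bullet> p \<and> d \<bullet> y2 > d \<bullet> p) \<or> (d \<bullet> y2 < d \<bullet> p \<and> d \<bullet> y1 > d \<bullet> p)"
    proof cases
      case 1
      then have "u * (d \<bullet> y1 - d \<bullet> y2) < 0" "(1 - u) * (d \<bullet> y2 - d \<bullet> y1) > 0" using u by (auto simp: mult_pos_neg)
      then show ?thesis using dy1 by linarith
    next
      case 2
      then have "u * (d \<bullet> y1 - d \<bullet> y2) > 0" "(1 - u) * (d \<bullet> y2 - d \<bullet> y1) < 0" using u by (auto simp: mult_pos_neg)
      then show ?thesis using dy1 by linarith
    qed
    then show "\<exists>y\<in>convex hull Q. d \<bullet> y < d \<bullet> p" "\<exists>y\<in>convex hull Q. d \<bullet> y > d \<bullet> p" using y by blast+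
  qed
  have low: "\<exists>x\<in>set vs. d \<bullet> x < d \<bullet> p"
  proof (rule ccontr)
    assume "\<not> ?thesis"
    then have "convex hull (set vs) \<subseteq> {x. d \<bullet> x \<ge> d \<bullet> p}"
      by (intro hull_minimal convex_halfspace_ge) (auto simp: not_less)
    then show False using ymm(1) hullQ by fastforce
  qed
  have high: "\<exists>x\<in>set vs. d \<bullet> x > d \<bullet> p"
  proof (rule ccontr)
    assume "\<not> ?thesis"
    then have "convex hull (set vs) \<subseteq> {x. d \<bullet> x \<le> d \<bullet> p}"
      by (intro hull_minimal convex_halfspace_le) (auto simp: not_less)
    then show False using ymm(2) hullQ by fastforce
  qed
  obtain x where x: "x \<in> set vs" "d \<bullet> x < d \<bullet> p" using low by blast
  obtain i where i: "cyc vs i = x" using cyc_index[OF x(1), of 0] by metis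
  obtain x' where x': "x' \<in> set vs" "d \<bullet> x' > d \<bullet> p" using high by blast
  obtain m where m: "i \<le> m" "cyc vs m = x'" using cyc_index[OF x'(1), of i] by metis
  \<comment> \<open>The first vertex above \<open>p\<close>. Its predecessor is \<open>p\<close>
    itself, and the vertex before that is below \<open>p\<close>.\<close>
  define k where "k = (LEAST k. i \<le> k \<and> d \<bullet> cyc vs k > d \<bullet> p)"
  have k: "i \<le> k \<and> d \<bullet> cyc vs k > d \<bullet> p" unfolding k_def by (rule LeastI[of _ m]) (use m x' in auto)
  have kl: "d \<bullet> cyc vs l \<le> d \<bullet> p" if "i \<le> l" "l < k" for l
    using not_less_Least[of l "\<lambda>k. i \<le> k \<and> d \<bullet> cyc vs k > d \<bullet> p"] that by (auto simp: k_def not_less)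
  have vQ: "cyc vs l \<in> Q" for l using cyc_in_set[OF ne] Q by blast
  note lv = line[OF vQ]
  have pP: "p \<in> P" using pQ Q by blast
  have "k \<noteq> i" using k i x by auto
  then obtain k1 where k1: "k = Suc k1" "i \<le> k1" using k by (cases k) auto
  have vk1: "cyc vs k1 = p"
  proof (rule ccontr)
    assume nv: "cyc vs k1 \<noteq> p"
    then have "d \<bullet> cyc vs k1 \<noteq> d \<bullet> p" using inj[of "cyc vs k1" p] lv line[OF pQ(1)] by auto
    then have "d \<bullet> cyc vs k1 < d \<bullet> p" using kl[of k1] k1 by simp
    then have "p \<in> open_segment (cyc vs k1) (cyc vs (Suc k1))"
      using between[OF lv line[OF pQ(1)] lv] k k1 by simp
    then show False using pcurve_edge(3)[OF vs, of k1] pP by blast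
  qed
  have "k1 \<noteq> i" using vk1 i x by auto
  then obtain k2 where k2: "k1 = Suc k2" "i \<le> k2" using k1 by (cases k1) auto
  have "cyc vs k2 \<noteq> p" using pcurve_edge(2)[OF vs, of k2] vk1 k2 by simp
  then have "d \<bullet> cyc vs k2 \<noteq> d \<bullet> p" using inj[of "cyc vs k2" p] lv line[OF pQ(1)] by auto
  then have "d \<bullet> cyc vs k2 < d \<bullet> p" using kl[of k2] k1 k2 by simp
  then have "p \<in> open_segment (cyc vs k2) (cyc vs (Suc (Suc k2)))"
    using between[OF lv line[OF pQ(1)] lv] k k1 k2 by simp
  then show ?thesis using nailed_Suc_iff[OF vs, of k2] vk1 k2 by auto
qed

lemma nailed_is_piece_start:
  assumes vs: "vs \<noteq> []" and n: "nailed vs i"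
  obtains j where "j < length (nailed_idx vs)" "cyc vs (piece_start vs j) = cyc vs i"
proof -
  have "nailed vs (i mod length vs)" "i mod length vs < length vs" using n vs by (auto simp: nailed_mod)
  then have "i mod length vs \<in> set (nailed_idx vs)" by (simp add: nailed_idx_def)
  then obtain j where "j < length (nailed_idx vs)" "nailed_idx vs ! j = i mod length vs" by (auto simp: in_set_conv_nth)
  then show thesis using that[of j] cyc_mod[of vs i] by (simp add: piece_start_def)
qed

text \<open>Joining by \<open>tl\<close> drops the head of each piece, but the head is also the last
  element of the piece before and reappears there unless that piece is a single point. A lost head
  therefore propagates backwards around the cycle, and then all pieces are the same point.\<close>

lemma closed_chain_union:
  assumes k: "length ws = Suc k" and ne: "\<And>j. j \<le> k \<Longrightarrow> ws ! j \<noteq> []"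
    and ch: "\<And>j. j < k \<Longrightarrow> last (ws ! j) = hd (ws ! Suc j)" "last (ws ! k) = hd (ws ! 0)"
  shows "(\<Union>(set ` set ws)) = set (concat (map tl ws)) \<or> (\<exists>q. (\<Union>(set ` set ws)) = {q})"
proof -
  let ?S = "set (concat (map tl ws))"
  let ?W = "\<Union>(set ` set ws)"
  have tlS: "set (tl (ws ! j)) \<subseteq> ?S" if "j \<le> k" for j using that k by (auto intro!: bexI[of _ "ws ! j"])
  have sub: "?S \<subseteq> ?W"
  proof -
    have "set (tl w) \<subseteq> set w" for w :: "'a list" by (cases w) auto
    then show ?thesis by fastforce
  qed
  show ?thesis
  proof (cases "\<forall>j\<le>k. hd (ws ! j) \<in> ?S")
    case True
    have "set w \<subseteq> ?S" if "w \<in> set ws" for w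
    proof -
      obtain j where j: "j \<le> k" "w = ws ! j" using \<open>w \<in> set ws\<close> k by (auto simp: in_set_conv_nth less_Suc_eq_le)
      have "w \<noteq> []" using ne[OF j(1)] j by simp
      then have "set w = insert (hd w) (set (tl w))" by (cases w) auto
      then show ?thesis using True tlS[OF j(1)] j by auto
    qed
    then show ?thesis using sub by blast
  next
    case False
    then obtain j where j: "j \<le> k" "hd (ws ! j) \<notin> ?S" by blast
    have lone: "hd (ws ! j) = last (ws ! j) \<and> length (ws ! j) = 1" if "j \<le> k" "last (ws ! j) \<notin> ?S" for j
    proof (cases "ws ! j")
      case Nil
      then show ?thesis using ne that by simp
    next
      case (Cons x xs)
      have "xs = []"
      proof (rule ccontr)
        assume "xs \<noteq> []"
        then have "last (ws ! j) \<in> set (tl (ws ! j))" using Cons by simp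
        then show False using tlS[OF that(1)] that(2) by blast
      qed
      then show ?thesis using Cons by simp
    qed
    have down: "hd (ws ! (j - i)) \<notin> ?S" if "j \<le> k" "hd (ws ! j) \<notin> ?S" for i j
    proof (induction i)
      case (Suc i)
      show ?case
      proof (cases "j - i")
        case 0
        then show ?thesis using Suc by simp
      next
        case (Suc m)
        have "m < k" using Suc that by simp
        then have "last (ws ! m) \<notin> ?S" using ch(1)[of m] Suc.IH Suc by simp
        then have "hd (ws ! m) \<notin> ?S" using lone[of m] \<open>m < k\<close> by simp
        moreover have "j - Suc i = m" using Suc by simp
        ultimately show ?thesis by simp
      qed
    qed (use that in simp)
    have "hd (ws ! 0) \<notin> ?S" using down[OF j, of j] by simp
    then have "last (ws ! k) \<notin> ?S" using ch(2) by simp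
    then have "hd (ws ! k) \<notin> ?S" using lone[of k] by simp
    then have all: "hd (ws ! j) \<notin> ?S" if "j \<le> k" for j using down[of k "k - j"] that by simp
    have len1: "hd (ws ! j) = last (ws ! j) \<and> length (ws ! j) = 1" if "j \<le> k" for j
      using lone[OF that] ch(1)[of j] ch(2) all[of "Suc j"] all[of 0] that by (cases "j = k") auto
    have hd0: "hd (ws ! j) = hd (ws ! 0)" if "j \<le> k" for j
      using that
    proof (induction j)
      case (Suc j)
      then show ?case using ch(1)[of j] len1[of j] by simp
    qed simp
    have "set (ws ! j) = {hd (ws ! 0)}" if "j \<le> k" for j
      using len1[OF that] hd0[OF that] by (cases "ws ! j") auto
    then have "set ` set ws = {{hd (ws ! 0)}}"
      using k by (auto simp: set_conv_nth less_Suc_eq_le image_iff)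
    then show ?thesis by auto
  qed
qed

text \<open>Each point of the next layer is either nailed, and then an end of a piece, or on the
  inner side of every edge, and then the winding argument applies. Two distinct points exclude that
  all pieces shrink to one point, which the joining of the pieces could lose.\<close>

lemma hcs_step_covers:
  assumes P: "finite P" and Q: "P \<inter> convex hull Q = Q" and st: "hcs_step P vs r" "set vs \<subseteq> Q" "Q \<subseteq> convex hull (set vs)"
    and na: "interior (convex hull Q) = {} \<or> no_alt (cyc vs) (length vs)"
    and two: "x \<in> peel Q" "y \<in> peel Q" "x \<noteq> y"
  shows "peel Q \<subseteq> convex hull (set r)"
proof -
  have vs: "pcurve P vs" using st by (simp add: hcs_step_def)
  have ne: "vs \<noteq> []" using vs by (auto simp: pcurve_def)
  have QP: "Q \<subseteq> P" using Q by auto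
  have hull: "convex hull (set vs) = convex hull Q"
    using st(2,3) by (metis hull_hull hull_mono subset_antisym)
  have dich: "(\<exists>k. cyc vs (Suc k) = p \<and> nailed vs (Suc k)) \<or>
     (\<exists>\<sigma>. (\<sigma> = 1 \<or> \<sigma> = -1) \<and> (\<forall>i. sees \<sigma> p (cyc vs i) (cyc vs (Suc i))))" if p: "p \<in> peel Q" for p
  proof (cases "interior (convex hull Q) = {}")
    case True
    then show ?thesis using collinear_peel_nailed[OF vs QP st(2,3) True p] by blast
  next
    case False
    then have na': "no_alt (cyc vs) (length vs)" and int: "interior (convex hull (set vs)) \<noteq> {}" using na hull by auto
    have pQ: "p \<in> Q" "\<not> p extreme_point_of (convex hull Q)" using p by (auto simp: peel_def)
    show ?thesis
    proof (cases "p \<in> interior (convex hull (set vs))")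
      case True
      obtain \<sigma> where o: "\<sigma> = 1 \<or> \<sigma> = -1" "oriented \<sigma> vs" using no_alt_oriented[OF vs na' int] .
      then show ?thesis using oriented_interior[OF o(2,1) vs True] unfolding sees_def by blast
    next
      case False
      then have "p \<in> set vs" using frontier_point_visited[OF vs na' int] pQ QP st(3) by blast
      then obtain m where m: "1 \<le> m" "cyc vs m = p" using cyc_index[of p vs 1] by metis
      then obtain k where "m = Suc k" by (cases m) auto
      then show ?thesis using m unnailed_extreme[OF vs na' int, of k] pQ(2) hull by auto
    qed
  qed
  show ?thesis
  proof (cases "nailed_idx vs = []")
    case True
    then have r: "r \<noteq> []" and sh: "\<forall>\<^sub>F eps in at_right 0. shortest_homotopic_loop P (closed_poly (shortcut_closed vs eps)) (closed_poly r)"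
      using st(1) by (auto simp: hcs_step_def pcurve_def)
    show ?thesis
    proof
      fix p assume p: "p \<in> peel Q"
      have "\<not> nailed vs k" for k using nailed_is_piece_start[OF ne, of k] True by auto
      then obtain \<sigma> where s: "\<sigma> = 1 \<or> \<sigma> = -1" "\<And>i. sees \<sigma> p (cyc vs i) (cyc vs (Suc i))" using dich[OF p] by blast
      have "p \<in> P" using p peel_subset QP by blast
      then show "p \<in> convex hull (set r)" by (rule hcs_hull_covers_loop[OF P vs s _ r sh])
    qed
  next
    case False
    obtain ws where ws: "length ws = length (nailed_idx vs)" "r = concat (map tl ws)"
      "\<And>j. j < length ws \<Longrightarrow> ppath P (ws ! j) \<or> length (ws ! j) = 1"
      "\<And>j. j < length ws \<Longrightarrow> hd (ws ! j) = cyc vs (piece_start vs j)"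
      "\<And>j. j < length ws \<Longrightarrow> last (ws ! j) = cyc vs (piece_end vs j)"
      "\<And>j. j < length ws \<Longrightarrow> \<forall>\<^sub>F eps in at_right 0.
          shortest_homotopic_path P (polypath (shortcut_piece vs eps j)) (polypath (ws ! j))"
      using hcs_step_pieces[OF st(1) False] by blast
    let ?W = "\<Union>(set ` set ws)"
    have wne: "ws ! j \<noteq> []" if "j < length ws" for j using ws(3)[OF that] by (auto simp: ppath_def)
    have cov: "p \<in> convex hull ?W" if p: "p \<in> peel Q" for p
      using dich[OF p]
    proof
      assume "\<exists>k. cyc vs (Suc k) = p \<and> nailed vs (Suc k)"
      then obtain k where k: "cyc vs (Suc k) = p" "nailed vs (Suc k)" by blast
      obtain j where j: "j < length (nailed_idx vs)" "cyc vs (piece_start vs j) = cyc vs (Suc k)"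
        using nailed_is_piece_start[OF ne k(2)] .
      then have "p \<in> set (ws ! j)" using ws(4)[of j] ws(1) k hd_in_set[OF wne[of j]] by simp
      then have "p \<in> ?W" using j ws(1) nth_mem[of j ws] by auto
      then show ?thesis by (rule hull_inc)
    next
      assume "\<exists>\<sigma>. (\<sigma> = 1 \<or> \<sigma> = -1) \<and> (\<forall>i. sees \<sigma> p (cyc vs i) (cyc vs (Suc i)))"
      then obtain \<sigma> where s: "\<sigma> = 1 \<or> \<sigma> = -1" "\<And>i. sees \<sigma> p (cyc vs i) (cyc vs (Suc i))" by blast
      have "p \<in> P" using p peel_subset QP by blast
      then show ?thesis by (rule hcs_hull_covers_pieces[OF P vs False s _ ws(1) wne ws(4,5,6)])
    qed
    obtain k where k: "length ws = Suc k" using ws(1) False by (cases ws) auto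
    have "?W = set r \<or> (\<exists>q. ?W = {q})" unfolding ws(2)
    proof (rule closed_chain_union[OF k])
      show "last (ws ! j) = hd (ws ! Suc j)" if "j < k" for j
        using ws(4)[of "Suc j"] ws(5)[of j] that k ws(1) by (simp add: piece_end_def piece_start_def)
      show "last (ws ! k) = hd (ws ! 0)"
        using ws(4)[of 0] ws(5)[of k] k ws(1) by (simp add: piece_end_def piece_start_def cyc_add_length)
    qed (use wne k in auto)
    moreover have "?W \<noteq> {q}" for q using cov[OF two(1)] cov[OF two(2)] two(3) by auto
    ultimately show ?thesis using cov by auto
  qed
qed

subsection \<open>Cyclic variation\<close>

lemma window_sum:
  fixes g :: "nat \<Rightarrow> real"
  assumes "\<And>i. g (i + M) = g i"
  shows "(\<Sum>i\<in>{k..<k+M}. g i) = (\<Sum>i<M. g i)"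
proof (induction k)
  case (Suc k)
  have "(\<Sum>i\<in>{Suc k..<Suc k+M}. g i) + g k = (\<Sum>i\<in>{k..<k+M}. g i) + g (k + M)"
  proof (cases "M = 0")
    case False
    then have "{k..<k + M} = insert k {Suc k..<k+M}" "{Suc k..<Suc k+M} = insert (k+M) {Suc k..<k+M}" by auto
    then show ?thesis by simp
  qed simp
  then show ?case using Suc assms[of k] by simp
qed (simp add: atLeast0LessThan)

lemma abs_diff_le_sum:
  fixes a :: "nat \<Rightarrow> real"
  assumes "p \<le> q"
  shows "\<bar>a q - a p\<bar> \<le> (\<Sum>i\<in>{p..<q}. \<bar>a (Suc i) - a i\<bar>)"
  using assms
proof (induction q rule: dec_induct)
  case (step n)
  then show ?case by simp
qed simp

text \<open>A closed tour covers the difference on the way out and again on the way back.\<close>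

lemma cyclic_variation_lower2:
  fixes a :: "nat \<Rightarrow> real"
  assumes per: "\<And>i. a (i + M) = a i" and "i \<le> j" "j \<le> i + M"
  shows "2 * \<bar>a j - a i\<bar> \<le> (\<Sum>k<M. \<bar>a (Suc k) - a k\<bar>)"
proof -
  have "(\<Sum>k<M. \<bar>a (Suc k) - a k\<bar>) = (\<Sum>k\<in>{i..<i+M}. \<bar>a (Suc k) - a k\<bar>)"
    by (rule window_sum[symmetric]) (use per[of "Suc _"] per in simp)
  also have "\<dots> = (\<Sum>k\<in>{i..<j}. \<bar>a (Suc k) - a k\<bar>) + (\<Sum>k\<in>{j..<i+M}. \<bar>a (Suc k) - a k\<bar>)"
    using assms by (simp add: sum.atLeastLessThan_concat)
  also have "\<dots> \<ge> \<bar>a j - a i\<bar> + \<bar>a (i + M) - a j\<bar>"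
    using assms by (intro add_mono abs_diff_le_sum)
  finally show ?thesis using per[of i] abs_minus_commute[of "a i" "a j"] by simp
qed

lemma cyclic_variation_lower4:
  fixes a :: "nat \<Rightarrow> real"
  assumes per: "\<And>i. a (i + M) = a i" and o: "i \<le> j" "j \<le> k" "k \<le> l" "l \<le> i + M"
  shows "\<bar>a j - a i\<bar> + \<bar>a k - a j\<bar> + \<bar>a l - a k\<bar> + \<bar>a i - a l\<bar> \<le> (\<Sum>k<M. \<bar>a (Suc k) - a k\<bar>)"
proof -
  have "(\<Sum>k<M. \<bar>a (Suc k) - a k\<bar>) = (\<Sum>k\<in>{i..<i+M}. \<bar>a (Suc k) - a k\<bar>)"
    by (rule window_sum[symmetric]) (use per[of "Suc _"] per in simp)
  also have "\<dots> = (\<Sum>k\<in>{i..<j}. \<bar>a (Suc k) - a k\<bar>) + (\<Sum>k\<in>{j..<k}. \<bar>a (Suc k) - a k\<bar>)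
     + (\<Sum>k\<in>{k..<l}. \<bar>a (Suc k) - a k\<bar>) + (\<Sum>k\<in>{l..<i+M}. \<bar>a (Suc k) - a k\<bar>)"
    using o by (simp add: sum.atLeastLessThan_concat)
  also have "\<dots> \<ge> \<bar>a j - a i\<bar> + \<bar>a k - a j\<bar> + \<bar>a l - a k\<bar> + \<bar>a (i + M) - a l\<bar>"
    using o by (intro add_mono abs_diff_le_sum)
  finally show ?thesis using per[of i] by simp
qed

lemma periodic_shift:
  fixes a :: "nat \<Rightarrow> 'a"
  assumes per: "\<And>i. a (i + M) = a i" and "M > 0"
  obtains j where "i \<le> j" "j < i + M" "a j = a k"
proof -
  have pm: "a (k + n * M) = a k" for k n
  proof (induction n)
    case (Suc n)
    have "a (k + Suc n * M) = a (k + n * M + M)" by (simp add: algebra_simps)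
    then show ?case using per[of "k + n * M"] Suc by simp
  qed simp
  define k' where "k' = k mod M"
  have k': "k' < M" "a k' = a k" using assms(2) pm[of k' "k div M"] by (auto simp: k'_def)
  define n where "n = i div M"
  have n: "n * M \<le> i" "i < n * M + M" using assms(2) dividend_less_div_times[of M i] by (auto simp: n_def)
  show thesis
  proof (cases "i \<le> n * M + k'")
    case True
    then show thesis using that[of "n * M + k'"] n k' pm[of k' n] by (simp add: add.commute)
  next
    case False
    then show thesis using that[of "k' + Suc n * M"] n k' pm[of k' "Suc n"] by (simp add: algebra_simps)
  qed
qed

text \<open>Cutting at the level \<open>c\<close> splits the variation into a part below, at least
  \<open>2 * (c - lo)\<close>, and a part above. Above \<open>c\<close> there are two separate
  humps: the one with the maximum costs at least \<open>2 * (hi - c)\<close>, and the other makes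
  the inequality strict.\<close>

lemma alternation_variation_gt:
  fixes a :: "nat \<Rightarrow> real"
  assumes per: "\<And>i. a (i + M) = a i"
    and alt: "i1 < i2" "i2 < i3" "i3 < i4" "i4 < i1 + M" "a i1 > c" "a i2 < c" "a i3 > c" "a i4 < c"
    and hi: "a X = hi" "\<And>i. a i \<le> hi" and lo: "a Y = lo" "\<And>i. a i \<ge> lo"
  shows "2 * (hi - lo) < (\<Sum>k<M. \<bar>a (Suc k) - a k\<bar>)"
proof -
  have M: "M > 0" using alt by linarith
  define b d where "b i = max (a i) c" and "d i = min (a i) c" for i
  have perb: "b (i + M) = b i" and perd: "d (i + M) = d i" for i by (auto simp: b_def d_def per)
  have split: "\<bar>a (Suc k) - a k\<bar> = \<bar>b (Suc k) - b k\<bar> + \<bar>d (Suc k) - d k\<bar>" for k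
    by (auto simp: b_def d_def max_def min_def)
  have D: "2 * (c - lo) \<le> (\<Sum>k<M. \<bar>d (Suc k) - d k\<bar>)"
  proof -
    obtain j where j: "Y \<le> j" "j < Y + M" "d j = d i1" using periodic_shift[of d M, OF perd M] by metis
    have "2 * \<bar>d j - d Y\<bar> \<le> (\<Sum>k<M. \<bar>d (Suc k) - d k\<bar>)" by (rule cyclic_variation_lower2[of d, OF perd]) (use j in auto)
    moreover have "lo < c" using lo(2)[of i2] alt(6) by linarith
    then have "d Y = lo" using lo(1) by (simp add: d_def)
    moreover have "d i1 = c" using alt by (simp add: d_def)
    ultimately show ?thesis using j lo(2)[of i2] alt by simp
  qed
  have b2: "b i2 = c" "b i4 = c" using alt by (auto simp: b_def)
  have b1: "b i1 > c" "b i3 > c" using alt by (auto simp: b_def)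
  \<comment> \<open>A place of the maximum in the period that starts at \<open>i2\<close>; whether
    it comes before or after \<open>i4\<close> decides which hump contains it.\<close>
  obtain x where x: "i2 \<le> x" "x < i2 + M" "b x = b X" using periodic_shift[of b M, OF perb M] by metis
  have bx: "b x = hi" using x(3) hi(1) hi(2)[of i1] alt by (simp add: b_def)
  have hc: "hi > c" using hi(2)[of i1] alt by simp
  have "2 * (hi - c) < (\<Sum>k<M. \<bar>b (Suc k) - b k\<bar>)"
  proof (cases "x \<le> i4")
    case True
    have "\<bar>b x - b i2\<bar> + \<bar>b i4 - b x\<bar> + \<bar>b (i1 + M) - b i4\<bar> + \<bar>b i2 - b (i1 + M)\<bar> \<le> (\<Sum>k<M. \<bar>b (Suc k) - b k\<bar>)"
      by (rule cyclic_variation_lower4[of b, OF perb]) (use True x alt in auto)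
    then show ?thesis using bx b2 b1 hc perb[of i1] by simp
  next
    case False
    have "\<bar>b i3 - b i2\<bar> + \<bar>b i4 - b i3\<bar> + \<bar>b x - b i4\<bar> + \<bar>b i2 - b x\<bar> \<le> (\<Sum>k<M. \<bar>b (Suc k) - b k\<bar>)"
      by (rule cyclic_variation_lower4[of b, OF perb]) (use False x alt in auto)
    then show ?thesis using bx b2 b1 hc by simp
  qed
  moreover have "(\<Sum>k<M. \<bar>a (Suc k) - a k\<bar>) = (\<Sum>k<M. \<bar>b (Suc k) - b k\<bar>) + (\<Sum>k<M. \<bar>d (Suc k) - d k\<bar>)"
    unfolding split by (simp add: sum.distrib)
  ultimately show ?thesis using D add_less_le_mono[of "2 * (hi - c)" _ "2 * (c - lo)"] by (fastforce simp: algebra_simps)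
qed

text \<open>From a minimum the sequence can only rise to the maximum and then only fall, since any
  reversal would form an alternation together with the maximum and the minimum. So the variation is
  at most twice the range.\<close>

lemma no_alternation_variation_le:
  fixes a :: "nat \<Rightarrow> real"
  assumes per: "\<And>i. a (i + M) = a i" and M: "M > 0"
    and na: "\<And>c i1 i2 i3 i4. i1 < i2 \<Longrightarrow> i2 < i3 \<Longrightarrow> i3 < i4 \<Longrightarrow> i4 < i1 + M \<Longrightarrow>
      a i1 > c \<Longrightarrow> a i2 < c \<Longrightarrow> a i3 > c \<Longrightarrow> a i4 < c \<Longrightarrow> False"
    and hi: "\<And>i. a i \<le> hi" and lo: "\<And>i. lo \<le> a i"
  shows "(\<Sum>k<M. \<bar>a (Suc k) - a k\<bar>) \<le> 2 * (hi - lo)"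
proof -
  obtain m where m: "m < M" "\<And>i. i < M \<Longrightarrow> a m \<le> a i"
  proof -
    have "finite (a ` {..<M})" "a ` {..<M} \<noteq> {}" using M by auto
    then have "Min (a ` {..<M}) \<in> a ` {..<M}" by (rule Min_in)
    then obtain m where "m < M" "a m = Min (a ` {..<M})" by auto
    then show thesis using that[of m] Min_le[of "a ` {..<M}"] by auto
  qed
  obtain X0 where X0: "X0 < M" "\<And>i. i < M \<Longrightarrow> a i \<le> a X0"
  proof -
    have "finite (a ` {..<M})" "a ` {..<M} \<noteq> {}" using M by auto
    then have "Max (a ` {..<M}) \<in> a ` {..<M}" by (rule Max_in)
    then obtain m where "m < M" "a m = Max (a ` {..<M})" by auto
    then show thesis using that[of m] Max_ge[of "a ` {..<M}"] by auto
  qed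
  have all: "\<exists>j<M. a j = a i" for i
    using periodic_shift[of a M 0 i, OF per M] by auto
  have mmin: "a m \<le> a i" for i using all[of i] m by metis
  obtain X where X: "m \<le> X" "X < m + M" "a X = a X0" using periodic_shift[of a M m X0, OF per M] by metis
  have Xmax: "a i \<le> a X" for i using all[of i] X0 X by metis
  have up: "a i \<le> a j" if "m \<le> i" "i < j" "j \<le> X" for i j
  proof (rule ccontr)
    assume n: "\<not> a i \<le> a j"
    define c where "c = (a i + a j) / 2"
    have c: "a i > c" "a j < c" using n by (auto simp: c_def)
    have "i \<noteq> m" using n mmin[of j] by auto
    moreover have "j \<noteq> X" using n Xmax[of i] by auto
    ultimately show False
      using na[of i j X "m + M" c] that X c Xmax[of i] mmin[of j] per[of m] by simp
  qed
  have down: "a j \<le> a i" if "X \<le> i" "i < j" "j \<le> m + M" for i j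
  proof (rule ccontr)
    assume n: "\<not> a j \<le> a i"
    define c where "c = (a i + a j) / 2"
    have c: "a j > c" "a i < c" using n by (auto simp: c_def)
    have "i \<noteq> X" using n Xmax[of j] by auto
    moreover have "j \<noteq> m + M" using n mmin[of i] per[of m] by auto
    moreover have "m < X"
    proof (rule ccontr)
      assume "\<not> m < X"
      then show False using X n Xmax[of j] mmin[of i] by (metis le_antisym leI order_trans)
    qed
    ultimately show False
      using na[of X i j "m + M" c] that X c Xmax[of j] mmin[of i] per[of m] by simp
  qed
  have "(\<Sum>k<M. \<bar>a (Suc k) - a k\<bar>) = (\<Sum>k\<in>{m..<m+M}. \<bar>a (Suc k) - a k\<bar>)"
    by (rule window_sum[symmetric]) (use per[of "Suc _"] per in simp)
  also have "\<dots> = (\<Sum>k\<in>{m..<X}. \<bar>a (Suc k) - a k\<bar>) + (\<Sum>k\<in>{X..<m+M}. \<bar>a (Suc k) - a k\<bar>)"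
    using X by (simp add: sum.atLeastLessThan_concat)
  also have "(\<Sum>k\<in>{m..<X}. \<bar>a (Suc k) - a k\<bar>) = (\<Sum>k\<in>{m..<X}. a (Suc k) - a k)"
    by (rule sum.cong) (use up in auto)
  also have "\<dots> = a X - a m" using sum_Suc_diff'[of m X a] X by simp
  also have "(\<Sum>k\<in>{X..<m+M}. \<bar>a (Suc k) - a k\<bar>) = (\<Sum>k\<in>{X..<m+M}. - (a (Suc k) - a k))"
    by (rule sum.cong) (use down in auto)
  also have "\<dots> = a X - a (m + M)" unfolding sum_negf using sum_Suc_diff'[of X "m + M" a] X by simp
  finally show ?thesis using per[of m] hi[of X] lo[of m] by simp
qed

subsection \<open>The Cauchy--Crofton formula\<close>

text \<open>The number is 4; it appears on both sides of the comparisons and cancels.\<close>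

definition crofton_const :: real where
  "crofton_const = integral {0..2*pi} (\<lambda>t. \<bar>cos t\<bar>)"

lemma crofton_const_pos: "crofton_const > 0"
proof -
  have "integral {0..2*pi} (\<lambda>t. \<bar>cos t\<bar>) \<noteq> 0"
  proof
    assume "integral {0..2*pi} (\<lambda>t. \<bar>cos t\<bar>) = 0"
    then have "\<forall>t\<in>{0..2*pi}. \<bar>cos t\<bar> = 0"
      by (subst (asm) integral_eq_0_iff) (auto intro!: continuous_intros)
    then have "\<bar>cos 0\<bar> = (0::real)" by (metis atLeastAtMost_iff order_refl pi_ge_zero zero_le_mult_iff zero_le_numeral)
    then show False by simp
  qed
  moreover have "integral {0..2*pi} (\<lambda>t. \<bar>cos t\<bar>) \<ge> 0"
    by (rule Henstock_Kurzweil_Integration.integral_nonneg) (auto intro!: integrable_continuous_interval continuous_intros)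
  ultimately show ?thesis by (simp add: crofton_const_def)
qed

lemma integral_abs_cos_shift:
  assumes "0 \<le> c" "c \<le> 2 * pi"
  shows "integral {0..2*pi} (\<lambda>t. \<bar>cos (t - c)\<bar>) = crofton_const"
proof -
  let ?f = "\<lambda>t::real. \<bar>cos t\<bar>"
  have int: "?f integrable_on {a..b}" for a b :: real
    by (intro integrable_continuous_interval continuous_intros)
  have sh: "integral {a..b} (\<lambda>t. ?f (t - e)) = integral {a-e..b-e} ?f" for a b e :: real
    using integral_shift_Icc_real[of "a - e" "b - e" "\<lambda>t. ?f (t - e)" e] by (simp add: o_def)
  have p: "?f (t - 2 * pi) = ?f t" for t by (simp add: cos_diff)
  have "integral {0..2*pi} (\<lambda>t. ?f (t - c)) = integral {-c..2*pi-c} ?f" using sh[of 0 "2*pi" c] by simp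
  also have "\<dots> = integral {-c..0} ?f + integral {0..2*pi-c} ?f"
    using assms by (intro Henstock_Kurzweil_Integration.integral_combine[symmetric] int) auto
  also have "integral {-c..0} ?f = integral {2*pi-c..2*pi} ?f"
    using sh[of "2*pi-c" "2*pi" "2*pi"] unfolding p by simp
  also have "integral {2*pi-c..2*pi} ?f + integral {0..2*pi-c} ?f = integral {0..2*pi} ?f"
    using assms Henstock_Kurzweil_Integration.integral_combine[of 0 "2*pi-c" "2*pi" ?f] int by simp
  finally show ?thesis by (simp add: crofton_const_def)
qed

text \<open>Turning \<open>e\<close> onto the real axis only shifts the argument of the cosine, so
  the mean length of the shadow of a vector is proportional to its length.\<close>

lemma crofton: "integral {0..2*pi} (\<lambda>t. \<bar>cis t \<bullet> e\<bar>) = crofton_const * norm e"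
proof -
  define c where "c = Arg2pi e"
  have e: "e = of_real (norm e) * cis c" using Arg2pi_eq[of e] by (simp add: c_def cis_conv_exp)
  have "\<bar>cis t \<bullet> e\<bar> = norm e * \<bar>cos (t - c)\<bar>" for t
  proof -
    have "cis t \<bullet> e = norm e * cos (t - c)"
      by (subst e) (simp add: inner_complex_def cos_diff algebra_simps)
    then show ?thesis by (simp add: abs_mult)
  qed
  then have "integral {0..2*pi} (\<lambda>t. \<bar>cis t \<bullet> e\<bar>) = norm e * integral {0..2*pi} (\<lambda>t. \<bar>cos (t - c)\<bar>)"
    by simp
  also have "integral {0..2*pi} (\<lambda>t. \<bar>cos (t - c)\<bar>) = crofton_const"
    by (rule integral_abs_cos_shift) (use Arg2pi_ge_0[of e] Arg2pi_lt_2pi[of e] in \<open>auto simp: c_def\<close>)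
  finally show ?thesis by simp
qed

lemma crofton_sum:
  fixes v :: "nat \<Rightarrow> complex"
  shows "integral {0..2*pi} (\<lambda>t. \<Sum>i<M. \<bar>cis t \<bullet> (v (Suc i) - v i)\<bar>) = crofton_const * (\<Sum>i<M. dist (v (Suc i)) (v i))"
proof -
  have "integral {0..2*pi} (\<lambda>t. \<Sum>i<M. \<bar>cis t \<bullet> (v (Suc i) - v i)\<bar>)
    = (\<Sum>i<M. integral {0..2*pi} (\<lambda>t. \<bar>cis t \<bullet> (v (Suc i) - v i)\<bar>))"
    by (rule Henstock_Kurzweil_Integration.integral_sum) (auto intro!: integrable_continuous_interval continuous_intros)
  then show ?thesis by (simp add: crofton sum_distrib_left dist_norm)
qed

text \<open>By Cauchy's formula the integral of \<open>2 * width Q\<close> over a full turn, divided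
  by \<open>crofton_const\<close>, is the perimeter of the hull of \<open>Q\<close>, a segment being
  counted twice. This integral stands for the perimeter throughout.\<close>

definition width :: "complex set \<Rightarrow> real \<Rightarrow> real" where
  "width Q t = Max ((\<lambda>x. cis t \<bullet> x) ` Q) - Min ((\<lambda>x. cis t \<bullet> x) ` Q)"

lemma continuous_on_Max_finite:
  fixes f :: "'b \<Rightarrow> 'a::topological_space \<Rightarrow> real"
  assumes "finite Q" "Q \<noteq> {}" "\<And>x. x \<in> Q \<Longrightarrow> continuous_on S (f x)"
  shows "continuous_on S (\<lambda>t. Max ((\<lambda>x. f x t) ` Q))"
  using assms
proof (induction Q rule: finite_ne_induct)
  case (insert x F)
  then show ?case by (simp add: continuous_on_max)
qed simp

lemma continuous_on_Min_finite:
  fixes f :: "'b \<Rightarrow> 'a::topological_space \<Rightarrow> real"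
  assumes "finite Q" "Q \<noteq> {}" "\<And>x. x \<in> Q \<Longrightarrow> continuous_on S (f x)"
  shows "continuous_on S (\<lambda>t. Min ((\<lambda>x. f x t) ` Q))"
  using assms
proof (induction Q rule: finite_ne_induct)
  case (insert x F)
  then show ?case by (simp add: continuous_on_min)
qed simp

lemma continuous_on_width: "finite Q \<Longrightarrow> Q \<noteq> {} \<Longrightarrow> continuous_on S (width Q)"
  unfolding width_def by (intro continuous_intros continuous_on_Max_finite continuous_on_Min_finite) auto

lemma inner_hull_bounds:
  assumes "finite Q" "x \<in> convex hull Q"
  shows "u \<bullet> x \<le> Max ((\<lambda>x. u \<bullet> x) ` Q)" "Min ((\<lambda>x. u \<bullet> x) ` Q) \<le> u \<bullet> x"
proof -
  have "convex hull Q \<subseteq> {y. u \<bullet> y \<le> Max ((\<lambda>x. u \<bullet> x) ` Q)}"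
    by (intro hull_minimal convex_halfspace_le) (use assms in auto)
  then show "u \<bullet> x \<le> Max ((\<lambda>x. u \<bullet> x) ` Q)" using assms by blast
  have "convex hull Q \<subseteq> {y. u \<bullet> y \<ge> Min ((\<lambda>x. u \<bullet> x) ` Q)}"
    by (intro hull_minimal convex_halfspace_ge) (use assms in auto)
  then show "Min ((\<lambda>x. u \<bullet> x) ` Q) \<le> u \<bullet> x" using assms by blast
qed

lemma hull_extremes_attained:
  assumes "finite Q" "Q \<noteq> {}" "S \<subseteq> Q" "Q \<subseteq> convex hull S"
  shows "\<exists>x\<in>S. u \<bullet> x = Max ((\<lambda>x. u \<bullet> x) ` Q)" "\<exists>x\<in>S. u \<bullet> x = Min ((\<lambda>x. u \<bullet> x) ` Q)"
proof -
  have S: "finite S" "S \<noteq> {}" using assms finite_subset by auto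
  have "Max ((\<lambda>x. u \<bullet> x) ` S) = Max ((\<lambda>x. u \<bullet> x) ` Q)"
  proof (rule antisym)
    show "Max ((\<lambda>x. u \<bullet> x) ` S) \<le> Max ((\<lambda>x. u \<bullet> x) ` Q)" using assms S by (intro Max_mono) auto
    show "Max ((\<lambda>x. u \<bullet> x) ` Q) \<le> Max ((\<lambda>x. u \<bullet> x) ` S)"
      using assms inner_hull_bounds(1)[OF S(1)] by (subst Max_le_iff) auto
  qed
  moreover have "Max ((\<lambda>x. u \<bullet> x) ` S) \<in> (\<lambda>x. u \<bullet> x) ` S" using S by (intro Max_in) auto
  ultimately show "\<exists>x\<in>S. u \<bullet> x = Max ((\<lambda>x. u \<bullet> x) ` Q)" by auto
  have "Min ((\<lambda>x. u \<bullet> x) ` S) = Min ((\<lambda>x. u \<bullet> x) ` Q)"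
  proof (rule antisym)
    show "Min ((\<lambda>x. u \<bullet> x) ` Q) \<le> Min ((\<lambda>x. u \<bullet> x) ` S)" using assms S by (intro Min_antimono) auto
    show "Min ((\<lambda>x. u \<bullet> x) ` S) \<le> Min ((\<lambda>x. u \<bullet> x) ` Q)"
      using assms inner_hull_bounds(2)[OF S(1)] by (subst Min_ge_iff) auto
  qed
  moreover have "Min ((\<lambda>x. u \<bullet> x) ` S) \<in> (\<lambda>x. u \<bullet> x) ` S" using S by (intro Min_in) auto
  ultimately show "\<exists>x\<in>S. u \<bullet> x = Min ((\<lambda>x. u \<bullet> x) ` Q)" by auto
qed

text \<open>By the Cauchy--Crofton formula the bound on the length forces the shadow of the polygon in every
  direction to be traversed exactly twice.\<close>

lemma short_tour_no_alt:
  assumes r: "r \<noteq> []" and Q: "finite Q" "set r \<subseteq> Q" "Q \<subseteq> convex hull (set r)"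
    and len: "crofton_const * (\<Sum>i<length r. dist (cyc r (Suc i)) (cyc r i)) \<le> integral {0..2*pi} (\<lambda>t. 2 * width Q t)"
  shows "no_alt (cyc r) (length r)"
proof -
  let ?M = "length r"
  let ?T = "\<lambda>t. \<Sum>i<?M. \<bar>cis t \<bullet> (cyc r (Suc i) - cyc r i)\<bar>"
  have Qne: "Q \<noteq> {}" using r Q by auto
  have M: "?M > 0" using r by simp
  have per: "cis t \<bullet> cyc r (i + ?M) = cis t \<bullet> cyc r i" for t i by (simp add: cyc_add_length)
  have T: "?T t = (\<Sum>i<?M. \<bar>cis t \<bullet> cyc r (Suc i) - cis t \<bullet> cyc r i\<bar>)" for t
    by (simp add: inner_diff_right)
  have att: "\<exists>i. cis t \<bullet> cyc r i = Max ((\<lambda>x. cis t \<bullet> x) ` Q)" "\<exists>i. cis t \<bullet> cyc r i = Min ((\<lambda>x. cis t \<bullet> x) ` Q)" for t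
    using hull_extremes_attained[OF Q(1) Qne Q(2,3), of "cis t"] cyc_index[of _ r 0] by metis+
  have ub: "cis t \<bullet> cyc r i \<le> Max ((\<lambda>x. cis t \<bullet> x) ` Q)" "cis t \<bullet> cyc r i \<ge> Min ((\<lambda>x. cis t \<bullet> x) ` Q)" for t i
    using cyc_in_set[OF r, of i] Q by (auto intro!: Max_ge Min_le)
  have ge: "2 * width Q t \<le> ?T t" for t
  proof -
    obtain X where X: "cis t \<bullet> cyc r X = Max ((\<lambda>x. cis t \<bullet> x) ` Q)" using att(1) by blast
    obtain Y where Y: "cis t \<bullet> cyc r Y = Min ((\<lambda>x. cis t \<bullet> x) ` Q)" using att(2) by blast
    obtain j where j: "Y \<le> j" "j < Y + ?M" "cis t \<bullet> cyc r j = cis t \<bullet> cyc r X"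
      using periodic_shift[of "\<lambda>i. cis t \<bullet> cyc r i" ?M Y X, OF per M] by metis
    have "2 * \<bar>cis t \<bullet> cyc r j - cis t \<bullet> cyc r Y\<bar> \<le> (\<Sum>i<?M. \<bar>cis t \<bullet> cyc r (Suc i) - cis t \<bullet> cyc r i\<bar>)"
      by (rule cyclic_variation_lower2[of "\<lambda>i. cis t \<bullet> cyc r i", OF per]) (use j in auto)
    moreover have "2 * x \<le> 2 * \<bar>x\<bar>" for x :: real by simp
    ultimately show ?thesis unfolding T width_def j(3) X Y by (rule order_trans[rotated])
  qed
  have cT: "continuous_on {0..2*pi} ?T" by (intro continuous_intros)
  have cW: "continuous_on {0..2*pi} (\<lambda>t. 2 * width Q t)"
    by (intro continuous_intros continuous_on_width Q Qne)
  have "integral {0..2*pi} (\<lambda>t. ?T t - 2 * width Q t) = integral {0..2*pi} ?T - integral {0..2*pi} (\<lambda>t. 2 * width Q t)"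
    by (rule Henstock_Kurzweil_Integration.integral_diff) (intro integrable_continuous_interval cT cW)+
  also have "\<dots> \<le> 0" using len unfolding crofton_sum by simp
  finally have "integral {0..2*pi} (\<lambda>t. ?T t - 2 * width Q t) \<le> 0" .
  moreover have "integral {0..2*pi} (\<lambda>t. ?T t - 2 * width Q t) \<ge> 0"
    by (rule Henstock_Kurzweil_Integration.integral_nonneg)
      (use ge in \<open>auto intro!: integrable_continuous_interval continuous_on_diff cT cW\<close>)
  ultimately have "integral {0..2*pi} (\<lambda>t. ?T t - 2 * width Q t) = 0" by simp
  \<comment> \<open>A nonnegative continuous function with integral 0 vanishes, so equality holds in
    every single direction, whereas an alternation would make the inequality strict in its
    direction.\<close>
  then have eq: "?T t = 2 * width Q t" if "t \<in> {0..2*pi}" for t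
    using that ge by (subst (asm) integral_eq_0_iff) (auto intro!: continuous_on_diff cT cW)
  show ?thesis unfolding no_alt_def
  proof (intro notI, elim exE conjE)
    fix u c i1 i2 i3 i4
    assume o: "i1 < i2" "i2 < i3" "i3 < i4" "i4 < i1 + ?M"
      and f: "c < u \<bullet> cyc r i1" "u \<bullet> cyc r i2 < c" "c < u \<bullet> cyc r i3" "u \<bullet> cyc r i4 < c"
    have u0: "u \<noteq> 0" using f by auto
    define t where "t = Arg2pi u"
    have t: "t \<in> {0..2*pi}" using Arg2pi_ge_0[of u] Arg2pi_lt_2pi[of u] by (auto simp: t_def)
    have u: "u = norm u *\<^sub>R cis t" using Arg2pi_eq[of u] by (simp add: t_def cis_conv_exp scaleR_conv_of_real)
    have n: "norm u > 0" using u0 by simp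
    have ui: "u \<bullet> x = norm u * (cis t \<bullet> x)" for x by (subst u) simp
    have f': "c / norm u < cis t \<bullet> cyc r i1" "cis t \<bullet> cyc r i2 < c / norm u"
       "c / norm u < cis t \<bullet> cyc r i3" "cis t \<bullet> cyc r i4 < c / norm u"
      using f n unfolding ui by (auto simp: pos_divide_less_eq pos_less_divide_eq mult.commute)
    obtain X where X: "cis t \<bullet> cyc r X = Max ((\<lambda>x. cis t \<bullet> x) ` Q)" using att(1) by blast
    obtain Y where Y: "cis t \<bullet> cyc r Y = Min ((\<lambda>x. cis t \<bullet> x) ` Q)" using att(2) by blast
    have "2 * (Max ((\<lambda>x. cis t \<bullet> x) ` Q) - Min ((\<lambda>x. cis t \<bullet> x) ` Q)) < (\<Sum>i<?M. \<bar>cis t \<bullet> cyc r (Suc i) - cis t \<bullet> cyc r i\<bar>)"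
      by (rule alternation_variation_gt[of "\<lambda>i. cis t \<bullet> cyc r i", OF per o f' X ub(1) Y ub(2)])
    then show False using eq[OF t] unfolding T by (simp add: width_def)
  qed
qed

subsection \<open>Radial projection onto the boundary of a convex body\<close>

lemma cis_sign_period:
  assumes "\<sigma> = 1 \<or> \<sigma> = -1"
  shows "cis (\<sigma> * (a + 2 * pi * of_nat k)) = cis (\<sigma> * a)"
proof -
  have "\<sigma> * (a + 2 * pi * of_nat k) = \<sigma> * a + 2 * pi * of_int (if \<sigma> = 1 then int k else - int k)"
    using assms by (auto simp: distrib_left)
  moreover have "cis (\<sigma> * a + 2 * pi * of_int m) = cis (\<sigma> * a)" for m
  proof -
    have "cis (2 * pi * of_int m) = 1" by (simp add: complex_eq_iff)
    then show ?thesis by (metis cis_mult mult.right_neutral)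
  qed
  ultimately show ?thesis by simp
qed

text \<open>A scaling factor rather than a distance, since \<open>w\<close> may have any length. It
  is picked by choice; \<open>rdist_unique\<close> shows that the choice is forced.\<close>

definition rdist :: "complex set \<Rightarrow> complex \<Rightarrow> complex \<Rightarrow> real" where
  "rdist K z0 w = (SOME d. 0 < d \<and> z0 + d *\<^sub>R w \<in> frontier K)"

definition radial :: "complex set \<Rightarrow> complex \<Rightarrow> complex \<Rightarrow> complex" where
  "radial K z0 z = z0 + rdist K z0 (z - z0) *\<^sub>R (z - z0)"

context
  fixes K :: "complex set" and z0 :: complex
  assumes K: "convex K" "compact K" "z0 \<in> interior K"
begin

lemma rdist_props:
  assumes "w \<noteq> 0"
  shows "0 < rdist K z0 w" "z0 + rdist K z0 w *\<^sub>R w \<in> frontier K"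
proof -
  obtain d where "0 < d" "z0 + d *\<^sub>R w \<in> frontier K"
    using ray_to_frontier[OF compact_imp_bounded[OF K(2)] K(3) assms] by metis
  then have "0 < rdist K z0 w \<and> z0 + rdist K z0 w *\<^sub>R w \<in> frontier K"
    unfolding rdist_def by (intro someI[of "\<lambda>d. 0 < d \<and> z0 + d *\<^sub>R w \<in> frontier K" d]) simp
  then show "0 < rdist K z0 w" "z0 + rdist K z0 w *\<^sub>R w \<in> frontier K" by auto
qed

lemma frontier_in_K: "frontier K \<subseteq> K"
  using K(2) by (simp add: compact_imp_closed frontier_subset_closed)

lemma ray_interior:
  assumes "z0 + e *\<^sub>R w \<in> K" "0 \<le> d" "d < e"
  shows "z0 + d *\<^sub>R w \<in> interior K"
proof -
  have "0 < 1 - d / e" "1 - d / e \<le> 1" using assms by (auto simp: field_simps)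
  then have "(z0 + e *\<^sub>R w) - (1 - d / e) *\<^sub>R ((z0 + e *\<^sub>R w) - z0) \<in> interior K"
    by (rule mem_interior_convex_shrink[OF K(1,3) assms(1)])
  moreover have "(z0 + e *\<^sub>R w) - (1 - d / e) *\<^sub>R ((z0 + e *\<^sub>R w) - z0) = z0 + d *\<^sub>R w"
  proof -
    have "(1 - d / e) * e = e - d" using assms by (simp add: field_simps)
    then show ?thesis by (simp add: scaleR_diff_left)
  qed
  ultimately show ?thesis by (simp only:)
qed

text \<open>A point of \<open>K\<close> further out on the ray would make the chosen frontier point
  interior.\<close>

lemma rdist_max:
  assumes "w \<noteq> 0" "z0 + e *\<^sub>R w \<in> K"
  shows "e \<le> rdist K z0 w"
proof (rule ccontr)
  assume "\<not> ?thesis"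
  then have "z0 + rdist K z0 w *\<^sub>R w \<in> interior K"
    using ray_interior[OF assms(2), of "rdist K z0 w"] rdist_props[OF assms(1)] by simp
  then show False using rdist_props(2)[OF assms(1)] by (simp add: frontier_def)
qed

lemma rdist_unique:
  assumes "w \<noteq> 0" "z0 + e *\<^sub>R w \<in> frontier K" "e > 0"
  shows "rdist K z0 w = e"
proof (rule ccontr)
  assume ne: "rdist K z0 w \<noteq> e"
  have "e \<le> rdist K z0 w" by (rule rdist_max[OF assms(1)]) (use assms frontier_in_K in blast)
  then have "z0 + e *\<^sub>R w \<in> interior K"
    using ray_interior[of "rdist K z0 w" w e] rdist_props(2)[OF assms(1)] frontier_in_K assms ne by auto
  then show False using assms(2) by (simp add: frontier_def)
qed

lemma rdist_scale:
  assumes "w \<noteq> 0" "k > 0"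
  shows "rdist K z0 (k *\<^sub>R w) = rdist K z0 w / k"
  by (rule rdist_unique) (use assms rdist_props[OF assms(1)] in auto)

lemma radial_frontier: "z \<noteq> z0 \<Longrightarrow> radial K z0 z \<in> frontier K"
  unfolding radial_def by (rule rdist_props) simp

lemma radial_ang:
  assumes "ang z0 \<sigma> z a"
  shows "radial K z0 z = radial K z0 (z0 + cis (\<sigma> * a))"
proof -
  have n: "norm (z - z0) > 0" using assms by (auto simp: ang_def)
  have z: "z - z0 = norm (z - z0) *\<^sub>R cis (\<sigma> * a)" using assms by (auto simp: ang_def scaleR_conv_of_real)
  have "rdist K z0 (z - z0) = rdist K z0 (norm (z - z0) *\<^sub>R cis (\<sigma> * a))" using z by simp
  also have "\<dots> = rdist K z0 (cis (\<sigma> * a)) / norm (z - z0)" by (rule rdist_scale) (use n in auto)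
  finally have r: "rdist K z0 (z - z0) = rdist K z0 (cis (\<sigma> * a)) / norm (z - z0)" .
  have "rdist K z0 (z - z0) *\<^sub>R (z - z0) = rdist K z0 (cis (\<sigma> * a)) *\<^sub>R cis (\<sigma> * a)"
    unfolding r by (subst (2) z) (use n in simp)
  then show ?thesis by (simp add: radial_def)
qed

lemma radial_fix:
  assumes "z \<in> frontier K"
  shows "radial K z0 z = z"
proof -
  have "z \<noteq> z0" using assms K(3) by (auto simp: frontier_def)
  then have "rdist K z0 (z - z0) = 1" by (intro rdist_unique) (use assms in auto)
  then show ?thesis by (simp add: radial_def)
qed

text \<open>A point outside the interior lies on its ray at the frontier or beyond it, and moving
  towards the frontier point it stays beyond until the end.\<close>

lemma radial_out:
  assumes z: "z \<notin> interior K" and s: "0 \<le> s" "s < 1"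
  shows "z = radial K z0 z \<or> (1 - s) *\<^sub>R z + s *\<^sub>R radial K z0 z \<notin> K"
proof (cases "z = radial K z0 z")
  case False
  have zz: "z \<noteq> z0" using z K(3) by auto
  define d where "d = rdist K z0 (z - z0)"
  have r: "radial K z0 z = z0 + d *\<^sub>R (z - z0)" by (simp add: radial_def d_def)
  have "d \<le> 1"
  proof (rule ccontr)
    assume "\<not> d \<le> 1"
    then have "z0 + 1 *\<^sub>R (z - z0) \<in> interior K"
      using ray_interior[of d "z - z0" 1] rdist_props(2)[of "z - z0"] zz frontier_in_K by (auto simp: d_def)
    then show False using z by simp
  qed
  moreover have "d \<noteq> 1" using r False by auto
  ultimately have d1: "d < 1" by simp
  have "(1 - s) *\<^sub>R z + s *\<^sub>R radial K z0 z = z0 + ((1 - s) + s * d) *\<^sub>R (z - z0)"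
    unfolding r by (simp add: algebra_simps)
  moreover have "(1 - s) + s * d > d"
  proof -
    have "(1 - s) * (1 - d) > 0" using s d1 by simp
    then show ?thesis by (simp add: algebra_simps)
  qed
  ultimately show ?thesis using rdist_max[of "z - z0" "(1 - s) + s * d"] zz by (auto simp: d_def)
qed simp

text \<open>By the closed graph criterion, as the frontier is compact: \<open>y\<close> is the
  projection of \<open>z\<close> if and only if it lies on the frontier and \<open>y - z0\<close> is
  a nonnegative multiple of \<open>z - z0\<close>, which is the closed condition
  \<open>C\<close>.\<close>

lemma radial_continuous:
  shows "continuous_on (- {z0}) (radial K z0)"
proof -
  have comp: "compact (frontier K)" using K(2) by (simp add: compact_frontier)
  have im: "radial K z0 \<in> - {z0} \<rightarrow> frontier K" using radial_frontier by auto
  define C where "C = {p::complex\<times>complex. cr (fst p - z0) (snd p - z0) = 0 \<and> 0 \<le> (fst p - z0) \<bullet> (snd p - z0)}"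
  have clC: "closed C" unfolding C_def cr_inner
    by (intro closed_Collect_conj closed_Collect_eq closed_Collect_le continuous_intros)
  have "(\<lambda>x. (x, radial K z0 x)) ` (- {z0}) = ((- {z0}) \<times> frontier K) \<inter> C"
  proof
    show "(\<lambda>x. (x, radial K z0 x)) ` (- {z0}) \<subseteq> ((- {z0}) \<times> frontier K) \<inter> C"
    proof
      fix p assume "p \<in> (\<lambda>x. (x, radial K z0 x)) ` (- {z0})"
      then obtain z where z: "z \<noteq> z0" "p = (z, radial K z0 z)" by auto
      have "radial K z0 z - z0 = rdist K z0 (z - z0) *\<^sub>R (z - z0)" by (simp add: radial_def)
      then show "p \<in> ((- {z0}) \<times> frontier K) \<inter> C"
        using radial_frontier[OF z(1)] rdist_props(1)[of "z - z0"] z by (simp add: C_def cr_scale_right)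
    qed
    show "((- {z0}) \<times> frontier K) \<inter> C \<subseteq> (\<lambda>x. (x, radial K z0 x)) ` (- {z0})"
    proof
      fix p assume "p \<in> ((- {z0}) \<times> frontier K) \<inter> C"
      then obtain z y where z: "z \<noteq> z0" and y: "y \<in> frontier K" and c: "(z, y) \<in> C" and p: "p = (z, y)" by (cases p) auto
      have y0: "y \<noteq> z0" using y K(3) by (auto simp: frontier_def)
      obtain k where k: "y - z0 = k *\<^sub>R (z - z0)" using cr_eq_0_imp[of "z - z0" "y - z0"] c z by (auto simp: C_def)
      have "0 \<le> k * ((z - z0) \<bullet> (z - z0))" using c k by (simp add: C_def)
      moreover have "(z - z0) \<bullet> (z - z0) > 0" using z by simp
      ultimately have "k \<ge> 0" by (metis mult_neg_pos not_less)
      moreover have "k \<noteq> 0" using k y0 by auto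
      ultimately have "k > 0" by simp
      moreover have yk: "y = z0 + k *\<^sub>R (z - z0)" using k by (simp add: algebra_simps)
      ultimately have "rdist K z0 (z - z0) = k" using y z by (intro rdist_unique) auto
      then have "y = radial K z0 z" using yk by (simp add: radial_def)
      then show "p \<in> (\<lambda>x. (x, radial K z0 x)) ` (- {z0})" using z p by auto
    qed
  qed
  then have "closedin (top_of_set ((- {z0}) \<times> frontier K)) ((\<lambda>x. (x, radial K z0 x)) ` (- {z0}))"
    using clC by (auto simp: closedin_closed)
  then show ?thesis using continuous_closed_graph_eq[OF comp im] by blast
qed

lemma radial_ang_curve:
  "ang z0 \<sigma> (radial K z0 (z0 + cis (\<sigma> * a))) a"
proof (rule angI)
  show "radial K z0 (z0 + cis (\<sigma> * a)) - z0 = of_real (rdist K z0 (cis (\<sigma> * a))) * cis (\<sigma> * a)"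
    by (simp add: radial_def scaleR_conv_of_real)
  show "0 < rdist K z0 (cis (\<sigma> * a))" by (rule rdist_props) simp
qed

lemma radial_curve_period:
  "\<sigma> = 1 \<or> \<sigma> = -1 \<Longrightarrow> radial K z0 (z0 + cis (\<sigma> * (a + 2 * pi * of_nat k))) = radial K z0 (z0 + cis (\<sigma> * a))"
  by (simp only: cis_sign_period)

text \<open>No line crosses the boundary of a convex body four times. Let \<open>z0\<close> be on
  the low side. If the two high points are not opposite each other, one arc between them is shorter
  than half a turn; their chord is high, and on its rays the frontier lies still further out, so the
  whole arc is high. Opposite high points would make \<open>z0\<close> high.\<close>

lemma radial_curve_no_alternation:
  assumes \<sigma>: "\<sigma> = 1 \<or> \<sigma> = -1"
    and le: "i1 \<le> i2" "i2 \<le> i3" "i3 \<le> i4" "i4 \<le> i1 + 2 * pi"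
    and f: "c < u \<bullet> radial K z0 (z0 + cis (\<sigma> * i1))" "u \<bullet> radial K z0 (z0 + cis (\<sigma> * i2)) < c"
      "c < u \<bullet> radial K z0 (z0 + cis (\<sigma> * i3))" "u \<bullet> radial K z0 (z0 + cis (\<sigma> * i4)) < c"
  shows False
proof -
  let ?Y = "\<lambda>a. radial K z0 (z0 + cis (\<sigma> * a))"
  have Yper: "?Y (a + 2 * pi) = ?Y a" for a using radial_curve_period[OF \<sigma>, of a 1] by simp
  note Yang = radial_ang_curve[of \<sigma>]
  have YK: "?Y a \<in> K" for a
  proof -
    have "z0 + cis (\<sigma> * a) \<noteq> z0" by simp
    then show ?thesis using radial_frontier frontier_in_K by blast
  qed
  have arc: False if lt: "a \<le> b" "b \<le> c" "c < a + pi" and f: "u \<bullet> ?Y a > e" "u \<bullet> ?Y c > e" "u \<bullet> ?Y b < e" and z: "u \<bullet> z0 \<le> e"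
    for a b c u e
  proof -
    obtain r where r: "r > 0" "z0 + of_real r * cis (\<sigma> * b) \<in> closed_segment (?Y a) (?Y c)"
      using ang_cone[OF \<sigma> Yang Yang lt] .
    define w where "w = z0 + of_real r * cis (\<sigma> * b)"
    have "closed_segment (?Y a) (?Y c) \<subseteq> {x. u \<bullet> x > e}"
      using f by (intro closed_segment_subset convex_halfspace_gt) auto
    then have fw: "u \<bullet> w > e" using r w_def by auto
    have "closed_segment (?Y a) (?Y c) \<subseteq> K" by (intro closed_segment_subset YK K(1))
    then have wK: "z0 + r *\<^sub>R cis (\<sigma> * b) \<in> K" using r by (auto simp: scaleR_conv_of_real)
    define d where "d = rdist K z0 (cis (\<sigma> * b))"
    have rd: "r \<le> d" unfolding d_def by (rule rdist_max[OF _ wK]) simp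
    have Yb: "?Y b = z0 + d *\<^sub>R cis (\<sigma> * b)" by (simp add: radial_def d_def)
    have wz: "u \<bullet> w = u \<bullet> z0 + r * (u \<bullet> cis (\<sigma> * b))"
      by (simp add: w_def inner_add_right flip: scaleR_conv_of_real)
    then have "r * (u \<bullet> cis (\<sigma> * b)) > 0" using fw z by linarith
    then have "u \<bullet> cis (\<sigma> * b) > 0" using r(1) by (simp add: zero_less_mult_iff)
    then have "r * (u \<bullet> cis (\<sigma> * b)) \<le> d * (u \<bullet> cis (\<sigma> * b))" using rd by simp
    then have "u \<bullet> ?Y b \<ge> u \<bullet> w" unfolding Yb wz by (simp add: inner_add_right)
    then show False using f fw by simp
  qed
  have key: False if lt: "a \<le> b" "b \<le> c" "c \<le> d" "d \<le> a + 2 * pi"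
    and f: "u \<bullet> ?Y a > e" "u \<bullet> ?Y b < e" "u \<bullet> ?Y c > e" "u \<bullet> ?Y d < e" and z: "u \<bullet> z0 \<le> e"
    for a b c d u e
  proof -
    consider "c < a + pi" | "c = a + pi" | "c > a + pi" by linarith
    then show False
    proof cases
      case 1
      then show False using arc[of a b c e u] lt f z by simp
    next
      case 2
      have "cis (\<sigma> * c) = - cis (\<sigma> * a)" unfolding 2 using \<sigma> by (auto simp: complex_eq_iff distrib_left)
      then have Yc: "?Y c = z0 + rdist K z0 (cis (\<sigma> * c)) *\<^sub>R (- cis (\<sigma> * a))" by (simp add: radial_def)
      have c: "u \<bullet> ?Y c = u \<bullet> z0 - rdist K z0 (cis (\<sigma> * c)) * (u \<bullet> cis (\<sigma> * a))"
        unfolding Yc by (simp add: inner_diff_right)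
      have a: "u \<bullet> ?Y a = u \<bullet> z0 + rdist K z0 (cis (\<sigma> * a)) * (u \<bullet> cis (\<sigma> * a))" by (simp add: radial_def inner_add_right)
      have pos: "rdist K z0 (cis (\<sigma> * a)) > 0" "rdist K z0 (cis (\<sigma> * c)) > 0" by (rule rdist_props; simp)+
      have "rdist K z0 (cis (\<sigma> * a)) * (u \<bullet> cis (\<sigma> * a)) > 0" using a f z by linarith
      then have "u \<bullet> cis (\<sigma> * a) > 0" using pos by (simp add: zero_less_mult_iff)
      then have "rdist K z0 (cis (\<sigma> * c)) * (u \<bullet> cis (\<sigma> * a)) > 0" using pos by simp
      then show False using c f z by linarith
    next
      case 3
      show False by (rule arc[of c d "a + 2 * pi" e u]) (use 3 lt f z in \<open>auto simp only: Yper\<close>)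
    qed
  qed
  show False
  proof (cases "u \<bullet> z0 \<le> c")
    case True
    then show False using key[OF le f] by simp
  next
    case False
    \<comment> \<open>If \<open>z0\<close> is on the high side, \<open>u\<close> is replaced by
      \<open>- u\<close> and the cyclic order is read from \<open>i2\<close>.\<close>
    have "i2 + 2 * pi \<ge> i1 + 2 * pi" using le by simp
    then show False
      using key[of i2 i3 i4 "i1 + 2 * pi" "- c" "- u"] le f False Yper[of i1] by simp
  qed
qed

lemma radial_curve_no_alt:
  assumes \<sigma>: "\<sigma> = 1 \<or> \<sigma> = -1"
    and A: "\<And>i j. i \<le> j \<Longrightarrow> A i \<le> A j" "\<And>i. A (i + N) = A i + 2 * pi"
  shows "no_alt (\<lambda>i::nat. radial K z0 (z0 + cis (\<sigma> * A i))) N"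
  unfolding no_alt_def
proof (intro notI, elim exE conjE)
  let ?Y = "\<lambda>a. radial K z0 (z0 + cis (\<sigma> * a))"
  fix u c i1 i2 i3 i4
  assume o: "i1 < i2" "i2 < i3" "i3 < i4" "i4 < i1 + N"
    and f: "c < u \<bullet> ?Y (A i1)" "u \<bullet> ?Y (A i2) < c" "c < u \<bullet> ?Y (A i3)" "u \<bullet> ?Y (A i4) < c"
  have le: "A i1 \<le> A i2" "A i2 \<le> A i3" "A i3 \<le> A i4" "A i4 \<le> A i1 + 2 * pi"
    using A(1)[of i1 i2] A(1)[of i2 i3] A(1)[of i3 i4] A(1)[of i4 "i1 + N"] A(2)[of i1] o by auto
  show False by (rule radial_curve_no_alternation[OF \<sigma> le f])
qed

text \<open>A partition of one turn gives a closed polygon without alternation, so its shadow in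
  each direction is covered at most twice; the Cauchy--Crofton formula bounds its length by the
  perimeter.\<close>

lemma radial_curve_variation:
  assumes \<sigma>: "\<sigma> = 1 \<or> \<sigma> = -1" and Q: "finite Q" "K = convex hull Q"
  shows "variation (\<lambda>a. radial K z0 (z0 + cis (\<sigma> * a))) x (x + 2 * pi) \<le>
     ennreal (integral {0..2*pi} (\<lambda>t. 2 * width Q t) / crofton_const)"
proof (rule variation_least)
  fix N and t :: "nat \<Rightarrow> real"
  assume t: "t 0 = x" "t N = x + 2 * pi" "\<And>i. i < N \<Longrightarrow> t i \<le> t (Suc i)"
  let ?Y = "\<lambda>a. radial K z0 (z0 + cis (\<sigma> * a))"
  have Qne: "Q \<noteq> {}" using Q K(3) by auto
  have N: "N > 0" using t by (cases N) auto
  note Yper = radial_curve_period[OF \<sigma>]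
  \<comment> \<open>The partition continued periodically, to fit the cyclic form of
    \<open>no_alt\<close>.\<close>
  define A where "A i = t (i mod N) + 2 * pi * of_nat (i div N)" for i
  have Aper: "A (i + N) = A i + 2 * pi" for i using N by (simp add: A_def algebra_simps)
  have Astep: "A i \<le> A (Suc i)" for i
  proof (cases "Suc (i mod N) = N")
    case True
    then have "Suc i mod N = 0" "Suc i div N = Suc (i div N)" by (auto simp: mod_Suc div_Suc)
    moreover have "t (i mod N) \<le> t N" using t(3)[of "i mod N"] True N by simp
    ultimately show ?thesis using t by (simp add: A_def algebra_simps)
  next
    case False
    then have "Suc i mod N = Suc (i mod N)" "Suc i div N = i div N" by (auto simp: mod_Suc div_Suc)
    moreover have "Suc (i mod N) < N" using False N by (metis Suc_lessI mod_less_divisor)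
    ultimately show ?thesis using t(3)[of "i mod N"] by (simp add: A_def)
  qed
  have Amono: "A i \<le> A j" if "i \<le> j" for i j using lift_Suc_mono_le[of A i j, OF Astep that] .
  define v where "v i = ?Y (A i)" for i
  have na: "no_alt v N" unfolding v_def by (rule radial_curve_no_alt[where A = A, OF \<sigma> Amono Aper])
  have vper: "v (i + N) = v i" for i unfolding v_def Aper using Yper[of "A i" 1] by simp
  have vt: "v i = ?Y (t i)" if "i \<le> N" for i
  proof (cases "i = N")
    case True
    then show ?thesis using N Yper[of x 1] t by (simp add: v_def A_def)
  next
    case False
    then show ?thesis using that by (simp add: v_def A_def)
  qed
  have vK: "v i \<in> convex hull Q" for i
  proof -
    have "z0 + cis (\<sigma> * A i) \<noteq> z0" by simp
    then show ?thesis unfolding v_def using radial_frontier frontier_in_K Q by blast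
  qed
  have le: "(\<Sum>i<N. \<bar>cis s \<bullet> (v (Suc i) - v i)\<bar>) \<le> 2 * width Q s" for s
  proof -
    have "(\<Sum>i<N. \<bar>cis s \<bullet> v (Suc i) - cis s \<bullet> v i\<bar>) \<le> 2 * (Max ((\<lambda>x. cis s \<bullet> x) ` Q) - Min ((\<lambda>x. cis s \<bullet> x) ` Q))"
    proof (rule no_alternation_variation_le[of "\<lambda>i. cis s \<bullet> v i", OF _ N])
      show "cis s \<bullet> v (i + N) = cis s \<bullet> v i" for i by (simp add: vper)
    qed (use na inner_hull_bounds[OF Q(1) vK] in \<open>auto intro: no_altD[OF na]\<close>)
    then show ?thesis by (simp add: width_def inner_diff_right)
  qed
  have "crofton_const * (\<Sum>i<N. dist (v (Suc i)) (v i)) = integral {0..2*pi} (\<lambda>s. \<Sum>i<N. \<bar>cis s \<bullet> (v (Suc i) - v i)\<bar>)"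
    by (rule crofton_sum[symmetric])
  also have "\<dots> \<le> integral {0..2*pi} (\<lambda>s. 2 * width Q s)"
    by (rule Henstock_Kurzweil_Integration.integral_le)
      (use le in \<open>auto intro!: integrable_continuous_interval continuous_intros continuous_on_width Q Qne\<close>)
  finally have "(\<Sum>i<N. dist (v (Suc i)) (v i)) \<le> integral {0..2*pi} (\<lambda>s. 2 * width Q s) / crofton_const"
    using crofton_const_pos by (simp add: field_simps)
  moreover have "(\<Sum>i<N. ennreal (dist (?Y (t (Suc i))) (?Y (t i)))) = ennreal (\<Sum>i<N. dist (v (Suc i)) (v i))"
    by (subst sum_ennreal[symmetric]) (auto intro!: sum.cong simp: vt)
  ultimately show "(\<Sum>i<N. ennreal (dist (?Y (t (Suc i))) (?Y (t i)))) \<le> ennreal (integral {0..2*pi} (\<lambda>t. 2 * width Q t) / crofton_const)"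
    by (simp add: ennreal_leI)
qed

end

subsection \<open>A convex curve stays convex\<close>

lemma psum_nth: "psum d ws = (\<Sum>i<length ws - 1. d (ws ! i) (ws ! Suc i))"
proof (induction d ws rule: psum.induct)
  case (1 d p q rs)
  then show ?case by (simp add: sum.lessThan_Suc_shift del: sum.lessThan_Suc)
qed auto

lemma psum_append: "xs \<noteq> [] \<Longrightarrow> psum d (xs @ ys) = psum d xs + psum d (last xs # ys)"
proof (induction xs rule: induct_list012)
  case (3 x y zs)
  then show ?case by simp
qed auto

lemma cyc_psum_closed:
  assumes "r \<noteq> []"
  shows "psum dist (r @ [hd r]) = (\<Sum>i<length r. dist (cyc r (Suc i)) (cyc r i))"
proof -
  have "(r @ [hd r]) ! i = cyc r i" if "i \<le> length r" for i
    using that assms by (cases "i = length r") (auto simp: cyc_def nth_append hd_conv_nth)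
  then show ?thesis unfolding psum_nth by (simp add: dist_commute)
qed

text \<open>Pieces joined by \<open>tl\<close> describe the tour that starts at
  \<open>last r\<close>, whereas the closed curve starts at \<open>hd r\<close>; the length is the
  same.\<close>

lemma cyc_psum_closed':
  assumes "r \<noteq> []"
  shows "psum dist (last r # r) = (\<Sum>i<length r. dist (cyc r (Suc i)) (cyc r i))"
proof -
  have e: "(last r # r) ! i = cyc r (i + (length r - 1))" if "i \<le> length r" for i
  proof (cases i)
    case 0
    then show ?thesis using assms by (simp add: cyc_def last_conv_nth)
  next
    case (Suc k)
    then have "i + (length r - 1) = k + length r" using assms by (cases r) auto
    then show ?thesis using Suc that by (simp add: cyc_def)
  qed
  have "psum dist (last r # r) = (\<Sum>i<length r. dist (cyc r (Suc (i + (length r - 1)))) (cyc r (i + (length r - 1))))"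
  proof -
    have "psum dist (last r # r) = (\<Sum>i<length r. dist ((last r # r) ! i) ((last r # r) ! Suc i))"
      unfolding psum_nth by (simp del: nth_Cons_Suc)
    also have "\<dots> = (\<Sum>i<length r. dist (cyc r (Suc (i + (length r - 1)))) (cyc r (i + (length r - 1))))"
    proof (rule sum.cong[OF refl])
      fix i assume "i \<in> {..<length r}"
      then have i: "i \<le> length r" "Suc i \<le> length r" by auto
      show "dist ((last r # r) ! i) ((last r # r) ! Suc i) = dist (cyc r (Suc (i + (length r - 1)))) (cyc r (i + (length r - 1)))"
        unfolding e[OF i(1)] e[OF i(2)] add_Suc by (rule dist_commute)
    qed
    finally show ?thesis .
  qed
  also have "\<dots> = (\<Sum>i\<in>{length r - 1..<(length r - 1) + length r}. dist (cyc r (Suc i)) (cyc r i))"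
    by (rule sum.reindex_bij_witness[of _ "\<lambda>i. i - (length r - 1)" "\<lambda>i. i + (length r - 1)"]) auto
  also have "\<dots> = (\<Sum>i<length r. dist (cyc r (Suc i)) (cyc r i))"
    by (rule window_sum) (use cyc_add_length[of r] cyc_add_length[of r "Suc _"] in simp)
  finally show ?thesis .
qed

lemma chain_psum:
  assumes "ws \<noteq> []" "\<forall>w\<in>set ws. w \<noteq> []" "successively (\<lambda>v w. last v = hd w) ws"
  shows "psum d (hd (hd ws) # concat (map tl ws)) = sum_list (map (psum d) ws) \<and>
     last (hd (hd ws) # concat (map tl ws)) = last (last ws)"
  using assms
proof (induction ws rule: induct_list012)
  case (2 w)
  then have "hd w # tl w = w" by simp
  then show ?case by (metis (no_types, lifting) append_Nil2 concat.simps list.map list.sel(1) last.simps sum_list_simps add.right_neutral)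
next
  case (3 v w ws)
  have IH: "psum d (hd w # concat (map tl (w # ws))) = sum_list (map (psum d) (w # ws))"
     "last (hd w # concat (map tl (w # ws))) = last (last (w # ws))" using 3 by auto
  have v: "hd v # tl v = v" "v \<noteq> []" "last v = hd w" using 3 by auto
  have e: "hd (hd (v # w # ws)) # concat (map tl (v # w # ws)) = v @ concat (map tl (w # ws))"
    using v by (metis append_Cons concat.simps(2) list.map(2) list.sel(1))
  have "psum d (v @ concat (map tl (w # ws))) = psum d v + psum d (hd w # concat (map tl (w # ws)))"
    using psum_append[OF v(2)] v(3) by simp
  moreover have "last (v @ concat (map tl (w # ws))) = last (hd w # concat (map tl (w # ws)))"
    using v by (cases "concat (map tl (w # ws)) = []") auto
  ultimately show ?case unfolding e using IH by simp
qed simp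

lemma variation_chain:
  assumes "\<And>j. j < n \<Longrightarrow> b j \<le> b (Suc j)"
  shows "(\<Sum>j<n. variation f (b j) (b (Suc j))) \<le> variation f (b 0) (b n)"
  using assms
proof (induction n)
  case (Suc n)
  have "b 0 \<le> b n" using partition_mono[of n b 0 n] Suc.prems by simp
  moreover have "b n \<le> b (Suc n)" using Suc.prems by simp
  ultimately have "variation f (b 0) (b n) + variation f (b n) (b (Suc n)) \<le> variation f (b 0) (b (Suc n))"
    by (rule variation_superadd)
  moreover have "(\<Sum>j<n. variation f (b j) (b (Suc j))) \<le> variation f (b 0) (b n)" using Suc by simp
  ultimately show ?case by (auto intro: order_trans add_right_mono)
qed simp

text \<open>A convex curve \<open>vs\<close> around a core K of the next layer, seen from a point z0 inside K under
  the lifted angles \<open>a i\<close>. The radial projection of the shortcut curve onto the boundary of K is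
  homotopic to it and runs once around K.\<close>

locale convex_step =
  fixes P Q :: "complex set" and vs :: "complex list" and \<sigma> :: real and z0 :: complex and a :: "nat \<Rightarrow> real"
  assumes finP: "finite P" and Q: "P \<inter> convex hull Q = Q"
    and vs: "pcurve P vs" and vsQ: "set vs \<subseteq> Q" "Q \<subseteq> convex hull (set vs)"
    and na: "no_alt (cyc vs) (length vs)"
    and \<sigma>: "\<sigma> = 1 \<or> \<sigma> = -1" and ori: "oriented \<sigma> vs"
    and z0: "z0 \<in> interior (convex hull (peel Q))"
    and a: "\<And>i. ang z0 \<sigma> (cyc vs i) (a i)" "\<And>i. a i < a (Suc i)" "\<And>i. a (Suc i) < a i + pi"
      "\<And>i. a (i + length vs) = a i + 2 * pi"
begin

definition K :: "complex set" where "K = convex hull (peel Q)"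

definition Y :: "real \<Rightarrow> complex" where "Y t = radial K z0 (z0 + cis (\<sigma> * t))"

lemma ne: "vs \<noteq> []"
  using vs by (auto simp: pcurve_def)

lemma hull_eq: "convex hull (set vs) = convex hull Q"
  using vsQ by (metis hull_hull hull_mono subset_antisym)

lemma QP: "Q \<subseteq> P"
  using Q by auto

lemma finpeel: "finite (peel Q)"
  using finP QP peel_subset finite_subset by metis

lemma K_props: "convex K" "compact K" "z0 \<in> interior K" "K \<subseteq> convex hull Q" "peel Q \<subseteq> K" "closed K"
  using finpeel z0 peel_subset[of Q]
  by (auto simp: K_def finite_imp_compact_convex_hull compact_imp_closed hull_subset hull_mono)

lemma int_K: "interior K \<subseteq> interior (convex hull (set vs))"
  unfolding hull_eq using K_props(4) by (rule interior_mono)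

lemma int_ne: "interior (convex hull (set vs)) \<noteq> {}"
  using int_K K_props(3) by blast

lemma edge_not_interior:
  assumes "z \<in> closed_segment (cyc vs i) (cyc vs (Suc i))"
  shows "z \<notin> interior K"
proof
  assume "z \<in> interior K"
  then have "z \<in> interior (convex hull (set vs))" using int_K by blast
  then have "\<sigma> * cr (cyc vs (Suc i) - cyc vs i) (z - cyc vs i) > 0" by (rule oriented_interior[OF ori \<sigma> vs])
  moreover obtain t where "z = (1 - t) *\<^sub>R cyc vs i + t *\<^sub>R cyc vs (Suc i)" using assms by (auto simp: in_segment)
  then have "z - cyc vs i = t *\<^sub>R (cyc vs (Suc i) - cyc vs i)" by (simp add: algebra_simps)
  then have "cr (cyc vs (Suc i) - cyc vs i) (z - cyc vs i) = 0" by (simp only: cr_scale_right cr_self)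
  ultimately show False by simp
qed

lemma z0_sees: "sees \<sigma> z0 (cyc vs i) (cyc vs (Suc i))"
  unfolding sees_def using oriented_interior[OF ori \<sigma> vs] int_K K_props(3) by blast

text \<open>The last condition keeps the chord at a vertex outside \<open>K\<close> from reaching
  \<open>K\<close>.\<close>

definition good :: "real \<Rightarrow> bool" where
  "good eps \<longleftrightarrow> small_radius P eps \<and> (\<forall>l. sees \<sigma> z0 (sc_x vs eps l) (sc_y vs eps l)) \<and>
     (\<forall>v\<in>set vs. v \<notin> K \<longrightarrow> eps < infdist v K)"

lemma eventually_good: "\<forall>\<^sub>F eps in at_right 0. good eps"
proof -
  have Kne: "K \<noteq> {}" using K_props(3) interior_subset by blast
  have "\<forall>\<^sub>F eps in at_right 0. v \<notin> K \<longrightarrow> eps < infdist v K" for v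
  proof (cases "v \<in> K")
    case False
    then have "infdist v K > 0" using in_closed_iff_infdist_zero[OF K_props(6) Kne, of v] infdist_nonneg[of v K] by force
    from eventually_less_at_right_0[OF this, of 1] show ?thesis by simp
  qed simp
  then have "\<forall>\<^sub>F eps in at_right 0. \<forall>v\<in>set vs. v \<notin> K \<longrightarrow> eps < infdist v K"
    by (intro eventually_ball_finite) auto
  then show ?thesis unfolding good_def
    using eventually_small_radius[OF finP] eventually_sees_chord[OF vs z0_sees] by eventually_elim auto
qed

text \<open>Here the radial projection can only move points inwards to the frontier of
  \<open>K\<close>, never outwards.\<close>

definition B :: "complex set" where "B = convex hull Q - P - interior K"

lemma edge_B: "open_segment (cyc vs i) (cyc vs (Suc i)) \<subseteq> B"
  using edge_in_region[OF vs vsQ(1), of i] edge_not_interior open_closed_segment unfolding B_def by blast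

text \<open>An unnailed vertex is an extreme point, hence not in \<open>K\<close>, and its chord
  stays within \<open>eps\<close> of it.\<close>

lemma chord_B:
  assumes g: "good eps" and nn: "\<not> nailed vs (Suc k)"
  shows "closed_segment (sc_x vs eps (Suc k)) (sc_y vs eps (Suc k)) \<subseteq> B"
proof
  fix z assume z: "z \<in> closed_segment (sc_x vs eps (Suc k)) (sc_y vs eps (Suc k))"
  have sr: "small_radius P eps" "eps > 0" using g by (auto simp: good_def small_radius_def)
  have "cyc vs (Suc k) \<notin> K"
    using unnailed_extreme[OF vs na int_ne nn] extreme_notin_hull_peel unfolding hull_eq K_def by blast
  then have "eps < infdist (cyc vs (Suc k)) K" using g cyc_in_set[OF ne] unfolding good_def by blast
  moreover have "dist z (cyc vs (Suc k)) \<le> eps" by (rule chord_near[OF z sr(2)])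
  moreover have "infdist (cyc vs (Suc k)) K \<le> dist (cyc vs (Suc k)) z" if "z \<in> K" using that by (rule infdist_le)
  ultimately have "z \<notin> K" by (auto simp: dist_commute)
  then show "z \<in> B" unfolding B_def
    using chord_in_region[OF vs vsQ(1) sr(1) nn] z interior_subset by blast
qed

lemma Y_variation: "variation Y x (x + 2 * pi) \<le> ennreal (integral {0..2*pi} (\<lambda>t. 2 * width (peel Q) t) / crofton_const)"
  unfolding Y_def by (rule radial_curve_variation[OF K_props(1-3) \<sigma> finpeel K_def])

lemma radial_Y: "ang z0 \<sigma> z t \<Longrightarrow> radial K z0 z = Y t"
  unfolding Y_def by (rule radial_ang[OF K_props(1-3)])

text \<open>The cut points \<open>sc_y\<close> at \<open>k\<close> and \<open>sc_x\<close> at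
  \<open>Suc k\<close> lie on the same edge, which confines their angles. Across a chord this alone
  allows almost a full turn; the bound \<open>pi\<close> follows because \<open>z0\<close> sees the
  chord.\<close>

lemma sc_angles:
  assumes g: "good eps"
  obtains bx yb where
    "\<And>k. a k \<le> bx (Suc k) \<and> bx (Suc k) \<le> a (Suc k) \<and> ang z0 \<sigma> (sc_x vs eps (Suc k)) (bx (Suc k))"
    "\<And>k. a k \<le> yb k \<and> yb k \<le> a (Suc k) \<and> ang z0 \<sigma> (sc_y vs eps k) (yb k)"
    "\<And>k. yb k \<le> bx (Suc k)" "\<And>k. yb (Suc k) < bx (Suc k) + pi"
proof -
  have sr: "small_radius P eps" using g by (simp add: good_def)
  note se = ang_segment[OF \<sigma> a(1) a(1) less_imp_le[OF a(2)] a(3)]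
  have "\<exists>c\<in>{a k..a (Suc k)}. ang z0 \<sigma> (sc_x vs eps (Suc k)) c" for k
    by (rule se) (use sc_x_in_edge[OF vs sr, of k] open_closed_segment in blast)
  then have "\<exists>f. \<forall>k. f k \<in> {a k..a (Suc k)} \<and> ang z0 \<sigma> (sc_x vs eps (Suc k)) (f k)" by metis
  then obtain bx0 where bx0: "\<And>k. bx0 k \<in> {a k..a (Suc k)} \<and> ang z0 \<sigma> (sc_x vs eps (Suc k)) (bx0 k)" by blast
  define bx where "bx k = bx0 (k - 1)" for k
  have bx: "bx (Suc k) = bx0 k" for k by (simp add: bx_def)
  have "\<exists>c\<in>{a k..a (Suc k)}. ang z0 \<sigma> (sc_y vs eps k) c" for k
    by (rule se) (use sc_y_in_edge[OF vs sr, of k] open_closed_segment in blast)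
  then have "\<exists>f. \<forall>k. f k \<in> {a k..a (Suc k)} \<and> ang z0 \<sigma> (sc_y vs eps k) (f k)" by metis
  then obtain yb where yb: "\<And>k. yb k \<in> {a k..a (Suc k)} \<and> ang z0 \<sigma> (sc_y vs eps k) (yb k)" by blast
  show thesis
  proof (rule that[of bx yb])
    fix k
    show "a k \<le> bx (Suc k) \<and> bx (Suc k) \<le> a (Suc k) \<and> ang z0 \<sigma> (sc_x vs eps (Suc k)) (bx (Suc k))"
      using bx0[of k] unfolding bx by auto
    show "a k \<le> yb k \<and> yb k \<le> a (Suc k) \<and> ang z0 \<sigma> (sc_y vs eps k) (yb k)" using yb[of k] by auto
    show "yb k \<le> bx (Suc k)"
    proof (rule ang_mono_aux[OF \<sigma>])
      show "ang z0 \<sigma> (sc_y vs eps k) (yb k)" using yb by blast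
      show "ang z0 \<sigma> (sc_x vs eps (Suc k)) (bx (Suc k))" using bx0[of k] unfolding bx by blast
      show "\<bar>yb k - bx (Suc k)\<bar> < pi" using yb[of k] bx0[of k] a(3)[of k] unfolding bx by auto
      have "sees \<sigma> z0 (sc_y vs eps k) (sc_x vs eps (Suc k))" by (rule sees_edge(2)[OF vs sr z0_sees])
      then show "0 \<le> \<sigma> * cr (sc_y vs eps k - z0) (sc_x vs eps (Suc k) - z0)"
        unfolding sees_def cr_triangle by simp
    qed
    show "yb (Suc k) < bx (Suc k) + pi"
    proof (rule ccontr)
      assume "\<not> yb (Suc k) < bx (Suc k) + pi"
      then have ge: "yb (Suc k) - bx (Suc k) \<ge> pi" by simp
      have "yb (Suc k) - bx (Suc k) < 2 * pi"
        using yb[of "Suc k"] bx0[of k] a(3)[of k] a(3)[of "Suc k"] unfolding bx by auto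
      then have "sin (yb (Suc k) - bx (Suc k) - pi) \<ge> 0" using ge by (intro sin_ge_zero) auto
      then have s: "sin (yb (Suc k) - bx (Suc k)) \<le> 0" by (simp add: sin_diff)
      have ax: "ang z0 \<sigma> (sc_x vs eps (Suc k)) (bx (Suc k))" using bx0[of k] unfolding bx by blast
      have ay: "ang z0 \<sigma> (sc_y vs eps (Suc k)) (yb (Suc k))" using yb by blast
      have "sees \<sigma> z0 (sc_x vs eps (Suc k)) (sc_y vs eps (Suc k))" using g unfolding good_def by blast
      then have "\<sigma> * cr (sc_x vs eps (Suc k) - z0) (sc_y vs eps (Suc k) - z0) > 0" unfolding sees_def cr_triangle .
      then have "norm (sc_x vs eps (Suc k) - z0) * norm (sc_y vs eps (Suc k) - z0) * sin (yb (Suc k) - bx (Suc k)) > 0"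
        unfolding ang_cr[OF \<sigma> ax ay] .
      moreover have "norm (sc_x vs eps (Suc k) - z0) * norm (sc_y vs eps (Suc k) - z0) * sin (yb (Suc k) - bx (Suc k)) \<le> 0"
        using s by (intro mult_nonneg_nonpos) auto
      ultimately show False by simp
    qed
  qed
qed

lemma map_fst_interleave: "map fst (interleave f g m n) = interleave (\<lambda>l. fst (f l)) (\<lambda>l. fst (g l)) m n"
  by (induction n) (auto simp: interleave_def)

lemma set_interleave: "set (interleave f g m n) = f ` {m..<n} \<union> g ` {m..<n}"
  by (auto simp: interleave_def)

lemma piece_angle:
  assumes g: "good eps" and j: "j < length (nailed_idx vs)"
  obtains \<alpha> where "mono_on {0..1} \<alpha>" "\<alpha> 0 = a (piece_start vs j)" "\<alpha> 1 = a (piece_end vs j)"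
    "\<And>t. t \<in> {0..1} \<Longrightarrow> ang z0 \<sigma> (polypath (shortcut_piece vs eps j) t) (\<alpha> t)"
proof -
  obtain bx yb where b:
    "\<And>k. a k \<le> bx (Suc k) \<and> bx (Suc k) \<le> a (Suc k) \<and> ang z0 \<sigma> (sc_x vs eps (Suc k)) (bx (Suc k))"
    "\<And>k. a k \<le> yb k \<and> yb k \<le> a (Suc k) \<and> ang z0 \<sigma> (sc_y vs eps k) (yb k)"
    "\<And>k. yb k \<le> bx (Suc k)" "\<And>k. yb (Suc k) < bx (Suc k) + pi"
    by (rule sc_angles[OF g]) (rule that)
  let ?s = "piece_start vs j" and ?e = "piece_end vs j"
  define f where "f l = (sc_x vs eps l, bx l)" for l
  define h where "h l = (sc_y vs eps l, yb l)" for l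
  let ?zs = "(cyc vs ?s, a ?s) # interleave f h (Suc ?s) ?e @ [(cyc vs ?e, a ?e)]"
  have m: "map fst ?zs = shortcut_piece vs eps j"
    by (simp add: shortcut_piece_eq map_fst_interleave f_def h_def)
  let ?R = "\<lambda>x y. snd x \<le> snd y \<and> snd y < snd x + pi"
  have succ: "successively ?R ?zs"
  proof (rule wrap_successively[OF piece_props(1)[OF j]])
    fix l assume "?s < l"
    then obtain k where k: "l = Suc k" by (cases l) auto
    show "?R (f l) (h l)" unfolding k f_def h_def using b(1)[of k] b(2)[of "Suc k"] b(4)[of k] by auto
    show "?R (h l) (f (Suc l))" unfolding f_def h_def using b(1)[of l] b(2)[of l] b(3)[of l] a(3)[of l] by auto
  next
    show "?R (cyc vs ?s, a ?s) (cyc vs ?e, a ?e)" if "?e = Suc ?s" using a(2,3)[of ?s] that by auto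
    show "?R (cyc vs ?s, a ?s) (f (Suc ?s))" unfolding f_def using b(1)[of ?s] a(3)[of ?s] by auto
    show "?R (h (?e - 1)) (cyc vs ?e, a ?e)" if "Suc ?s < ?e"
      unfolding h_def using b(2)[of "?e - 1"] a(3)[of "?e - 1"] that by auto
  qed
  have "\<forall>x\<in>set ?zs. ang z0 \<sigma> (fst x) (snd x)"
  proof -
    have "ang z0 \<sigma> (sc_x vs eps l) (bx l)" if "Suc ?s \<le> l" for l using b(1)[of "l - 1"] that by (cases l) auto
    then show ?thesis using a(1) b(2) by (auto simp: set_interleave f_def h_def)
  qed
  then have "\<exists>\<alpha>. mono_on {0..1} \<alpha> \<and> \<alpha> 0 = snd (hd ?zs) \<and> \<alpha> 1 = snd (last ?zs) \<and>
    (\<forall>t\<in>{0..1}. ang z0 \<sigma> (polypath (map fst ?zs) t) (\<alpha> t))"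
    by (intro ang_polypath[OF \<sigma> _ _ succ]) auto
  then show thesis unfolding m using that by auto
qed

lemma closed_angle:
  assumes g: "good eps"
  obtains \<alpha> where "mono_on {0..1} \<alpha>" "\<alpha> 1 = \<alpha> 0 + 2 * pi"
    "\<And>t. t \<in> {0..1} \<Longrightarrow> ang z0 \<sigma> (closed_poly (shortcut_closed vs eps) t) (\<alpha> t)"
proof -
  obtain bx yb where b:
    "\<And>k. a k \<le> bx (Suc k) \<and> bx (Suc k) \<le> a (Suc k) \<and> ang z0 \<sigma> (sc_x vs eps (Suc k)) (bx (Suc k))"
    "\<And>k. a k \<le> yb k \<and> yb k \<le> a (Suc k) \<and> ang z0 \<sigma> (sc_y vs eps k) (yb k)"
    "\<And>k. yb k \<le> bx (Suc k)" "\<And>k. yb (Suc k) < bx (Suc k) + pi"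
    by (rule sc_angles[OF g]) (rule that)
  let ?M = "length vs"
  \<comment> \<open>The angles are taken one period later, because \<open>bx\<close> is controlled
    at successor indices only.\<close>
  define f where "f l = (sc_x vs eps l, bx (l + ?M))" for l
  define h where "h l = (sc_y vs eps l, yb (l + ?M))" for l
  let ?zs = "interleave f h 0 ?M @ [f ?M]"
  have M: "0 < ?M" using ne by simp
  have xM: "sc_x vs eps ?M = sc_x vs eps 0" using sc_x_add_length[OF ne, of eps 0] by simp
  have m: "map fst ?zs = interleave (sc_x vs eps) (sc_y vs eps) 0 ?M @ [sc_x vs eps 0]"
    by (simp add: map_fst_interleave f_def h_def xM)
  let ?R = "\<lambda>x y. snd x \<le> snd y \<and> snd y < snd x + pi"
  have succ: "successively ?R ?zs"
  proof (rule closed_successively[OF M])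
    fix l
    obtain k where k: "l + ?M = Suc k" using M by (cases "l + ?M") auto
    show "?R (f l) (h l)" unfolding f_def h_def k using b(1)[of k] b(2)[of "Suc k"] b(4)[of k] by auto
    show "?R (h l) (f (Suc l))" unfolding f_def h_def
      using b(1)[of "l + ?M"] b(2)[of "l + ?M"] b(3)[of "l + ?M"] a(3)[of "l + ?M"] by auto
  qed simp
  have angx: "ang z0 \<sigma> (sc_x vs eps l) (bx (l + ?M))" for l
  proof -
    obtain k where k: "l + ?M = Suc k" using M by (cases "l + ?M") auto
    have "ang z0 \<sigma> (sc_x vs eps (l + ?M)) (bx (l + ?M))" unfolding k using b(1)[of k] by blast
    then show ?thesis by (simp add: sc_x_add_length[OF ne])
  qed
  have angy: "ang z0 \<sigma> (sc_y vs eps l) (yb (l + ?M))" for l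
    using b(2)[of "l + ?M"] by (simp add: sc_y_add_length)
  have "\<forall>x\<in>set ?zs. ang z0 \<sigma> (fst x) (snd x)"
    using angx angy by (auto simp: set_interleave f_def h_def)
  moreover have "2 \<le> length ?zs"
    using interleave_props(1)[OF M, of f h] by (cases "interleave f h 0 ?M") auto
  ultimately have "\<exists>\<alpha>. mono_on {0..1} \<alpha> \<and> \<alpha> 0 = snd (hd ?zs) \<and> \<alpha> 1 = snd (last ?zs) \<and>
    (\<forall>t\<in>{0..1}. ang z0 \<sigma> (polypath (map fst ?zs) t) (\<alpha> t))"
    by (intro ang_polypath[OF \<sigma> _ _ succ])
  then obtain \<alpha> where \<alpha>: "mono_on {0..1} \<alpha>" "\<alpha> 0 = bx ?M" "\<alpha> 1 = bx (?M + ?M)"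
     "\<And>t. t \<in> {0..1} \<Longrightarrow> ang z0 \<sigma> (closed_poly (shortcut_closed vs eps) t) (\<alpha> t)"
    unfolding m closed_poly_shortcut_closed[OF ne] using interleave_props[OF M, of f h] by (auto simp: f_def)
  \<comment> \<open>Both sides are angles of the same point in a common window shorter than
    \<open>pi\<close>, so they agree.\<close>
  have "bx (?M + ?M) = bx ?M + 2 * pi"
  proof -
    obtain k where k: "?M = Suc k" using M by (cases ?M) auto
    have 1: "ang z0 \<sigma> (sc_x vs eps ?M) (bx ?M + 2 * pi)"
      using angx[of 0] ang_shift[OF \<sigma>, of z0 "sc_x vs eps 0" "bx ?M" 1] xM by simp
    have 2: "ang z0 \<sigma> (sc_x vs eps ?M) (bx (?M + ?M))" by (rule angx)
    have i1: "a k \<le> bx ?M" "bx ?M \<le> a ?M" using b(1)[of k] k by auto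
    have i2: "a (k + ?M) \<le> bx (?M + ?M)" "bx (?M + ?M) \<le> a (?M + ?M)" using b(1)[of "k + ?M"] k by auto
    have a2: "a (k + ?M) = a k + 2 * pi" "a (?M + ?M) = a ?M + 2 * pi" by (rule a(4))+
    have a3: "a ?M < a k + pi" using a(3)[of k] k by simp
    show ?thesis
    proof (rule antisym)
      show "bx (?M + ?M) \<le> bx ?M + 2 * pi" by (rule ang_mono_aux[OF \<sigma> 2 1]) (use i1 i2 a2 a3 in auto)
      show "bx ?M + 2 * pi \<le> bx (?M + ?M)" by (rule ang_mono_aux[OF \<sigma> 1 2]) (use i1 i2 a2 a3 in auto)
    qed
  qed
  then show thesis using that[of \<alpha>] \<alpha> by simp
qed

lemma radial_path:
  assumes "path g" "z0 \<notin> path_image g"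
  shows "path (radial K z0 \<circ> g)"
  using assms radial_continuous[OF K_props(1-3)] unfolding path_def path_image_def
  by (metis (no_types, lifting) continuous_on_compose continuous_on_subset image_subset_iff ComplI singletonD subsetI)

lemma radial_segment_avoids:
  assumes "z \<in> B" "0 \<le> s" "s < 1"
  shows "(1 - s) *\<^sub>R z + s *\<^sub>R radial K z0 z \<notin> P"
proof (rule segment_to_core_avoids[OF Q K_props(4,5) _ _ _ assms(2,3)])
  have z: "z \<in> convex hull Q" "z \<notin> P" "z \<notin> interior K" using assms by (auto simp: B_def)
  then show "z \<in> convex hull Q" "z \<notin> P" by auto
  have "z \<noteq> z0" using z K_props(3) by auto
  then show "radial K z0 z \<in> K" using radial_frontier[OF K_props(1-3)] frontier_in_K[OF K_props(1-3)] by blast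
  show "z = radial K z0 z \<or> (1 - s) *\<^sub>R z + s *\<^sub>R radial K z0 z \<notin> K"
    by (rule radial_out[OF K_props(1-3) z(3) assms(2,3)])
qed

lemma radial_homotopy_continuous:
  assumes "path g" "z0 \<notin> path_image g"
  shows "continuous_on ({0..1} \<times> {0..1}) (\<lambda>(s::real, t). (1 - s) *\<^sub>R g t + s *\<^sub>R radial K z0 (g t))"
proof -
  have "continuous_on {0..1} (radial K z0 \<circ> g)" using radial_path[OF assms] by (simp add: path_def)
  then have 1: "continuous_on ({0..1} \<times> {0..1}) (\<lambda>x::real\<times>real. (radial K z0 \<circ> g) (snd x))"
    by (rule continuous_on_compose2) (auto intro: continuous_intros)
  have 2: "continuous_on ({0..1} \<times> {0..1}) (\<lambda>x::real\<times>real. g (snd x))"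
    using assms(1) unfolding path_def by (rule continuous_on_compose2) (auto intro: continuous_intros)
  show ?thesis unfolding case_prod_beta
    using 1 2 by (intro continuous_intros) (auto simp: o_def)
qed

text \<open>The radial projection of the shortcut piece is a competitor for \<open>h\<close>, and it
  is no longer than the boundary arc swept by its monotone angle. Its ends stay fixed: a nailed
  vertex belongs to \<open>K\<close> but, lying on an edge, not to the interior of
  \<open>K\<close>.\<close>

lemma piece_length:
  assumes j: "j < length (nailed_idx vs)"
    and sh: "\<forall>\<^sub>F eps in at_right 0. shortest_homotopic_path P (polypath (shortcut_piece vs eps j)) h"
  shows "path_length h \<le> variation Y (a (piece_start vs j)) (a (piece_end vs j))"
proof -
  obtain eps where eps: "good eps" "shortest_homotopic_path P (polypath (shortcut_piece vs eps j)) h"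
    using eventually_happens'[OF _ eventually_conj[OF eventually_good sh]] by (auto simp: trivial_limit_at_right_real)
  let ?g = "polypath (shortcut_piece vs eps j)"
  have sr: "small_radius P eps" using eps by (simp add: good_def)
  obtain \<alpha> where \<alpha>: "mono_on {0..1} \<alpha>" "\<alpha> 0 = a (piece_start vs j)" "\<alpha> 1 = a (piece_end vs j)"
    "\<And>t. t \<in> {0..1} \<Longrightarrow> ang z0 \<sigma> (?g t) (\<alpha> t)" using piece_angle[OF eps(1) j] by metis
  have ends: "?g 0 = cyc vs (piece_start vs j)" "?g 1 = cyc vs (piece_end vs j)"
    using polypath_ends[of "shortcut_piece vs eps j"] by (auto simp: shortcut_piece_eq pathstart_def pathfinish_def)
  have "?g t \<noteq> z0" if "t \<in> {0..1}" for t using \<alpha>(4)[OF that] by (simp add: ang_def)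
  then have zg: "z0 \<notin> path_image ?g" unfolding path_image_def by blast
  have gB: "?g t \<in> B" if "t \<in> {0<..<1}" for t
    by (rule shortcut_piece_interior[OF vs sr j edge_B chord_B[OF eps(1)]]) (use that in auto)
  have rfix: "radial K z0 (cyc vs i) = cyc vs i" if "nailed vs i" for i
  proof (rule radial_fix[OF K_props(1-3)])
    have "cyc vs i \<in> K" using nailed_in_peel[OF vs vsQ(1) that] K_props(5) by blast
    moreover have "cyc vs i \<notin> interior K" using edge_not_interior[of "cyc vs i" i] by simp
    ultimately show "cyc vs i \<in> frontier K" using K_props(6) by (simp add: frontier_def closure_closed)
  qed
  note pp = piece_props[OF j]
  let ?H = "\<lambda>(s::real, t). (1 - s) *\<^sub>R ?g t + s *\<^sub>R radial K z0 (?g t)"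
  have "homotopic_paths_obst P ?g (radial K z0 \<circ> ?g)"
    unfolding homotopic_paths_obst_def
  proof (intro exI[of _ ?H] conjI ballI)
    show "continuous_on ({0..1} \<times> {0..1}) ?H" by (rule radial_homotopy_continuous[OF path_polypath zg])
    show "?H (s, 0) = ?g 0" "?H (s, 1) = ?g 1" for s
      unfolding prod.case ends rfix[OF pp(2)] rfix[OF pp(3)] by (simp_all flip: scaleR_add_left)
    show "?H (s, t) \<notin> P" if "s \<in> {0..<1}" "t \<in> {0<..<1}" for s t
      using radial_segment_avoids[OF gB[OF that(2)], of s] that by simp
  qed auto
  moreover have "path (radial K z0 \<circ> ?g)" by (rule radial_path[OF path_polypath zg])
  ultimately have "path_length h \<le> path_length (radial K z0 \<circ> ?g)" using eps(2) by (simp add: shortest_homotopic_path_def)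
  also have "\<dots> \<le> variation Y (\<alpha> 0) (\<alpha> 1)" unfolding path_length_variation
    by (rule variation_reparam_le[OF _ \<alpha>(1)]) (use radial_Y[OF \<alpha>(4)] in simp)
  finally show ?thesis unfolding \<alpha> .
qed

lemma loop_length:
  assumes n: "nailed_idx vs = []"
    and sh: "\<forall>\<^sub>F eps in at_right 0. shortest_homotopic_loop P (closed_poly (shortcut_closed vs eps)) h"
  shows "\<exists>x. path_length h \<le> variation Y x (x + 2 * pi)"
proof -
  obtain eps where eps: "good eps" "shortest_homotopic_loop P (closed_poly (shortcut_closed vs eps)) h"
    using eventually_happens'[OF _ eventually_conj[OF eventually_good sh]] by (auto simp: trivial_limit_at_right_real)
  let ?g = "closed_poly (shortcut_closed vs eps)"
  have sr: "small_radius P eps" using eps by (simp add: good_def)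
  obtain \<alpha> where \<alpha>: "mono_on {0..1} \<alpha>" "\<alpha> 1 = \<alpha> 0 + 2 * pi"
    "\<And>t. t \<in> {0..1} \<Longrightarrow> ang z0 \<sigma> (?g t) (\<alpha> t)" using closed_angle[OF eps(1)] by metis
  have "?g t \<noteq> z0" if "t \<in> {0..1}" for t using \<alpha>(3)[OF that] by (simp add: ang_def)
  then have zg: "z0 \<notin> path_image ?g" unfolding path_image_def by blast
  have pg: "path ?g" unfolding closed_poly_def by (rule path_polypath)
  have "path_image ?g \<subseteq> B" by (rule shortcut_closed_subset[OF vs sr n edge_B chord_B[OF eps(1)]])
  then have gB: "?g t \<in> B" if "t \<in> {0..1}" for t using imageI[OF that, of ?g] unfolding path_image_def by blast
  have "interleave (sc_x vs eps) (sc_y vs eps) 0 (length vs) @ [sc_x vs eps 0] \<noteq> []" by simp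
  from polypath_ends[OF this] have "?g 1 = ?g 0"
    unfolding closed_poly_shortcut_closed[OF ne] pathstart_def pathfinish_def
    using interleave_props(1,2)[of 0 "length vs" "sc_x vs eps" "sc_y vs eps"] ne by (simp add: hd_append)
  let ?H = "\<lambda>(s::real, t). (1 - s) *\<^sub>R ?g t + s *\<^sub>R radial K z0 (?g t)"
  have "homotopic_loops_obst P ?g (radial K z0 \<circ> ?g)"
    unfolding homotopic_loops_obst_def
  proof (intro exI[of _ ?H] conjI ballI)
    show "continuous_on ({0..1} \<times> {0..1}) ?H" by (rule radial_homotopy_continuous[OF pg zg])
    show "?H (s, 0) = ?H (s, 1)" for s using \<open>?g 1 = ?g 0\<close> by simp
    show "?H (s, t) \<notin> P" if "s \<in> {0..<1}" "t \<in> {0..1}" for s t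
      using radial_segment_avoids[OF gB[OF that(2)], of s] that by simp
  qed auto
  moreover have "path (radial K z0 \<circ> ?g)" by (rule radial_path[OF pg zg])
  moreover have "pathfinish (radial K z0 \<circ> ?g) = pathstart (radial K z0 \<circ> ?g)"
    using \<open>?g 1 = ?g 0\<close> by (simp add: pathstart_def pathfinish_def)
  ultimately have "path_length h \<le> path_length (radial K z0 \<circ> ?g)" using eps(2) by (simp add: shortest_homotopic_loop_def)
  also have "\<dots> \<le> variation Y (\<alpha> 0) (\<alpha> 1)" unfolding path_length_variation
    by (rule variation_reparam_le[OF _ \<alpha>(1)]) (use radial_Y[OF \<alpha>(3)] in simp)
  finally show ?thesis unfolding \<alpha> by blast
qed

text \<open>The arcs belonging to the pieces follow each other and make up exactly one turn.\<close>

lemma step_length: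
  assumes st: "hcs_step P vs r" and r: "r \<noteq> []"
  shows "\<exists>x. ennreal (\<Sum>i<length r. dist (cyc r (Suc i)) (cyc r i)) \<le> variation Y x (x + 2 * pi)"
proof (cases "nailed_idx vs = []")
  case True
  have "\<forall>\<^sub>F eps in at_right 0. shortest_homotopic_loop P (closed_poly (shortcut_closed vs eps)) (closed_poly r)"
    using st True by (simp add: hcs_step_def)
  from loop_length[OF True this] show ?thesis
    by (simp add: closed_poly_def path_length_polypath cyc_psum_closed[OF r])
next
  case False
  obtain ws where ws: "length ws = length (nailed_idx vs)" "r = concat (map tl ws)"
    "\<And>j. j < length ws \<Longrightarrow> ppath P (ws ! j) \<or> length (ws ! j) = 1"
    "\<And>j. j < length ws \<Longrightarrow> hd (ws ! j) = cyc vs (piece_start vs j)"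
    "\<And>j. j < length ws \<Longrightarrow> last (ws ! j) = cyc vs (piece_end vs j)"
    "\<And>j. j < length ws \<Longrightarrow> \<forall>\<^sub>F eps in at_right 0.
        shortest_homotopic_path P (polypath (shortcut_piece vs eps j)) (polypath (ws ! j))"
    using hcs_step_pieces[OF st False] by blast
  obtain k where k: "length ws = Suc k" using ws(1) False by (cases ws) auto
  have wne: "ws ! j \<noteq> []" if "j < length ws" for j using ws(3)[OF that] by (auto simp: ppath_def)
  have wsne: "ws \<noteq> []" using k by auto
  have nxt: "last (ws ! j) = hd (ws ! Suc j)" if "Suc j < length ws" for j
    using ws(4)[of "Suc j"] ws(5)[of j] that ws(1) by (simp add: piece_end_def piece_start_def)
  have "successively (\<lambda>v w. last v = hd w) ws"
    unfolding successively_conv_nth using nxt by simp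
  moreover have "\<forall>w\<in>set ws. w \<noteq> []" using wne by (auto simp: in_set_conv_nth)
  ultimately have ps: "psum dist (hd (hd ws) # r) = sum_list (map (psum dist) ws)" "last (hd (hd ws) # r) = last (last ws)"
    using chain_psum[OF wsne] unfolding ws(2) by auto
  have "last (last ws) = hd (hd ws)"
    using ws(4)[of 0] ws(5)[of k] k ws(1) wsne
    by (simp add: piece_end_def piece_start_def cyc_add_length last_conv_nth hd_conv_nth)
  then have lr: "last r = hd (hd ws)" using ps(2) r by simp
  \<comment> \<open>The angles at the nailed vertices, closed by the first of them one turn
    later.\<close>
  define b where "b j = (if j \<le> k then a (piece_start vs j) else a (piece_start vs 0) + 2 * pi)" for j
  have be: "b (Suc j) = a (piece_end vs j)" if "j \<le> k" for j
    using that k ws(1) by (auto simp: b_def piece_end_def piece_start_def a(4))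
  have amono: "i \<le> l \<Longrightarrow> a i \<le> a l" for i l
    using lift_Suc_mono_le[of a i l] a(2) less_imp_le by blast
  have "ennreal (\<Sum>i<length r. dist (cyc r (Suc i)) (cyc r i)) = ennreal (sum_list (map (psum dist) ws))"
    unfolding cyc_psum_closed'[OF r, symmetric] lr ps(1) ..
  also have "sum_list (map (psum dist) ws) = (\<Sum>j<Suc k. psum dist (ws ! j))"
    using k by (simp add: sum_list_sum_nth atLeast0LessThan)
  also have "ennreal (\<Sum>j<Suc k. psum dist (ws ! j)) = (\<Sum>j<Suc k. path_length (polypath (ws ! j)))"
    unfolding path_length_polypath by (rule sum_ennreal[symmetric]) (simp add: psum_nonneg)
  also have "\<dots> \<le> (\<Sum>j<Suc k. variation Y (b j) (b (Suc j)))"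
  proof (rule sum_mono)
    fix j assume j: "j \<in> {..<Suc k}"
    then have "path_length (polypath (ws ! j)) \<le> variation Y (a (piece_start vs j)) (a (piece_end vs j))"
      using ws(1) k by (intro piece_length ws(6)) auto
    then show "path_length (polypath (ws ! j)) \<le> variation Y (b j) (b (Suc j))" using be[of j] j by (simp add: b_def)
  qed
  also have "\<dots> \<le> variation Y (b 0) (b (Suc k))"
  proof (rule variation_chain)
    fix j assume j: "j < Suc k"
    then have "piece_start vs j \<le> piece_end vs j" using piece_props(1)[of j vs] ws(1) k by simp
    then show "b j \<le> b (Suc j)" using be[of j] j amono by (simp add: b_def)
  qed
  finally show ?thesis unfolding b_def by auto
qed

lemma step_no_alt:
  assumes st: "hcs_step P vs r" and r: "pcurve P r" and cov: "peel Q \<subseteq> convex hull (set r)"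
  shows "no_alt (cyc r) (length r)"
proof (rule short_tour_no_alt[OF _ finpeel _ cov])
  show rne: "r \<noteq> []" using r by (auto simp: pcurve_def)
  show "set r \<subseteq> peel Q" by (rule hcs_step_in_peel[OF finP Q st vsQ(1) r])
  obtain x where x: "ennreal (\<Sum>i<length r. dist (cyc r (Suc i)) (cyc r i)) \<le> variation Y x (x + 2 * pi)"
    using step_length[OF st rne] by blast
  \<comment> \<open>\<open>ennreal\<close> sends negative numbers to 0, so the bound is read back
    for reals when its right side is nonnegative; the other case makes the length at most 0, against
    two distinct consecutive vertices.\<close>
  have "integral {0..2*pi} (\<lambda>t. 2 * width (peel Q) t) / crofton_const \<ge> 0 \<or>
     (\<Sum>i<length r. dist (cyc r (Suc i)) (cyc r i)) \<le> 0"
  proof (rule disjCI)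
    assume "\<not> (\<Sum>i<length r. dist (cyc r (Suc i)) (cyc r i)) \<le> 0"
    then have pos: "ennreal (\<Sum>i<length r. dist (cyc r (Suc i)) (cyc r i)) > 0" by simp
    show "integral {0..2*pi} (\<lambda>t. 2 * width (peel Q) t) / crofton_const \<ge> 0"
    proof (rule ccontr)
      assume "\<not> integral {0..2*pi} (\<lambda>t. 2 * width (peel Q) t) / crofton_const \<ge> 0"
      then have z: "ennreal (integral {0..2*pi} (\<lambda>t. 2 * width (peel Q) t) / crofton_const) = 0"
        by (intro ennreal_neg) linarith
      show False using order_trans[OF x Y_variation] pos unfolding z by simp
    qed
  qed
  then have "(\<Sum>i<length r. dist (cyc r (Suc i)) (cyc r i)) \<le> integral {0..2*pi} (\<lambda>t. 2 * width (peel Q) t) / crofton_const"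
  proof
    assume "integral {0..2*pi} (\<lambda>t. 2 * width (peel Q) t) / crofton_const \<ge> 0"
    then show ?thesis using order_trans[OF x Y_variation] by (simp add: ennreal_le_iff)
  next
    assume le: "(\<Sum>i<length r. dist (cyc r (Suc i)) (cyc r i)) \<le> 0"
    have "dist (cyc r (Suc 0)) (cyc r 0) \<le> (\<Sum>i<length r. dist (cyc r (Suc i)) (cyc r i))"
      using rne by (intro member_le_sum) auto
    then have "dist (cyc r (Suc 0)) (cyc r 0) \<le> 0" using le by (rule order_trans)
    then show ?thesis using pcurve_edge(2)[OF r, of 0] by simp
  qed
  then show "crofton_const * (\<Sum>i<length r. dist (cyc r (Suc i)) (cyc r i)) \<le> integral {0..2*pi} (\<lambda>t. 2 * width (peel Q) t)"
    using crofton_const_pos by (simp add: field_simps)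
qed

end

lemma hcs_step_no_alt:
  assumes P: "finite P" and Q: "P \<inter> convex hull Q = Q" and st: "hcs_step P vs r" "set vs \<subseteq> Q" "Q \<subseteq> convex hull (set vs)"
    and na: "no_alt (cyc vs) (length vs)" and int: "interior (convex hull (peel Q)) \<noteq> {}"
    and r: "pcurve P r" and cov: "peel Q \<subseteq> convex hull (set r)"
  shows "no_alt (cyc r) (length r)"
proof -
  have vs: "pcurve P vs" using st by (simp add: hcs_step_def)
  obtain z0 where z0: "z0 \<in> interior (convex hull (peel Q))" using int by blast
  have "convex hull (peel Q) \<subseteq> convex hull Q" by (simp add: hull_mono peel_subset)
  also have "\<dots> = convex hull (set vs)" using st(2,3) by (metis hull_hull hull_mono subset_antisym)
  finally have z0': "z0 \<in> interior (convex hull (set vs))" using z0 interior_mono by blast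
  then have int': "interior (convex hull (set vs)) \<noteq> {}" by blast
  obtain \<sigma> where o: "\<sigma> = 1 \<or> \<sigma> = -1" "oriented \<sigma> vs" using no_alt_oriented[OF vs na int'] .
  obtain a where a: "\<And>i. ang z0 \<sigma> (cyc vs i) (a i)" "\<And>i. a i < a (Suc i)" "\<And>i. a (Suc i) < a i + pi"
    "\<And>i. a (i + length vs) = a i + 2 * pi" by (rule angle_lift_exists[OF o(2,1) vs na z0']) (rule that)
  interpret convex_step P Q vs \<sigma> z0 a
    by unfold_locales (use P Q vs st na o z0 a in auto)
  show ?thesis by (rule step_no_alt[OF st(1) r cov])
qed

subsection \<open>The boundary of the convex hull\<close>

lemma path_image_polypath:
  assumes "length ws \<ge> 2"
  shows "path_image (polypath ws) = (\<Union>i<length ws - 1. closed_segment (ws ! i) (ws ! Suc i))"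
  using assms
proof (induction ws rule: polypath.induct)
  case (4 p q r rs)
  have e: "polypath (p # q # r # rs) = linepath p q +++ polypath (q # r # rs)" by simp
  have "path_image (polypath (p # q # r # rs)) = closed_segment p q \<union> path_image (polypath (q # r # rs))"
    unfolding e using polypath_ends(1)[of "q # r # rs"] by (subst path_image_join) auto
  also have "\<dots> = (\<Union>i<length (p # q # r # rs) - 1. closed_segment ((p # q # r # rs) ! i) ((p # q # r # rs) ! Suc i))"
    using 4 by (simp add: lessThan_Suc_eq_insert_0 image_image)
  finally show ?case .
qed auto

lemma path_image_closed_poly:
  assumes "vs \<noteq> []"
  shows "path_image (closed_poly vs) = (\<Union>i<length vs. closed_segment (cyc vs i) (cyc vs (Suc i)))"
proof -
  have c: "(vs @ [hd vs]) ! i = cyc vs i" if "i \<le> length vs" for i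
    using that assms by (cases "i = length vs") (auto simp: cyc_def nth_append hd_conv_nth)
  have "length (vs @ [hd vs]) \<ge> 2" using assms by (cases vs) auto
  then have "path_image (closed_poly vs) = (\<Union>i<length vs. closed_segment ((vs @ [hd vs]) ! i) ((vs @ [hd vs]) ! Suc i))"
    unfolding closed_poly_def by (subst path_image_polypath) auto
  also have "\<dots> = (\<Union>i<length vs. closed_segment (cyc vs i) (cyc vs (Suc i)))"
    using c by (intro SUP_cong refl) auto
  finally show ?thesis .
qed

text \<open>By Krein--Milman, since the extreme points of the hull belong to \<open>P\<close> and
  are not interior.\<close>

lemma hull_frontier:
  fixes P :: "complex set"
  assumes "finite P"
  shows "convex hull P \<subseteq> convex hull (P \<inter> frontier (convex hull P))"
proof -
  let ?E = "{x. x extreme_point_of (convex hull P)}"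
  have comp: "compact (convex hull P)" using assms by (simp add: finite_imp_compact_convex_hull)
  have "?E \<subseteq> P \<inter> frontier (convex hull P)"
  proof
    fix x assume "x \<in> ?E"
    then have x: "x extreme_point_of (convex hull P)" by simp
    then have "x \<notin> interior (convex hull P)" "x \<in> convex hull P"
      using extreme_point_not_in_interior by (auto simp: extreme_point_of_def)
    then show "x \<in> P \<inter> frontier (convex hull P)"
      using extreme_point_of_convex_hull[OF x] comp by (simp add: frontier_def closure_closed compact_imp_closed)
  qed
  then show ?thesis using Krein_Milman_Minkowski[OF comp convex_convex_hull] hull_mono by blast
qed

text \<open>The competitor for the boundary curve: the points of P on the frontier of the hull, sorted by
  their angle as seen from an interior point.\<close>

lemma boundary_pcurve_exists:
  assumes P: "finite P" and z0: "z0 \<in> interior (convex hull P)"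
  obtains C where "pcurve P C" "path_image (closed_poly C) = frontier (convex hull P)"
    "crofton_const * (\<Sum>i<length C. dist (cyc C (Suc i)) (cyc C i)) \<le> integral {0..2*pi} (\<lambda>t. 2 * width P t)"
proof -
  define K where "K = convex hull P"
  have K: "convex K" "compact K" "z0 \<in> interior K"
    using P z0 by (auto simp: K_def finite_imp_compact_convex_hull)
  have PK: "P \<subseteq> K" by (simp add: K_def hull_subset)
  define Y where "Y t = radial K z0 (z0 + cis t)" for t
  have angY: "ang z0 1 (Y t) t" for t using radial_ang_curve[OF K, of 1 t] by (simp add: Y_def)
  have YF: "Y t \<in> frontier K" for t unfolding Y_def by (rule radial_frontier[OF K]) simp
  have Yang: "Y t = z" if "z \<in> frontier K" "ang z0 1 z t" for z t
    using radial_ang[OF K that(2)] radial_fix[OF K that(1)] by (simp add: Y_def)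
  have Yper: "Y (t + 2 * pi * of_nat k) = Y t" for t k
    using radial_curve_period[OF K, of 1 t k] by (simp add: Y_def)
  have fz: "z \<noteq> z0" if "z \<in> frontier K" for z using that K(3) by (auto simp: frontier_def)
  define F where "F = P \<inter> frontier K"
  have finF: "finite F" using P by (simp add: F_def)
  have "\<exists>b. 0 \<le> b \<and> b < 2 * pi \<and> ang z0 1 z b" if "z \<noteq> z0" for z
    using ang_exists[of 1 z z0 0] that by auto
  then obtain \<theta> where \<theta>: "\<And>z. z \<noteq> z0 \<Longrightarrow> 0 \<le> \<theta> z \<and> \<theta> z < 2 * pi \<and> ang z0 1 z (\<theta> z)" by metis
  have hullF: "P \<subseteq> convex hull F" using hull_frontier[OF P] PK unfolding F_def K_def by blast
  define as where "as = sorted_list_of_set (\<theta> ` F)"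
  define N where "N = length as"
  have Pne: "P \<noteq> {}" using z0 by auto
  have Fne: "F \<noteq> {}" using hullF Pne by auto
  have set_as: "set as = \<theta> ` F" using finF by (simp add: as_def)
  have N0: "N > 0" using set_as Fne by (auto simp: N_def)
  have sorted: "sorted_wrt (<) as" by (simp add: as_def)
  have asF: "Y (as ! k) \<in> F \<and> 0 \<le> as ! k \<and> as ! k < 2 * pi" if "k < N" for k
  proof -
    have "as ! k \<in> \<theta> ` F" using nth_mem[of k as] that set_as by (simp add: N_def)
    then obtain z where z: "z \<in> F" "as ! k = \<theta> z" by blast
    have zf: "z \<in> frontier K" using z by (simp add: F_def)
    show ?thesis using \<theta>[OF fz[OF zf]] Yang[OF zf] z by auto
  qed
  \<comment> \<open>The sorted angles, continued to a strictly increasing sequence that gains 2 pi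
    per period.\<close>
  define a where "a i = as ! (i mod N) + 2 * pi * of_nat (i div N)" for i
  have aper: "a (i + N) = a i + 2 * pi" for i using N0 by (simp add: a_def algebra_simps)
  have alt: "a i < a (Suc i)" for i
  proof (cases "Suc (i mod N) = N")
    case True
    then have "Suc i mod N = 0" "Suc i div N = Suc (i div N)" by (auto simp: mod_Suc div_Suc)
    moreover have "as ! (i mod N) < 2 * pi" "0 \<le> as ! 0" using asF[of "i mod N"] asF[of 0] N0 by auto
    ultimately show ?thesis by (simp add: a_def algebra_simps)
  next
    case False
    then have "Suc i mod N = Suc (i mod N)" "Suc i div N = i div N" by (auto simp: mod_Suc div_Suc)
    moreover have "Suc (i mod N) < N" using False N0 by (metis Suc_lessI mod_less_divisor)
    ultimately show ?thesis using sorted_wrt_nth_less[OF sorted, of "i mod N" "Suc (i mod N)"] by (simp add: a_def N_def)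
  qed
  have amono: "strict_mono a" using alt by (simp add: strict_mono_Suc_iff)
  have a0: "0 \<le> a i" for i using asF[of "i mod N"] N0 by (simp add: a_def)
  define C where "C = map Y as"
  have lenC: "length C = N" by (simp add: C_def N_def)
  have cycC: "cyc C i = Y (a i)" for i
    using N0 by (simp add: cyc_def C_def a_def N_def Yper)
  \<comment> \<open>Reduced modulo 2 pi, the angle of a point of \<open>F\<close> occurs in
    \<open>as\<close>, so it is a value of the increasing sequence \<open>a\<close> and not strictly
    between two consecutive ones.\<close>
  have noF: False if z: "z \<in> F" "ang z0 1 z b" "a i < b" "b < a (Suc i)" for z b i
  proof -
    have zf: "z \<in> frontier K" using z by (simp add: F_def)
    have \<theta>z: "0 \<le> \<theta> z" "\<theta> z < 2 * pi" "ang z0 1 z (\<theta> z)" using \<theta>[OF fz[OF zf]] by auto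
    have "cis b = cis (\<theta> z)" using z(2) \<theta>z(3) unfolding ang_def by (metis mult_cancel_left mult_1 norm_eq_zero of_real_eq_0_iff right_minus_eq)
    then have "cis (b - \<theta> z) = 1" by (metis cis_divide cis_neq_zero divide_self)
    then have "cos (b - \<theta> z) = 1" by (metis cis.simps(1) one_complex.simps(1))
    then obtain m :: int where m: "b - \<theta> z = of_int m * 2 * pi" using cos_one_2pi_int by blast
    have "b > 0" using z(3) a0[of i] by linarith
    have "m \<ge> 0"
    proof (rule ccontr)
      assume "\<not> m \<ge> 0"
      then have "of_int m \<le> (-1::real)" by simp
      then have "of_int m * (2 * pi) \<le> (-1) * (2 * pi)" by (intro mult_right_mono) auto
      then show False using m \<open>b > 0\<close> \<theta>z by (simp only: mult.assoc)
    qed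
    then obtain k where k: "m = int k" using nonneg_int_cases by blast
    obtain j where j: "j < N" "as ! j = \<theta> z"
      using set_as z(1) by (metis N_def image_eqI in_set_conv_nth)
    have "a (j + k * N) = b" using j m k N0 by (simp add: a_def eq_diff_eq mult.commute mult.left_commute)
    then have "a i < a (j + k * N)" "a (j + k * N) < a (Suc i)" using z by auto
    then show False using amono by (simp add: strict_mono_less)
  qed
  \<comment> \<open>Every direction attains its maximum over \<open>K\<close> at a point of
    \<open>F\<close>, strictly beyond \<open>z0\<close>.\<close>
  have far: "\<exists>z\<in>F. u \<bullet> z0 < u \<bullet> z \<and> (\<forall>x\<in>K. u \<bullet> x \<le> u \<bullet> z)" if u: "u \<noteq> 0" for u
  proof -
    obtain z where z: "z \<in> F" "u \<bullet> z = Max ((\<lambda>x. u \<bullet> x) ` P)"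
      using hull_extremes_attained(1)[OF P Pne _ hullF, of u] F_def by blast
    have mx: "u \<bullet> x \<le> u \<bullet> z" if "x \<in> K" for x
      using inner_hull_bounds(1)[OF P, of x u] that z by (simp add: K_def)
    have "K \<subseteq> {x. u \<bullet> x \<le> u \<bullet> z}" using mx by blast
    then have "z0 \<in> interior {x. u \<bullet> x \<le> u \<bullet> z}" using K(3) interior_mono by blast
    then have "u \<bullet> z0 < u \<bullet> z" using interior_halfspace_le[OF u] by blast
    then show ?thesis using z mx by blast
  qed
  have Fang: "\<exists>b. a i \<le> b \<and> b < a i + 2 * pi \<and> ang z0 1 z b \<and> Y b = z" if "z \<in> frontier K" for z i
    using ang_exists[of 1 z z0 "a i"] fz[OF that] Yang[OF that] by (metis)
  \<comment> \<open>A gap of at least \<open>pi\<close> would leave an open half-plane bounded by a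
    line through \<open>z0\<close> without points of \<open>F\<close>, against
    \<open>far\<close>.\<close>
  have gap: "a (Suc i) < a i + pi" for i
  proof (rule ccontr)
    assume ge: "\<not> a (Suc i) < a i + pi"
    define u where "u = \<i> * cis (a i)"
    obtain z where z: "z \<in> F" "u \<bullet> z0 < u \<bullet> z" using far[of u] by (auto simp: u_def)
    have zf: "z \<in> frontier K" using z by (simp add: F_def)
    obtain b where b: "a i \<le> b" "b < a i + 2 * pi" "ang z0 1 z b" using Fang[OF zf] by blast
    have "u \<bullet> z - u \<bullet> z0 = u \<bullet> (z - z0)" by (simp add: inner_diff_right)
    also have "\<dots> = u \<bullet> (of_real (norm (z - z0)) * cis b)" using b(3) by (metis ang_def mult_1)
    also have "\<dots> = norm (z - z0) * sin (b - a i)"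
      by (simp add: u_def inner_complex_def sin_diff algebra_simps)
    finally have "norm (z - z0) * sin (b - a i) > 0" using z by simp
    then have s: "sin (b - a i) > 0" by (metis mult_nonneg_nonpos norm_ge_zero not_less)
    have "b - a i < pi"
    proof (rule ccontr)
      assume "\<not> b - a i < pi"
      then have "sin (b - a i - pi) \<ge> 0" using b by (intro sin_ge_zero) auto
      then show False using s by (simp add: sin_diff)
    qed
    moreover have "b \<noteq> a i" using s by auto
    ultimately show False using noF[OF z(1) b(3), of i] b(1) ge by simp
  qed
  have AB: "Y (a i) \<noteq> Y (a (Suc i))" "cr (Y (a (Suc i)) - Y (a i)) (z0 - Y (a i)) > 0" for i
  proof -
    have "1 * cr (Y (a i) - z0) (Y (a (Suc i)) - z0) = norm (Y (a i) - z0) * norm (Y (a (Suc i)) - z0) * sin (a (Suc i) - a i)"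
      by (rule ang_cr[OF _ angY angY]) simp
    also have "\<dots> > 0" using fz[OF YF] alt[of i] gap[of i] by (intro mult_pos_pos sin_gt_zero) auto
    finally show "cr (Y (a (Suc i)) - Y (a i)) (z0 - Y (a i)) > 0" by (simp add: cr_triangle)
    then show "Y (a i) \<noteq> Y (a (Suc i))" by (auto simp: cr_def)
  qed
  \<comment> \<open>If the frontier bulged beyond the chord, the farthest point in that direction
    could be taken in \<open>F\<close>, hence outside this arc, and the boundary would cross a line
    parallel to the chord four times.\<close>
  have beyond: "\<not> cr (Y (a (Suc i)) - Y (a i)) (Y b - Y (a i)) < 0" if b: "a i \<le> b" "b \<le> a (Suc i)" for i b
  proof
    assume neg: "cr (Y (a (Suc i)) - Y (a i)) (Y b - Y (a i)) < 0"
    define n where "n = - (\<i> * (Y (a (Suc i)) - Y (a i)))"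
    have n: "n \<bullet> x - n \<bullet> Y (a i) = - cr (Y (a (Suc i)) - Y (a i)) (x - Y (a i))" for x
      by (simp add: n_def cr_inner inner_diff_right)
    have nB: "n \<bullet> Y (a (Suc i)) = n \<bullet> Y (a i)" using n[of "Y (a (Suc i))"] by simp
    have nYb: "n \<bullet> Y b > n \<bullet> Y (a i)" using n[of "Y b"] neg by simp
    have n0: "n \<noteq> 0" using AB(1)[of i] by (simp add: n_def)
    obtain z where z: "z \<in> F" "\<And>x. x \<in> K \<Longrightarrow> n \<bullet> x \<le> n \<bullet> z" using far[OF n0] by blast
    have zf: "z \<in> frontier K" using z by (simp add: F_def)
    have "Y b \<in> K" using YF frontier_in_K[OF K] by blast
    then have nz: "n \<bullet> z > n \<bullet> Y (a i)" using z(2) nYb by fastforce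
    obtain c where c: "a i \<le> c" "c < a i + 2 * pi" "ang z0 1 z c" "Y c = z" using Fang[OF zf] by blast
    have "c \<noteq> a i" "c \<noteq> a (Suc i)" using nz nB c by auto
    then have cc: "a (Suc i) \<le> c" using noF[OF z(1) c(3), of i] c(1) by force
    define e where "e = (n \<bullet> Y (a i) + min (n \<bullet> Y b) (n \<bullet> z)) / 2"
    have e: "n \<bullet> Y (a i) < e" "e < n \<bullet> Y b" "e < n \<bullet> z" using nYb nz by (auto simp: e_def min_def)
    show False
    proof (rule radial_curve_no_alternation[OF K, of 1 b "a (Suc i)" c "a i + 2 * pi" e n])
      show "n \<bullet> radial K z0 (z0 + cis (1 * (a i + 2 * pi))) < e" using e(1) Yper[of "a i" 1] by (simp add: Y_def)
    qed (use b cc c e nB in \<open>auto simp: Y_def\<close>)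
  qed
  \<comment> \<open>The chord is the arc: for a chord point off the frontier, the radial image would
    lie beyond the chord.\<close>
  have segY: "s = Y b" if s: "s \<in> closed_segment (Y (a i)) (Y (a (Suc i)))" and b: "a i \<le> b" "b \<le> a (Suc i)" "ang z0 1 s b" for s b i
  proof -
    let ?A = "Y (a i)" and ?B = "Y (a (Suc i))"
    have sK: "s \<in> K" using s closed_segment_subset[OF _ _ K(1)] YF frontier_in_K[OF K] by blast
    define d where "d = rdist K z0 (s - z0)"
    have sz: "s - z0 \<noteq> 0" using b(3) by (simp add: ang_def)
    have d1: "1 \<le> d" unfolding d_def by (rule rdist_max[OF K sz]) (use sK in simp)
    have Yb: "Y b = z0 + d *\<^sub>R (s - z0)" using radial_ang[OF K b(3)] by (simp add: Y_def radial_def d_def)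
    obtain t where "s = (1 - t) *\<^sub>R ?A + t *\<^sub>R ?B" using s by (auto simp: in_segment)
    then have "s - ?A = t *\<^sub>R (?B - ?A)" by (simp add: algebra_simps)
    then have s0: "cr (?B - ?A) (s - ?A) = 0" by (simp only: cr_scale_right cr_self)
    have "Y b - ?A = d *\<^sub>R (s - ?A) + (1 - d) *\<^sub>R (z0 - ?A)" unfolding Yb by (simp add: algebra_simps)
    then have "cr (?B - ?A) (Y b - ?A) = d * cr (?B - ?A) (s - ?A) + (1 - d) * cr (?B - ?A) (z0 - ?A)"
      by (simp only: cr_add_right cr_scale_right)
    then have eq: "cr (?B - ?A) (Y b - ?A) = (1 - d) * cr (?B - ?A) (z0 - ?A)" unfolding s0 by simp
    have "d = 1"
    proof (rule ccontr)
      assume "d \<noteq> 1"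
      then have "(1 - d) * cr (?B - ?A) (z0 - ?A) < 0" using d1 AB(2)[of i] by (intro mult_neg_pos) auto
      then show False using beyond[OF b(1,2)] eq by simp
    qed
    then show ?thesis using Yb by simp
  qed
  have seg_ang: "\<exists>b\<in>{a i..a (Suc i)}. ang z0 1 s b \<and> s = Y b" if s: "s \<in> closed_segment (Y (a i)) (Y (a (Suc i)))" for s i
  proof -
    obtain b where "b \<in> {a i..a (Suc i)}" "ang z0 1 s b"
      using ang_segment[OF _ angY angY less_imp_le[OF alt] gap s] by auto
    then show ?thesis using segY[OF s, of b] by auto
  qed
  have Cne: "C \<noteq> []" using lenC N0 by auto
  show thesis
  proof (rule that[of C])
    show "pcurve P C" unfolding pcurve_def
    proof (intro conjI allI impI)
      have "N \<noteq> 1"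
      proof
        assume "N = 1"
        then have "a 1 = a 0 + 2 * pi" using aper[of 0] by simp
        then show False using gap[of 0] by simp
      qed
      then show "2 \<le> length C" using lenC N0 by simp
      show "set C \<subseteq> P"
      proof
        fix x assume "x \<in> set C"
        then obtain k where "k < N" "x = Y (as ! k)" by (auto simp: C_def N_def in_set_conv_nth)
        then show "x \<in> P" using asF by (auto simp: F_def)
      qed
      fix i
      show "cyc C i \<noteq> cyc C (Suc i)" unfolding cycC by (rule AB)
      show "open_segment (cyc C i) (cyc C (Suc i)) \<inter> P = {}" unfolding cycC
      proof (rule ccontr)
        assume "open_segment (Y (a i)) (Y (a (Suc i))) \<inter> P \<noteq> {}"
        then obtain x where x: "x \<in> open_segment (Y (a i)) (Y (a (Suc i)))" "x \<in> P" by blast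
        then obtain b where b: "b \<in> {a i..a (Suc i)}" "ang z0 1 x b" "x = Y b"
          using seg_ang open_closed_segment by blast
        have "b \<noteq> a i" "b \<noteq> a (Suc i)" using b(3) x(1) by (auto simp: open_segment_def)
        then have "a i < b" "b < a (Suc i)" using b(1) by auto
        moreover have "x \<in> F" using x(2) b(3) YF by (simp add: F_def)
        ultimately show False using noF b(2) by blast
      qed
    qed
    show "path_image (closed_poly C) = frontier (convex hull P)"
      unfolding path_image_closed_poly[OF Cne] lenC cycC K_def[symmetric]
    proof
      show "(\<Union>i<N. closed_segment (Y (a i)) (Y (a (Suc i)))) \<subseteq> frontier K" using seg_ang YF by blast
      show "frontier K \<subseteq> (\<Union>i<N. closed_segment (Y (a i)) (Y (a (Suc i))))"
      proof
        fix y assume y: "y \<in> frontier K"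
        obtain b where b: "a 0 \<le> b" "b < a 0 + 2 * pi" "Y b = y" using Fang[OF y, of 0] by blast
        obtain i where i: "i < N" "a i \<le> b" "b < a (Suc i)"
          using lift_bracket[of a b N] b aper[of 0] by auto
        obtain r where r: "r > 0" "z0 + of_real r * cis (1 * b) \<in> closed_segment (Y (a i)) (Y (a (Suc i)))"
          using ang_cone[OF _ angY angY i(2) less_imp_le[OF i(3)] gap] by blast
        have "ang z0 1 (z0 + of_real r * cis (1 * b)) b" by (rule angI[OF _ r(1)]) simp
        then have "z0 + of_real r * cis (1 * b) = Y b" using segY[OF r(2) i(2) less_imp_le[OF i(3)]] by blast
        then show "y \<in> (\<Union>i<N. closed_segment (Y (a i)) (Y (a (Suc i))))" using r(2) b(3) i(1) by auto
      qed
    qed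
    have "(\<Sum>i<N. ennreal (dist (Y (a (Suc i))) (Y (a i)))) \<le> variation Y (a 0) (a 0 + 2 * pi)"
      by (rule variation_upper) (use aper[of 0] alt in \<open>auto intro: less_imp_le\<close>)
    also have "\<dots> \<le> ennreal (integral {0..2*pi} (\<lambda>t. 2 * width P t) / crofton_const)"
      using radial_curve_variation[OF K _ P K_def, of 1 "a 0"] unfolding Y_def[abs_def] by simp
    finally have le: "ennreal (\<Sum>i<N. dist (Y (a (Suc i))) (Y (a i))) \<le> ennreal (integral {0..2*pi} (\<lambda>t. 2 * width P t) / crofton_const)"
      by (subst (asm) sum_ennreal) auto
    have "dist (Y (a (Suc 0))) (Y (a 0)) \<le> (\<Sum>i<N. dist (Y (a (Suc i))) (Y (a i)))"
      using N0 by (intro member_le_sum) auto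
    moreover have "dist (Y (a (Suc 0))) (Y (a 0)) > 0" using AB(1)[of 0] by simp
    ultimately have "(\<Sum>i<N. dist (Y (a (Suc i))) (Y (a i))) > 0" by (rule less_le_trans[rotated])
    then have "(\<Sum>i<N. dist (Y (a (Suc i))) (Y (a i))) \<le> integral {0..2*pi} (\<lambda>t. 2 * width P t) / crofton_const"
      using le by (simp add: ennreal_le_iff2)
    then show "crofton_const * (\<Sum>i<length C. dist (cyc C (Suc i)) (cyc C i)) \<le> integral {0..2*pi} (\<lambda>t. 2 * width P t)"
      unfolding lenC cycC using crofton_const_pos by (simp add: field_simps)
  qed
qed

lemma hull_boundary_curve_covers:
  assumes P: "finite P" and b: "hull_boundary_curve P vs"
  shows "set vs \<subseteq> P" "P \<subseteq> convex hull (set vs)"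
proof -
  show "set vs \<subseteq> P" using b by (auto simp: hull_boundary_curve_def pcurve_def)
  have "vs \<noteq> []" using b by (auto simp: hull_boundary_curve_def pcurve_def)
  then have "path_image (closed_poly vs) \<subseteq> convex hull (set vs)"
    using polypath_image_subset_hull[of "vs @ [hd vs]"] by (simp add: closed_poly_def insert_absorb)
  then have "P \<inter> frontier (convex hull P) \<subseteq> convex hull (set vs)" using b by (auto simp: hull_boundary_curve_def)
  then have "convex hull (P \<inter> frontier (convex hull P)) \<subseteq> convex hull (set vs)" by (simp add: hull_minimal)
  then show "P \<subseteq> convex hull (set vs)" using hull_frontier[OF P] hull_subset[of P convex] by blast
qed

text \<open>Minimality makes the boundary curve at most as long as the competitor and so as the
  perimeter, which is the hypothesis of \<open>short_tour_no_alt\<close>.\<close>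

lemma hull_boundary_curve_no_alt:
  assumes P: "finite P" and b: "hull_boundary_curve P vs" and int: "interior (convex hull P) \<noteq> {}"
  shows "no_alt (cyc vs) (length vs)"
proof -
  note cov = hull_boundary_curve_covers[OF P b]
  have ne: "vs \<noteq> []" using b by (auto simp: hull_boundary_curve_def pcurve_def)
  obtain z0 where "z0 \<in> interior (convex hull P)" using int by blast
  then obtain C where C: "pcurve P C" "path_image (closed_poly C) = frontier (convex hull P)"
    "crofton_const * (\<Sum>i<length C. dist (cyc C (Suc i)) (cyc C i)) \<le> integral {0..2*pi} (\<lambda>t. 2 * width P t)"
    using boundary_pcurve_exists[OF P] by blast
  have Cne: "C \<noteq> []" using C by (auto simp: pcurve_def)
  have "path_length (closed_poly vs) \<le> path_length (closed_poly C)" using b C by (auto simp: hull_boundary_curve_def)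
  then have "psum dist (vs @ [hd vs]) \<le> psum dist (C @ [hd C])"
    by (simp add: closed_poly_def path_length_polypath psum_nonneg)
  then have "crofton_const * (\<Sum>i<length vs. dist (cyc vs (Suc i)) (cyc vs i)) \<le> integral {0..2*pi} (\<lambda>t. 2 * width P t)"
    unfolding cyc_psum_closed[OF ne] cyc_psum_closed[OF Cne]
    using C(3) crofton_const_pos by (meson less_imp_le mult_left_mono order_trans)
  then show ?thesis by (rule short_tour_no_alt[OF ne P cov])
qed

lemma layers_closed:
  "P \<inter> convex hull ((peel ^^ i) P) = (peel ^^ i) P"
proof (induction i)
  case 0
  show ?case using hull_subset[of P convex] by auto
next
  case (Suc i)
  then show ?case using peel_closed by simp
qed

lemma pcurve_two_points:
  assumes "pcurve P vs"
  obtains x y where "x \<in> set vs" "y \<in> set vs" "x \<noteq> y"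
proof -
  have "vs \<noteq> []" using assms by (auto simp: pcurve_def)
  then show thesis using that cyc_in_set pcurve_edge(2)[OF assms, of 0] by metis
qed

theorem theorem5:
  fixes P :: "complex set" and beta gamma0 :: "complex list" and n m :: nat
  assumes "finite P"
    and "hull_boundary_curve P beta"
    and "pcurve P gamma0"
    and "hcs_collapse_steps P gamma0 n"
    and "hcs_collapse_steps P beta m"
  shows "n \<le> m"
proof (rule ccontr)
  assume "\<not> n \<le> m"
  then have mn: "m < n" by simp
  note P = assms(1)
  obtain g where g: "g 0 = gamma0" "\<And>i. i < n \<Longrightarrow> length (g i) \<ge> 2 \<and> hcs_step P (g i) (g (Suc i))"
    using assms(4) by (auto simp: hcs_collapse_steps_def)
  obtain b where b: "b 0 = beta" "\<And>i. i < m \<Longrightarrow> length (b i) \<ge> 2 \<and> hcs_step P (b i) (b (Suc i))" "length (b m) \<le> 1"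
    using assms(5) by (auto simp: hcs_collapse_steps_def)
  let ?Q = "\<lambda>i. (peel ^^ i) P"
  \<comment> \<open>For \<open>i \<le> m < n\<close> the curve \<open>g i\<close> still admits a
    step, so it has not collapsed.\<close>
  have gP: "pcurve P (g i)" if "i \<le> m" for i using g(2)[of i] that mn by (auto simp: hcs_step_def)
  have gQ: "set (g i) \<subseteq> ?Q i" if "i \<le> m" for i
    using that
  proof (induction i)
    case 0
    then show ?case using gP[of 0] by (simp add: pcurve_def)
  next
    case (Suc i)
    have "hcs_step P (g i) (g (Suc i))" "set (g i) \<subseteq> ?Q i" using Suc g(2)[of i] mn by auto
    from hcs_step_in_peel[OF P layers_closed this gP[OF Suc.prems]] show ?case by simp
  qed
  have two: "\<exists>x y. x \<in> ?Q i \<and> y \<in> ?Q i \<and> x \<noteq> y" if "i \<le> m" for i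
    using pcurve_two_points[OF gP[OF that]] gQ[OF that] by (metis subsetD)
  \<comment> \<open>At \<open>m\<close> the curve may have collapsed, so containment in the layer
    and convexity are claimed for \<open>i < m\<close> only, while the covering of the layer extends
    to \<open>m\<close>, where it gives the contradiction.\<close>
  have cov: "?Q i \<subseteq> convex hull (set (b i)) \<and>
     (i < m \<longrightarrow> set (b i) \<subseteq> ?Q i \<and> (interior (convex hull ?Q i) = {} \<or> no_alt (cyc (b i)) (length (b i))))"
    if "i \<le> m" for i
    using that
  proof (induction i)
    case 0
    then show ?case
      using hull_boundary_curve_covers[OF P assms(2)] hull_boundary_curve_no_alt[OF P assms(2)] b(1) by auto
  next
    case (Suc i)
    then have im: "i < m" by simp
    have IH: "?Q i \<subseteq> convex hull (set (b i))" "set (b i) \<subseteq> ?Q i"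
      "interior (convex hull ?Q i) = {} \<or> no_alt (cyc (b i)) (length (b i))" using Suc by auto
    have st: "hcs_step P (b i) (b (Suc i))" using b(2)[OF im] by simp
    obtain x y where xy: "x \<in> peel (?Q i)" "y \<in> peel (?Q i)" "x \<noteq> y" using two[OF Suc.prems] by auto
    have c: "peel (?Q i) \<subseteq> convex hull (set (b (Suc i)))"
      by (rule hcs_step_covers[OF P layers_closed st IH(2,1,3) xy])
    show ?case
    proof (intro conjI impI)
      show "?Q (Suc i) \<subseteq> convex hull (set (b (Suc i)))" using c by simp
      assume sm: "Suc i < m"
      have r: "pcurve P (b (Suc i))" using b(2)[OF sm] by (simp add: hcs_step_def)
      show "set (b (Suc i)) \<subseteq> ?Q (Suc i)"
        using hcs_step_in_peel[OF P layers_closed st IH(2) r] by simp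
      \<comment> \<open>Layers shrink: if the next one has interior, so has the present one, and the
        present curve is convex by induction.\<close>
      show "interior (convex hull ?Q (Suc i)) = {} \<or> no_alt (cyc (b (Suc i))) (length (b (Suc i)))"
      proof (cases "interior (convex hull (peel (?Q i))) = {}")
        case False
        have "convex hull (peel (?Q i)) \<subseteq> convex hull (?Q i)" by (simp add: hull_mono peel_subset)
        then have "interior (convex hull ?Q i) \<noteq> {}" using False interior_mono by blast
        then have "no_alt (cyc (b i)) (length (b i))" using IH(3) by blast
        from hcs_step_no_alt[OF P layers_closed st IH(2,1) this False r c] show ?thesis by simp
      qed simp
    qed
  qed
  obtain x y where xy: "x \<in> ?Q m" "y \<in> ?Q m" "x \<noteq> y" using two[of m] by auto
  have "b m = [] \<or> (\<exists>z. b m = [z])" using b(3) by (cases "b m") auto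
  then have "convex hull (set (b m)) = {} \<or> (\<exists>z. convex hull (set (b m)) = {z})" by auto
  then show False using cov[of m] xy by (metis empty_iff order_refl singletonD subsetD)
qed

end
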